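(* Let $n\geq1$, and let $0<\sigma<1/2$ if $n=1$ and $\sigma\in(0,1/2)\cup(1/2,1)$ if $n\geq 2$. Assume $S_{n,\sigma}(\mathbb{R}^n_+)<S_{n,\sigma}(\mathbb{R}^n)$. Let $(u_k)\subset\mathring H^\sigma(\mathbb{R}^n_+)$ be a minimizing sequence for $S_{n,\sigma}(\mathbb{R}^n_+)$ with $I_{n,\sigma,\mathbb{R}^n_+}[u_k]=1$ for all $k$. Then $(u_k)$ is relatively compact in $\mathring H^\sigma(\mathbb{R}^n_+)$ up to translations parallel to the boundary and dilations, i.e. after passing to a subsequence there are $\lambda_k>0$ and $a_k\in\mathbb{R}^{n-1}$ such that $\lambda_k^{\frac{n-2\sigma}{2}}u_k(\lambda_k(x'-a_k),\lambda_k x_n)$ converges strongly in $\mathring H^\sigma(\mathbb{R}^n_+)$. In particular, the infimum $S_{n,\sigma}(\mathbb{R}^n_+)$ is attained.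
   Context: For an open set $\Omega\subset\mathbb{R}^n$ and a function $u$ on $\Omega$ let $I_{n,\sigma,\Omega}[u]=\iint_{\Omega\times\Omega}\frac{(u(x)-u(y))^2}{|x-y|^{n+2\sigma}}\,dx\,dy$. $\mathring H^\sigma(\mathbb{R}^n)$ denotes the space of real functions $u$ on $\mathbb{R}^n$ with $I_{n,\sigma,\mathbb{R}^n}[u]<\infty$ and $|\{|u|>\tau\}|<\infty$ for all $\tau>0$, and $S_{n,\sigma}(\mathbb{R}^n)=\inf_{0\not\equiv u\in\mathring H^\sigma(\mathbb{R}^n)} I_{n,\sigma,\mathbb{R}^n}[u]\big/\big(\int_{\mathbb{R}^n}|u|^{\frac{2n}{n-2\sigma}}dx\big)^{\frac{n-2\sigma}{n}}$. $\mathbb{R}^n_+=\{(x',x_n)\in\mathbb{R}^{n-1}\times\mathbb{R}: x_n>0\}$; $\mathring H^\sigma(\mathbb{R}^n_+)$ is the completion of $C^1_c(\mathbb{R}^n_+)$ with respect to the quadratic form $I_{n,\sigma,\mathbb{R}^n_+}$ (it embeds into $L^{\frac{2n}{n-2\sigma}}(\mathbb{R}^n_+)$), and $S_{n,\sigma}(\mathbb{R}^n_+)=\inf_{0\not\equiv u\in\mathring H^\sigma(\mathbb{R}^n_+)} I_{n,\sigma,\mathbb{R}^n_+}[u]\big/\big(\int_{\mathbb{R}^n_+}|u|^{\frac{2n}{n-2\sigma}}dx\big)^{\frac{n-2\sigma}{n}}$. A minimizing sequence is a sequence of nonzero elements along which this quotient tends to $S_{n,\sigma}(\mathbb{R}^n_+)$.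 *)

theory Defs
  imports "HOL-Analysis.Analysis"
begin

text \<open>Ambient space R^n is a euclidean space 'a with DIM('a) = n.
  A fixed basis vector plays the role of e_n; the half space is {x. x \<bullet> e_n > 0},
  and R^{n-1} is identified with the hyperplane {a. a \<bullet> e_n = 0}.\<close>

definition en :: "'a::euclidean_space" where
  "en = (SOME b. b \<in> Basis)"

definition halfspace :: "'a::euclidean_space set" where
  "halfspace = {x. x \<bullet> en > 0}"

definition Ifrac :: "real \<Rightarrow> 'a::euclidean_space set \<Rightarrow> ('a \<Rightarrow> real) \<Rightarrow> ennreal" where
  "Ifrac \<sigma> \<Omega> u = (\<integral>\<^sup>+ z. indicator (\<Omega> \<times> \<Omega>) z *
      ennreal ((u (fst z) - u (snd z))\<^sup>2 / norm (fst z - snd z) powr (real DIM('a) + 2 * \<sigma>))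
      \<partial>(lborel :: ('a \<times> 'a) measure))"

definition pcrit :: "real \<Rightarrow> 'a::euclidean_space itself \<Rightarrow> real" where
  "pcrit \<sigma> _ = 2 * real DIM('a) / (real DIM('a) - 2 * \<sigma>)"

definition Lpow :: "real \<Rightarrow> 'a::euclidean_space set \<Rightarrow> ('a \<Rightarrow> real) \<Rightarrow> ennreal" where
  "Lpow p \<Omega> u = (\<integral>\<^sup>+ x \<in> \<Omega>. ennreal (\<bar>u x\<bar> powr p) \<partial>lborel)"

definition C1c :: "'a::euclidean_space set \<Rightarrow> ('a \<Rightarrow> real) set" where
  "C1c \<Omega> = {\<phi>. (\<exists>D :: 'a \<Rightarrow> ('a \<Rightarrow>\<^sub>L real).
        (\<forall>x. (\<phi> has_derivative blinfun_apply (D x)) (at x)) \<and> continuous_on UNIV D)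
      \<and> compact (closure {x. \<phi> x \<noteq> 0}) \<and> closure {x. \<phi> x \<noteq> 0} \<subseteq> \<Omega>}"

text \<open>Elements of the completion of C^1_c(R^n_+) w.r.t. I_{R^n_+}, realised (via the
  embedding into L^{2n/(n-2 sigma)}) as measurable functions vanishing outside the half space
  that are limits of C^1_c functions both in the I-seminorm and in L^{2n/(n-2 sigma)}.\<close>
definition Hhalf :: "real \<Rightarrow> ('a::euclidean_space \<Rightarrow> real) set" where
  "Hhalf \<sigma> = {u. u \<in> borel_measurable lborel \<and> (\<forall>x. x \<notin> halfspace \<longrightarrow> u x = 0) \<and>
      (\<exists>\<phi>. (\<forall>k. \<phi> k \<in> C1c halfspace) \<and>
         (\<lambda>k. Ifrac \<sigma> halfspace (\<lambda>x. \<phi> k x - u x)) \<longlonglongrightarrow> 0 \<and>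
         (\<lambda>k. Lpow (pcrit \<sigma> TYPE('a)) halfspace (\<lambda>x. \<phi> k x - u x)) \<longlonglongrightarrow> 0)}"

definition Hfull :: "real \<Rightarrow> ('a::euclidean_space \<Rightarrow> real) set" where
  "Hfull \<sigma> = {u. u \<in> borel_measurable lborel \<and> Ifrac \<sigma> UNIV u < \<infinity> \<and>
      (\<forall>\<tau>>0. emeasure lborel {x. \<bar>u x\<bar> > \<tau>} < \<infinity>)}"

definition Quot :: "real \<Rightarrow> 'a::euclidean_space set \<Rightarrow> ('a \<Rightarrow> real) \<Rightarrow> real" where
  "Quot \<sigma> \<Omega> u = enn2real (Ifrac \<sigma> \<Omega> u) /
      enn2real (Lpow (pcrit \<sigma> TYPE('a)) \<Omega> u) powr ((real DIM('a) - 2 * \<sigma>) / real DIM('a))"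

text \<open>Admissible (nonzero) competitors: not a.e. zero. The finiteness of \<integral>|u|^p is
  automatic by the fractional Sobolev inequality; it is recorded to make the quotient meaningful.\<close>
definition Shalf :: "real \<Rightarrow> 'a::euclidean_space itself \<Rightarrow> real" where
  "Shalf \<sigma> _ = (INF u \<in> {u :: 'a \<Rightarrow> real. u \<in> Hhalf \<sigma> \<and> 0 < Lpow (pcrit \<sigma> TYPE('a)) halfspace u
      \<and> Lpow (pcrit \<sigma> TYPE('a)) halfspace u < \<infinity>}. Quot \<sigma> halfspace u)"

definition Sfull :: "real \<Rightarrow> 'a::euclidean_space itself \<Rightarrow> real" where
  "Sfull \<sigma> _ = (INF u \<in> {u :: 'a \<Rightarrow> real. u \<in> Hfull \<sigma> \<and> 0 < Lpow (pcrit \<sigma> TYPE('a)) UNIV u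
      \<and> Lpow (pcrit \<sigma> TYPE('a)) UNIV u < \<infinity>}. Quot \<sigma> UNIV u)"

end

theory Submission
  imports Defs "HOL-Complex_Analysis.Great_Picard"
begin

text \<open>
  The improved Sobolev inequality (a Hedberg-type pointwise estimate) bounds the critical norm by the
  form and the averages over balls, so a minimising sequence of test functions has an average of
  critical size on some ball of the half space. Rescaling that ball to unit size, one extracts an
  almost everywhere limit \<open>U \<noteq> 0\<close> of the even extensions, whose form is bounded on the whole space.
  By the Brezis-Lieb lemma both the form and the critical norm split between \<open>U\<close> and the remainder.
  If the rescaled balls stay at bounded distance from the boundary, strict concavity of
  \<open>t \<mapsto> t\<^sup>2\<^sup>/\<^sup>p\<close> forces the remainder to vanish. If not, \<open>U\<close> lives on the whole space, and
  the strict inequality between the two Sobolev constants gives a contradiction.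
\<close>

section \<open>The Brezis-Lieb lemma\<close>

text \<open>The limit \<open>U\<close> is found through convergence in measure, so nothing places it
  a priori in the closure of the test functions, and \<open>\<psi> k - U\<close> cannot be inserted
  into the quotient. Midpoint combinations of the sequence itself repair this: the parallelogram
  identity makes them Cauchy in the form, and they inherit the limit \<open>U\<close>. Their compact
  supports eventually fit into the rescaled half spaces, also when these exhaust the whole space.
  Positivity of \<open>Shalf\<close>, by which masses are bounded through the form, comes from
  \<open>0 \<le> Shalf < Sfull\<close> and from \<open>Sfull / 4 \<le> Shalf\<close>, where 4 counts
  the quadrants of an even reflection. The energy balance: with form 1 the masses tend to L, where S
  L^(2/p) = 1. A profile of mass l > 0 and form A leaves S (L - l)^(2/p) \<le> 1 - A, while A is at
  least S l^(2/p) near the boundary and at least F l^(2/p) far from it, with S and F the two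
  constants. Near the boundary this leaves only l = L and A = 1; far from it S < F excludes
  everything.\<close>

definition pint :: "real \<Rightarrow> 'b measure \<Rightarrow> ('b \<Rightarrow> real) \<Rightarrow> ennreal" where
  "pint q M f = (\<integral>\<^sup>+ x. ennreal (\<bar>f x\<bar> powr q) \<partial>M)"

text \<open>The coefficient of |a|^q can be made as small as desired at the price of a large one for
  |b|^q. If b is small relative to a, then |a + b| / |a| is near 1 and continuity of t^q at 1
  applies; otherwise |a| is at most a multiple of |b|.\<close>

lemma abs_powr_add_bound:
  fixes q e :: real
  assumes "0 < q" "0 < e"
  obtains C where "0 \<le> C"
    "\<And>a b::real. \<bar>\<bar>a + b\<bar> powr q - \<bar>a\<bar> powr q\<bar> \<le> e * \<bar>a\<bar> powr q + C * \<bar>b\<bar> powr q"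
proof -
  have "isCont (\<lambda>t::real. t powr q) 1" by (intro continuous_intros) auto
  then obtain d where d: "0 < d" "\<And>t. dist t 1 < d \<Longrightarrow> dist (t powr q) (1 powr q) < e"
    using \<open>0 < e\<close> unfolding continuous_at_eps_delta by blast
  \<comment> \<open>If |b| exceeds (d/2) |a|, then both |a| and |a + b| are at most (1 + 2/d)
    |b|.\<close>
  define C where "C = (1 + 1 / (d/2)) powr q"
  show thesis
  proof
    show "0 \<le> C" by (simp add: C_def)
    fix a b :: real
    show "\<bar>\<bar>a + b\<bar> powr q - \<bar>a\<bar> powr q\<bar> \<le> e * \<bar>a\<bar> powr q + C * \<bar>b\<bar> powr q"
    proof (cases "\<bar>b\<bar> \<le> d/2 * \<bar>a\<bar> \<and> a \<noteq> 0")
      case True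
      define t where "t = \<bar>a + b\<bar> / \<bar>a\<bar>"
      have ab: "\<bar>a + b\<bar> = t * \<bar>a\<bar>" "0 \<le> t" using True by (auto simp: t_def)
      have "\<bar>\<bar>a + b\<bar> - \<bar>a\<bar>\<bar> \<le> d/2 * \<bar>a\<bar>" using True by linarith
      then have "\<bar>t - 1\<bar> * \<bar>a\<bar> \<le> d/2 * \<bar>a\<bar>"
        unfolding ab(1) by (metis abs_idempotent abs_mult left_diff_distrib mult_1)
      then have "dist t 1 < d" using True d(1) by (simp add: dist_real_def)
      then have "\<bar>t powr q - 1\<bar> \<le> e" using d(2) by (fastforce simp: dist_real_def)
      then have "\<bar>t powr q - 1\<bar> * \<bar>a\<bar> powr q \<le> e * \<bar>a\<bar> powr q" by (intro mult_right_mono) auto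
      moreover have "\<bar>\<bar>a + b\<bar> powr q - \<bar>a\<bar> powr q\<bar> = \<bar>t powr q - 1\<bar> * \<bar>a\<bar> powr q"
      proof -
        have "\<bar>a + b\<bar> powr q - \<bar>a\<bar> powr q = (t powr q - 1) * \<bar>a\<bar> powr q"
          unfolding ab(1) using ab(2) by (simp add: powr_mult algebra_simps)
        then show ?thesis by (simp add: abs_mult)
      qed
      ultimately show ?thesis using \<open>0 \<le> C\<close> by (smt (verit) mult_nonneg_nonneg powr_ge_zero)
    next
      case False
      then have 1: "\<bar>a\<bar> \<le> 1/(d/2) * \<bar>b\<bar>" using d(1) by (auto simp: field_simps)
      have "\<bar>a\<bar> \<le> (1 + 1/(d/2)) * \<bar>b\<bar>" "\<bar>a + b\<bar> \<le> (1 + 1/(d/2)) * \<bar>b\<bar>"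
        using 1 by (auto simp: distrib_right)
      then have "\<bar>a\<bar> powr q \<le> C * \<bar>b\<bar> powr q" "\<bar>a + b\<bar> powr q \<le> C * \<bar>b\<bar> powr q"
        unfolding C_def using assms d(1) by (auto simp flip: powr_mult intro!: powr_mono2)
      moreover have "0 \<le> e * \<bar>a\<bar> powr q" using assms by auto
      ultimately show ?thesis
        using powr_ge_zero[of "\<bar>a\<bar>" q] powr_ge_zero[of "\<bar>a+b\<bar>" q] by linarith
    qed
  qed
qed

lemma pint_integral:
  assumes [measurable]: "f \<in> borel_measurable M" and "pint q M f < \<infinity>"
  shows "integrable M (\<lambda>x. \<bar>f x\<bar> powr q)" "enn2real (pint q M f) = (\<integral>x. \<bar>f x\<bar> powr q \<partial>M)"
proof -
  show "integrable M (\<lambda>x. \<bar>f x\<bar> powr q)"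
    using assms(2) by (auto simp: integrable_iff_bounded pint_def)
  show "enn2real (pint q M f) = (\<integral>x. \<bar>f x\<bar> powr q \<partial>M)"
    by (simp add: pint_def integral_eq_nn_integral)
qed

text \<open>The integrated case \<open>e = 1\<close> of \<open>abs_powr_add_bound\<close>, a
  quasi-triangle inequality for every positive exponent. \<open>C\<close> is chosen before the
  measure and the functions, so it serves whole sequences.\<close>

lemma pint_add_le:
  assumes "0 < q"
  obtains C where "0 \<le> C"
    "\<And>M f g. f \<in> borel_measurable M \<Longrightarrow> g \<in> borel_measurable M \<Longrightarrow>
       pint q M (\<lambda>x. f x + g x) \<le> 2 * pint q M f + ennreal C * pint q M g"
proof -
  obtain C where C: "0 \<le> C"
    "\<And>a b::real. \<bar>\<bar>a + b\<bar> powr q - \<bar>a\<bar> powr q\<bar> \<le> 1 * \<bar>a\<bar> powr q + C * \<bar>b\<bar> powr q"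
    using abs_powr_add_bound[OF assms, of 1] by auto
  show thesis
  proof
    show "0 \<le> C" by fact
    fix M :: "'a measure" and f g :: "'a \<Rightarrow> real"
    assume [measurable]: "f \<in> borel_measurable M" "g \<in> borel_measurable M"
    have "pint q M (\<lambda>x. f x + g x) \<le> (\<integral>\<^sup>+ x. 2 * ennreal (\<bar>f x\<bar> powr q) + ennreal C * ennreal (\<bar>g x\<bar> powr q) \<partial>M)"
      unfolding pint_def
    proof (intro nn_integral_mono)
      fix x
      have "\<bar>f x + g x\<bar> powr q \<le> 2 * \<bar>f x\<bar> powr q + C * \<bar>g x\<bar> powr q"
        using C(2)[of "f x" "g x"] by linarith
      then have "ennreal (\<bar>f x + g x\<bar> powr q) \<le> ennreal (2 * \<bar>f x\<bar> powr q + C * \<bar>g x\<bar> powr q)"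
        by (rule ennreal_leI)
      also have "\<dots> = 2 * ennreal (\<bar>f x\<bar> powr q) + ennreal C * ennreal (\<bar>g x\<bar> powr q)"
        using C(1) by (simp add: ennreal_plus ennreal_mult)
      finally show "ennreal (\<bar>f x + g x\<bar> powr q) \<le> 2 * ennreal (\<bar>f x\<bar> powr q) + ennreal C * ennreal (\<bar>g x\<bar> powr q)" .
    qed
    also have "\<dots> = 2 * pint q M f + ennreal C * pint q M g"
      unfolding pint_def by (simp add: nn_integral_add nn_integral_cmult)
    finally show "pint q M (\<lambda>x. f x + g x) \<le> 2 * pint q M f + ennreal C * pint q M g" .
  qed
qed

lemma pint_minus: "pint q M (\<lambda>x. - f x) = pint q M f"
  by (simp add: pint_def)

lemma pint_minus_commute: "pint q M (\<lambda>x. f x - g x) = pint q M (\<lambda>x. g x - f x)"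
  by (simp add: pint_def abs_minus_commute)

lemma pint_diff_finite:
  assumes "0 < q" "f \<in> borel_measurable M" "g \<in> borel_measurable M" "pint q M f < \<infinity>" "pint q M g < \<infinity>"
  shows "pint q M (\<lambda>x. f x - g x) < \<infinity>"
proof -
  obtain C where C: "\<And>f g. f \<in> borel_measurable M \<Longrightarrow> g \<in> borel_measurable M \<Longrightarrow>
       pint q M (\<lambda>x. f x + g x) \<le> 2 * pint q M f + ennreal C * pint q M g"
    using pint_add_le[OF assms(1)] by metis
  have "pint q M (\<lambda>x. f x + - g x) \<le> 2 * pint q M f + ennreal C * pint q M (\<lambda>x. - g x)"
    by (rule C) (use assms in auto)
  also have "\<dots> < \<infinity>" using assms by (simp add: pint_minus ennreal_mult_less_top)
  finally show ?thesis by simp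
qed

lemma pint_Fatou:
  assumes [measurable]: "\<And>k::nat. f k \<in> borel_measurable M" "g \<in> borel_measurable M"
    and lim: "AE x in M. (\<lambda>k. f k x) \<longlonglongrightarrow> g x" and "0 < q"
    and B: "\<forall>\<^sub>F k in sequentially. pint q M (f k) \<le> B"
  shows "pint q M g \<le> B"
proof -
  have "pint q M g = (\<integral>\<^sup>+ x. liminf (\<lambda>k. ennreal (\<bar>f k x\<bar> powr q)) \<partial>M)"
    unfolding pint_def
  proof (rule nn_integral_cong_AE, use lim in eventually_elim)
    case (elim x)
    have "(\<lambda>k. ennreal (\<bar>f k x\<bar> powr q)) \<longlonglongrightarrow> ennreal (\<bar>g x\<bar> powr q)"
      using elim \<open>0 < q\<close> by (intro tendsto_ennrealI tendsto_powr' tendsto_rabs tendsto_const) auto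
    then show ?case using lim_imp_Liminf[OF sequentially_bot] by (metis (no_types, lifting))
  qed
  also have "\<dots> \<le> liminf (\<lambda>k. \<integral>\<^sup>+ x. ennreal (\<bar>f k x\<bar> powr q) \<partial>M)"
    by (rule nn_integral_liminf) measurable
  also have "\<dots> \<le> B" using B unfolding pint_def
    by (simp add: Liminf_le)
  finally show ?thesis .
qed

text \<open>Stated over an arbitrary measure because it is applied both with q = 2 to difference
  quotients on pairs of points and with the critical exponent on the space itself. |f k|^q has no
  integrable majorant, but the defect between |f k|^q and the sum of |f k - g|^q and |g|^q has one
  as soon as e |f k - g|^q is subtracted; dominated convergence then leaves only \<open>e\<close>
  times a bounded quantity.\<close>

theorem brezis_lieb:
  fixes f :: "nat \<Rightarrow> 'b \<Rightarrow> real"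
  assumes q: "0 < q" and [measurable]: "\<And>k. f k \<in> borel_measurable M" "g \<in> borel_measurable M"
    and lim: "AE x in M. (\<lambda>k. f k x) \<longlonglongrightarrow> g x" and "0 \<le> B"
    and B: "\<And>k. pint q M (f k) \<le> ennreal B"
  shows "(\<lambda>k. enn2real (pint q M (f k)) - enn2real (pint q M (\<lambda>x. f k x - g x)))
           \<longlonglongrightarrow> enn2real (pint q M g)"
proof -
  have g: "pint q M g \<le> ennreal B" by (rule pint_Fatou[OF _ _ lim q]) (auto simp: B)
  then have gfin: "pint q M g < \<infinity>" by (simp add: le_less_trans)
  have ffin: "pint q M (f k) < \<infinity>" for k using B[of k] by (simp add: le_less_trans)
  have dfin: "pint q M (\<lambda>x. f k x - g x) < \<infinity>" for k
    by (rule pint_diff_finite) (use q ffin gfin in auto)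
  obtain C0 where C0: "0 \<le> C0" "\<And>f g. f \<in> borel_measurable M \<Longrightarrow> g \<in> borel_measurable M \<Longrightarrow>
       pint q M (\<lambda>x. f x + g x) \<le> 2 * pint q M f + ennreal C0 * pint q M g"
    using pint_add_le[OF q] by metis
  define K where "K = 2 * B + C0 * B"
  have K: "enn2real (pint q M (\<lambda>x. f k x - g x)) \<le> K" for k
  proof -
    have "pint q M (\<lambda>x. f k x + - g x) \<le> 2 * pint q M (f k) + ennreal C0 * pint q M (\<lambda>x. - g x)"
      by (rule C0(2)) auto
    also have "\<dots> \<le> 2 * ennreal B + ennreal C0 * ennreal B"
      using B g by (intro add_mono mult_left_mono) (auto simp: pint_minus)
    also have "\<dots> = ennreal K" unfolding K_def using C0(1) \<open>0 \<le> B\<close>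
      by (simp add: ennreal_plus ennreal_mult)
    finally show ?thesis using C0(1) \<open>0 \<le> B\<close> by (simp add: enn2real_leI K_def)
  qed
  have "0 \<le> K" using K[of 0] enn2real_nonneg order_trans by blast
  let ?a = "\<lambda>k x. \<bar>f k x\<bar> powr q" and ?b = "\<lambda>k x. \<bar>f k x - g x\<bar> powr q" and ?c = "\<lambda>x. \<bar>g x\<bar> powr q"
  note ia = pint_integral[OF _ ffin, simplified] and ib = pint_integral[OF _ dfin, simplified]
    and ic = pint_integral[OF _ gfin, simplified]
  show ?thesis
    unfolding ia ib ic
  proof (rule LIMSEQ_I)
    fix r :: real assume "0 < r"
    \<comment> \<open>The error left after dominated convergence is at most \<open>e * K\<close>;
      the 1 in the denominator covers \<open>K = 0\<close>.\<close>
    define e where "e = r / (2 * (K + 1))"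
    have "0 < e" and eK: "e * K < r/2"
    proof -
      show "0 < e" unfolding e_def using \<open>0 < r\<close> \<open>0 \<le> K\<close> by auto
      have "e * (K + 1) = r/2" unfolding e_def using \<open>0 \<le> K\<close> by (simp add: field_simps)
      then show "e * K < r/2" using \<open>0 < e\<close> by (simp add: distrib_left)
    qed
    obtain C where C: "0 \<le> C"
      "\<And>a b::real. \<bar>\<bar>a + b\<bar> powr q - \<bar>a\<bar> powr q\<bar> \<le> e * \<bar>a\<bar> powr q + C * \<bar>b\<bar> powr q"
      using abs_powr_add_bound[OF q \<open>0 < e\<close>] by auto
    \<comment> \<open>Positive part of the defect after \<open>e\<close> times the remainder is
      removed; by the choice of \<open>C\<close> it is at most (C + 1) |g|^q.\<close>
    define W where "W k x = max 0 (\<bar>?a k x - ?b k x - ?c x\<bar> - e * ?b k x)" for k x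
    have Wm[measurable]: "W k \<in> borel_measurable M" for k unfolding W_def by measurable
    have Wb: "norm (W k x) \<le> (C + 1) * ?c x" for k x
    proof -
      have "\<bar>?a k x - ?b k x\<bar> \<le> e * ?b k x + C * ?c x" using C(2)[of "f k x - g x" "g x"] by simp
      moreover have "0 \<le> C * ?c x" "0 \<le> ?c x" using \<open>0 \<le> C\<close> by auto
      ultimately have "0 \<le> (C + 1) * ?c x" "\<bar>?a k x - ?b k x - ?c x\<bar> - e * ?b k x \<le> (C + 1) * ?c x"
        unfolding distrib_right mult_1 abs_le_iff by linarith+
      then show ?thesis unfolding W_def by simp
    qed
    have W0: "(\<lambda>k. \<integral>x. W k x \<partial>M) \<longlonglongrightarrow> (\<integral>x. 0 \<partial>M)"
    proof (rule integral_dominated_convergence[where w="\<lambda>x. (C+1) * ?c x"])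
      show "AE x in M. (\<lambda>k. W k x) \<longlonglongrightarrow> 0"
        using lim
      proof eventually_elim
        case (elim x)
        have a: "(\<lambda>k. ?a k x) \<longlonglongrightarrow> ?c x"
          using elim q by (intro tendsto_powr' tendsto_rabs tendsto_const) auto
        have "(\<lambda>k. f k x - g x) \<longlonglongrightarrow> 0" using elim LIM_zero by blast
        then have b: "(\<lambda>k. ?b k x) \<longlonglongrightarrow> \<bar>0\<bar> powr q"
          using q by (intro tendsto_powr' tendsto_rabs tendsto_const) auto
        have "(\<lambda>k. W k x) \<longlonglongrightarrow> max 0 (\<bar>?c x - \<bar>0\<bar> powr q - ?c x\<bar> - e * \<bar>0\<bar> powr q)"
          unfolding W_def by (intro tendsto_intros a b)
        then show ?case using q by simp
      qed
      show "integrable M (\<lambda>x. (C+1) * ?c x)" using ic(1) by auto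
    qed (use Wb in auto)
    then obtain N where N: "\<And>k. k \<ge> N \<Longrightarrow> \<bar>\<integral>x. W k x \<partial>M\<bar> < r/2"
      using LIMSEQ_D[of _ 0 "r/2"] \<open>0 < r\<close> by fastforce
    show "\<exists>no. \<forall>n\<ge>no. norm (integral\<^sup>L M (?a n) - integral\<^sup>L M (?b n) - integral\<^sup>L M ?c) < r"
    proof (intro exI allI impI)
      fix k assume k: "k \<ge> N"
      have iW: "integrable M (W k)"
        by (rule Bochner_Integration.integrable_bound[of _ "\<lambda>x. (C+1) * ?c x"]) (use ic(1) Wb in \<open>auto intro!: always_eventually order_trans[OF Wb[unfolded real_norm_def] abs_ge_self]\<close>)
      have "integral\<^sup>L M (?a k) - integral\<^sup>L M (?b k) - integral\<^sup>L M ?c = (\<integral>x. ?a k x - ?b k x - ?c x \<partial>M)"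
        using ia ib ic by simp
      also have "norm \<dots> \<le> (\<integral>x. norm (?a k x - ?b k x - ?c x) \<partial>M)" by (rule integral_norm_bound)
      also have "\<dots> \<le> (\<integral>x. W k x + e * ?b k x \<partial>M)"
      proof (rule integral_mono)
        have "a \<le> max 0 (a - b) + b" for a b :: real by (simp add: max_def)
        then show "norm (?a k x - ?b k x - ?c x) \<le> W k x + e * ?b k x" for x by (simp add: W_def)
      qed (use ia ib ic iW in auto)
      also have "\<dots> = (\<integral>x. W k x \<partial>M) + e * (\<integral>x. ?b k x \<partial>M)" using iW ib by simp
      also have "\<dots> < r/2 + r/2"
      proof (rule add_less_le_mono)
        show "(\<integral>x. W k x \<partial>M) < r/2" using N[OF k] by auto
        have "e * (\<integral>x. ?b k x \<partial>M) \<le> e * K" using K[of k] \<open>0 < e\<close> unfolding ib by auto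
        then show "e * (\<integral>x. ?b k x \<partial>M) \<le> r/2" using eK by linarith
      qed
      finally show "norm (integral\<^sup>L M (?a k) - integral\<^sup>L M (?b k) - integral\<^sup>L M ?c) < r" by simp
    qed
  qed
qed

text \<open>The sequence \<open>f k\<close> is only bounded here. This is what allows a minimising
  sequence to be replaced by test functions with the limits of form and mass unchanged.\<close>

lemma pint_perturbation:
  fixes f g :: "nat \<Rightarrow> 'b \<Rightarrow> real"
  assumes q: "0 < q" and [measurable]: "\<And>k. f k \<in> borel_measurable M" "\<And>k. g k \<in> borel_measurable M"
    and "0 \<le> B" and B: "\<And>k. pint q M (f k) \<le> ennreal B"
    and fin: "\<And>k. pint q M (g k) < \<infinity>" and lim: "(\<lambda>k. pint q M (g k)) \<longlonglongrightarrow> 0"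
  shows "(\<lambda>k. enn2real (pint q M (\<lambda>x. f k x + g k x)) - enn2real (pint q M (f k))) \<longlonglongrightarrow> 0"
proof -
  have ffin: "pint q M (f k) < \<infinity>" for k using B[of k] by (simp add: le_less_trans)
  have sfin: "pint q M (\<lambda>x. f k x + g k x) < \<infinity>" for k
    using pint_diff_finite[OF q, of "f k" M "\<lambda>x. - g k x"] fin[of k] ffin[of k] by (simp add: pint_minus)
  note ia = pint_integral[OF _ ffin, simplified] and ib = pint_integral[OF _ sfin, simplified]
    and ic = pint_integral[OF _ fin, simplified]
  have lim': "(\<lambda>k. enn2real (pint q M (g k))) \<longlonglongrightarrow> 0"
    using tendsto_enn2real[of "\<lambda>k. pint q M (g k)" 0 sequentially] lim by simp
  show ?thesis
  proof (rule LIMSEQ_I)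
    fix r :: real assume "0 < r"
    define e where "e = r / (2 * (B + 1))"
    have "0 < e" and eB: "e * B < r/2"
    proof -
      show "0 < e" unfolding e_def using \<open>0 < r\<close> \<open>0 \<le> B\<close> by auto
      have "e * (B + 1) = r/2" unfolding e_def using \<open>0 \<le> B\<close> by (simp add: field_simps)
      then show "e * B < r/2" using \<open>0 < e\<close> by (simp add: distrib_left)
    qed
    obtain C where C: "0 \<le> C"
      "\<And>a b::real. \<bar>\<bar>a + b\<bar> powr q - \<bar>a\<bar> powr q\<bar> \<le> e * \<bar>a\<bar> powr q + C * \<bar>b\<bar> powr q"
      using abs_powr_add_bound[OF q \<open>0 < e\<close>] by auto
    have "(\<lambda>k. C * enn2real (pint q M (g k))) \<longlonglongrightarrow> 0"
      using tendsto_mult_right_zero[OF lim'] by simp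
    then obtain N where N: "\<And>k. k \<ge> N \<Longrightarrow> \<bar>C * enn2real (pint q M (g k))\<bar> < r/2"
      using LIMSEQ_D[of _ 0 "r/2"] \<open>0 < r\<close> by fastforce
    show "\<exists>no. \<forall>n\<ge>no. norm (enn2real (pint q M (\<lambda>x. f n x + g n x)) - enn2real (pint q M (f n)) - 0) < r"
    proof (intro exI allI impI)
      fix k assume k: "k \<ge> N"
      have "enn2real (pint q M (\<lambda>x. f k x + g k x)) - enn2real (pint q M (f k))
         = (\<integral>x. \<bar>f k x + g k x\<bar> powr q - \<bar>f k x\<bar> powr q \<partial>M)"
        unfolding ia ib using ia ib by simp
      also have "norm \<dots> \<le> (\<integral>x. norm (\<bar>f k x + g k x\<bar> powr q - \<bar>f k x\<bar> powr q) \<partial>M)" by (rule integral_norm_bound)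
      also have "\<dots> \<le> (\<integral>x. e * \<bar>f k x\<bar> powr q + C * \<bar>g k x\<bar> powr q \<partial>M)"
        by (rule integral_mono) (use ia ib ic C in auto)
      also have "\<dots> = e * enn2real (pint q M (f k)) + C * enn2real (pint q M (g k))"
        unfolding ia ic using ia ic by simp
      also have "\<dots> < r/2 + r/2"
      proof (rule add_le_less_mono)
        have "enn2real (pint q M (f k)) \<le> B" using B[of k] \<open>0 \<le> B\<close> by (simp add: enn2real_leI)
        then show "e * enn2real (pint q M (f k)) \<le> r/2" using eB \<open>0 < e\<close>
          by (smt (verit) mult_left_mono)
        show "C * enn2real (pint q M (g k)) < r/2" using N[OF k] by auto
      qed
      finally show "norm (enn2real (pint q M (\<lambda>x. f k x + g k x)) - enn2real (pint q M (f k)) - 0) < r" by simp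
    qed
  qed
qed

section \<open>Scaling and reflection\<close>

text \<open>Square root of the integrand of \<open>Ifrac\<close>, up to sign, and linear in
  \<open>u\<close>: the form becomes a squared L^2 norm on pairs (\<open>Ifrac_eq_pint\<close>),
  open to Fatou's lemma, the parallelogram law and the Brezis-Lieb lemma. On the diagonal the
  numerator is 0.\<close>

definition dq :: "real \<Rightarrow> 'a::euclidean_space set \<Rightarrow> ('a \<Rightarrow> real) \<Rightarrow> 'a \<times> 'a \<Rightarrow> real" where
  "dq \<sigma> \<Omega> u z = indicator (\<Omega> \<times> \<Omega>) z *
     ((u (fst z) - u (snd z)) / norm (fst z - snd z) powr ((real DIM('a) + 2 * \<sigma>) / 2))"

lemma Ifrac_eq_pint: "Ifrac \<sigma> \<Omega> u = pint 2 lborel (dq \<sigma> \<Omega> u)"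
  unfolding Ifrac_def pint_def
proof (rule nn_integral_cong)
  fix z :: "'a \<times> 'a"
  have "(norm (fst z - snd z) powr ((real DIM('a) + 2 * \<sigma>) / 2))\<^sup>2 = norm (fst z - snd z) powr (real DIM('a) + 2 * \<sigma>)"
    by (simp add: power2_eq_square flip: powr_add)
  then show "indicator (\<Omega> \<times> \<Omega>) z * ennreal ((u (fst z) - u (snd z))\<^sup>2 / norm (fst z - snd z) powr (real DIM('a) + 2 * \<sigma>))
      = ennreal (\<bar>dq \<sigma> \<Omega> u z\<bar> powr 2)"
    by (cases "z \<in> \<Omega> \<times> \<Omega>") (simp_all add: dq_def power_divide)
qed

lemma Lpow_eq_pint: "Lpow p \<Omega> u = pint p lborel (\<lambda>x. indicator \<Omega> x * u x)"
  unfolding Lpow_def pint_def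
  by (rule nn_integral_cong) (auto simp: indicator_def)

lemma dq_diff: "dq \<sigma> \<Omega> (\<lambda>x. f x - g x) z = dq \<sigma> \<Omega> f z - dq \<sigma> \<Omega> g z"
  unfolding dq_def by (simp add: algebra_simps diff_divide_distrib add_divide_distrib)

lemma dq_add: "dq \<sigma> \<Omega> (\<lambda>x. f x + g x) z = dq \<sigma> \<Omega> f z + dq \<sigma> \<Omega> g z"
  unfolding dq_def by (simp add: algebra_simps diff_divide_distrib add_divide_distrib)

lemma dq_cmult: "dq \<sigma> \<Omega> (\<lambda>x. c * f x) z = c * dq \<sigma> \<Omega> f z"
  unfolding dq_def by (simp add: algebra_simps diff_divide_distrib)

lemma fst_borel_measurable[measurable]:
  "(fst :: 'a::euclidean_space \<times> 'b::euclidean_space \<Rightarrow> 'a) \<in> borel \<rightarrow>\<^sub>M borel"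
  by (auto intro!: borel_measurable_continuous_onI continuous_intros)

lemma snd_borel_measurable[measurable]:
  "(snd :: 'a::euclidean_space \<times> 'b::euclidean_space \<Rightarrow> 'b) \<in> borel \<rightarrow>\<^sub>M borel"
  by (auto intro!: borel_measurable_continuous_onI continuous_intros)

lemma dq_measurable[measurable]:
  assumes [measurable]: "u \<in> borel_measurable borel" "\<Omega> \<in> sets borel"
  shows "dq \<sigma> \<Omega> u \<in> borel_measurable (borel :: ('a::euclidean_space \<times> 'a) measure)"
proof -
  have "\<Omega> \<times> \<Omega> = {z. fst z \<in> \<Omega> \<and> snd z \<in> \<Omega>}" by auto
  moreover have "{z\<in>space (borel :: ('a\<times>'a) measure). fst z \<in> \<Omega> \<and> snd z \<in> \<Omega>} \<in> sets borel" by measurable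
  ultimately have [measurable]: "\<Omega> \<times> \<Omega> \<in> sets (borel :: ('a\<times>'a) measure)" by simp
  show ?thesis unfolding dq_def by measurable
qed

lemma pint_cmult: "f \<in> borel_measurable M \<Longrightarrow> pint q M (\<lambda>x. c * f x) = ennreal (\<bar>c\<bar> powr q) * pint q M f"
  unfolding pint_def by (subst nn_integral_cmult[symmetric]) (auto simp: abs_mult powr_mult ennreal_mult)

lemma pint_affine:
  fixes f :: "'a::euclidean_space \<Rightarrow> real"
  assumes [measurable]: "f \<in> borel_measurable borel" and "0 < r"
  shows "pint q lborel f = ennreal (r ^ DIM('a)) * pint q lborel (\<lambda>x. f (t + r *\<^sub>R x))"
proof -
  have "pint q lborel f = pint q (density (distr lborel borel (\<lambda>x. t + r *\<^sub>R x)) (\<lambda>_. \<bar>r\<bar>^DIM('a))) f"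
    using lborel_affine[of r t] \<open>0 < r\<close> by simp
  also have "\<dots> = ennreal (r ^ DIM('a)) * pint q lborel (\<lambda>x. f (t + r *\<^sub>R x))"
    unfolding pint_def using \<open>0 < r\<close>
    by (simp add: nn_integral_density nn_integral_distr nn_integral_cmult)
  finally show ?thesis .
qed

text \<open>With the exponent (n - 2 \<sigma>)/2 both the form and the critical mass are invariant
  once the domain is pulled back by the same affine map.\<close>

definition resc :: "real \<Rightarrow> real \<Rightarrow> 'a::euclidean_space \<Rightarrow> ('a \<Rightarrow> real) \<Rightarrow> 'a \<Rightarrow> real" where
  "resc \<sigma> r t u = (\<lambda>x. r powr ((real DIM('a) - 2 * \<sigma>) / 2) * u (t + r *\<^sub>R x))"

lemma resc_measurable[measurable]:
  "u \<in> borel_measurable borel \<Longrightarrow> resc \<sigma> r t u \<in> borel_measurable borel"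
  unfolding resc_def
  by (intro borel_measurable_times borel_measurable_const measurable_compose[of "\<lambda>x. t + r *\<^sub>R x" borel borel u])
     auto

lemma resc_diff: "resc \<sigma> r t (\<lambda>x. f x - g x) = (\<lambda>x. resc \<sigma> r t f x - resc \<sigma> r t g x)"
  by (simp add: resc_def algebra_simps)

lemma Ifrac_resc:
  fixes u :: "'a::euclidean_space \<Rightarrow> real"
  assumes [measurable]: "u \<in> borel_measurable borel" "\<Omega> \<in> sets borel" and r: "0 < r"
  shows "Ifrac \<sigma> ((\<lambda>x. t + r *\<^sub>R x) -` \<Omega>) (resc \<sigma> r t u) = Ifrac \<sigma> \<Omega> u"
proof -
  let ?n = "real DIM('a)"
  have [measurable]: "(\<lambda>x. t + r *\<^sub>R x) -` \<Omega> \<in> sets borel"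
    using measurable_sets_borel[of "\<lambda>x. t + r *\<^sub>R x" borel \<Omega>] by simp
  have eq: "dq \<sigma> ((\<lambda>x. t + r *\<^sub>R x) -` \<Omega>) (resc \<sigma> r t u) z = r powr ?n * dq \<sigma> \<Omega> u ((t,t) + r *\<^sub>R z)" for z
  proof -
    have "(t + r *\<^sub>R fst z) - (t + r *\<^sub>R snd z) = r *\<^sub>R (fst z - snd z)" by (simp add: algebra_simps)
    then have N: "norm ((t + r *\<^sub>R fst z) - (t + r *\<^sub>R snd z)) = r * norm (fst z - snd z)"
      using r by simp
    have "r powr ?n = r powr ((?n - 2*\<sigma>)/2) * r powr ((?n + 2*\<sigma>)/2)"
      using r by (simp flip: powr_add) (simp add: field_simps)
    moreover have "indicator ((\<lambda>x. t + r *\<^sub>R x) -` \<Omega> \<times> (\<lambda>x. t + r *\<^sub>R x) -` \<Omega>) z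
        = (indicator (\<Omega> \<times> \<Omega>) ((t,t) + r *\<^sub>R z) :: real)"
      by (auto simp: indicator_def mem_Times_iff)
    ultimately show ?thesis
      using r unfolding dq_def resc_def fst_add snd_add fst_conv snd_conv fst_scaleR snd_scaleR N
      by (simp add: powr_mult right_diff_distrib[symmetric] del: right_diff_distrib)
  qed
  \<comment> \<open>The constant r^(2n) is the Jacobian of the dilation on pairs of points.\<close>
  have P: "ennreal (\<bar>r powr ?n\<bar> powr 2) = ennreal (r ^ DIM('a \<times> 'a))"
  proof -
    have "\<bar>r powr ?n\<bar> powr 2 = (r ^ DIM('a))\<^sup>2" using r by (simp add: powr_realpow)
    also have "\<dots> = r ^ DIM('a \<times> 'a)" by (simp add: power2_eq_square power_add)
    finally show ?thesis by simp
  qed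
  have "Ifrac \<sigma> ((\<lambda>x. t + r *\<^sub>R x) -` \<Omega>) (resc \<sigma> r t u)
      = pint 2 lborel (\<lambda>z. r powr ?n * dq \<sigma> \<Omega> u ((t,t) + r *\<^sub>R z))"
    unfolding Ifrac_eq_pint eq[abs_def] ..
  also have "\<dots> = ennreal (r ^ DIM('a \<times> 'a)) * pint 2 lborel (\<lambda>z. dq \<sigma> \<Omega> u ((t,t) + r *\<^sub>R z))"
    unfolding P[symmetric] by (rule pint_cmult) auto
  also have "\<dots> = Ifrac \<sigma> \<Omega> u"
    unfolding Ifrac_eq_pint by (rule pint_affine[symmetric]) (use r in auto)
  finally show ?thesis .
qed

lemma Lpow_resc:
  fixes u :: "'a::euclidean_space \<Rightarrow> real"
  assumes [measurable]: "u \<in> borel_measurable borel" "\<Omega> \<in> sets borel" and r: "0 < r"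
    and n: "2 * \<sigma> < real DIM('a)"
  shows "Lpow (pcrit \<sigma> TYPE('a)) ((\<lambda>x. t + r *\<^sub>R x) -` \<Omega>) (resc \<sigma> r t u) = Lpow (pcrit \<sigma> TYPE('a)) \<Omega> u"
proof -
  let ?n = "real DIM('a)" and ?p = "pcrit \<sigma> TYPE('a)"
  have eq: "(\<lambda>x. indicator ((\<lambda>x. t + r *\<^sub>R x) -` \<Omega>) x * resc \<sigma> r t u x) =
      (\<lambda>x. r powr ((?n - 2*\<sigma>)/2) * (indicator \<Omega> (t + r *\<^sub>R x) * u (t + r *\<^sub>R x)))"
    by (auto simp: resc_def indicator_def)
  have "(?n - 2*\<sigma>)/2 * ?p = ?n" using n by (simp add: pcrit_def field_simps)
  then have P: "ennreal (\<bar>r powr ((?n - 2*\<sigma>)/2)\<bar> powr ?p) = ennreal (r ^ DIM('a))"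
    using r by (simp add: powr_powr flip: powr_realpow)
  have "Lpow ?p ((\<lambda>x. t + r *\<^sub>R x) -` \<Omega>) (resc \<sigma> r t u) =
      ennreal (r ^ DIM('a)) * pint ?p lborel (\<lambda>x. indicator \<Omega> (t + r *\<^sub>R x) * u (t + r *\<^sub>R x))"
    unfolding Lpow_eq_pint eq P[symmetric] by (rule pint_cmult) auto
  also have "\<dots> = Lpow ?p \<Omega> u"
    unfolding Lpow_eq_pint by (rule pint_affine[symmetric, of "\<lambda>x. indicator \<Omega> x * u x"]) (use r in auto)
  finally show ?thesis .
qed

section \<open>Reflection in the boundary hyperplane and even extension\<close>

lemma en_Basis: "(en :: 'a::euclidean_space) \<in> Basis"
  unfolding en_def using some_in_eq[of Basis] nonempty_Basis by auto

lemma inner_en_en[simp]: "(en :: 'a::euclidean_space) \<bullet> en = 1"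
  by (rule inner_same_Basis[OF en_Basis])

lemma norm_en[simp]: "norm (en :: 'a::euclidean_space) = 1"
  by (rule norm_Basis[OF en_Basis])

definition rfl :: "'a::euclidean_space \<Rightarrow> 'a" where
  "rfl x = x - (2 * (x \<bullet> en)) *\<^sub>R en"

lemma rfl_rfl[simp]: "rfl (rfl x) = x"
  by (simp add: rfl_def inner_diff_left algebra_simps)

lemma inner_rfl[simp]: "rfl x \<bullet> en = - (x \<bullet> en)"
  by (simp add: rfl_def inner_diff_left)

lemma norm_rfl_diff[simp]: "norm (rfl x - rfl y) = norm (x - y)"
proof -
  define w where "w = x - y"
  have "rfl x - rfl y = w - (2 * (w \<bullet> en)) *\<^sub>R en"
    by (simp add: rfl_def w_def algebra_simps inner_diff_left)
  moreover have "(norm (w - (2 * (w \<bullet> en)) *\<^sub>R en))\<^sup>2 = (norm w)\<^sup>2"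
    unfolding power2_norm_eq_inner
    by (simp add: inner_diff_left inner_diff_right inner_commute[of en w])
  ultimately show ?thesis by (simp add: w_def)
qed

lemma norm_diff_rfl_ge:
  assumes "0 \<le> x \<bullet> en" "0 \<le> y \<bullet> en"
  shows "norm (x - y) \<le> norm (x - rfl y)"
proof -
  have "(norm (x - rfl y))\<^sup>2 = (norm (x - y))\<^sup>2 + 4 * (x \<bullet> en) * (y \<bullet> en)"
    unfolding power2_norm_eq_inner rfl_def
    by (simp add: inner_diff_left inner_diff_right inner_commute[of en x] inner_commute[of en y]
        inner_commute[of y x] algebra_simps)
  then have "(norm (x - y))\<^sup>2 \<le> (norm (x - rfl y))\<^sup>2" using assms by simp
  then show ?thesis by (rule power2_le_imp_le) simp
qed

lemma rfl_measurable[measurable]: "rfl \<in> borel \<rightarrow>\<^sub>M borel"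
  unfolding rfl_def[abs_def] by measurable

lemma nn_integral_rfl:
  fixes f :: "'a::euclidean_space \<Rightarrow> ennreal"
  assumes [measurable]: "f \<in> borel_measurable borel"
  shows "(\<integral>\<^sup>+ x. f (rfl x) \<partial>lborel) = (\<integral>\<^sup>+ x. f x \<partial>lborel)"
proof -
  \<comment> \<open>The reflection is a diagonal map with a single entry -1, so its Jacobian is 1 in
    absolute value.\<close>
  define c :: "'a \<Rightarrow> real" where "c j = (if j = en then -1 else 1)" for j
  have eq: "0 + (\<Sum>j\<in>Basis. (c j * (x \<bullet> j)) *\<^sub>R j) = rfl x" for x
  proof -
    have "(\<Sum>j\<in>Basis. (c j * (x \<bullet> j)) *\<^sub>R j) = (\<Sum>j\<in>Basis. (x \<bullet> j) *\<^sub>R j - (if j = en then (2 * (x \<bullet> en)) *\<^sub>R en else 0))"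
      by (rule sum.cong) (auto simp: c_def algebra_simps simp flip: scaleR_add_left)
    also have "\<dots> = x - (2 * (x \<bullet> en)) *\<^sub>R en"
      using en_Basis[where 'a='a] by (simp add: sum_subtractf euclidean_representation)
    finally show ?thesis by (simp add: rfl_def)
  qed
  have "lborel = density (distr lborel borel (\<lambda>x. 0 + (\<Sum>j\<in>Basis. (c j * (x \<bullet> j)) *\<^sub>R j))) (\<lambda>_. \<Prod>j\<in>Basis. \<bar>c j\<bar>)"
    by (rule lborel_affine_euclidean) (auto simp: c_def)
  also have "(\<Prod>j\<in>Basis. \<bar>c j\<bar>) = 1" by (rule prod.neutral) (auto simp: c_def)
  finally have "(lborel :: 'a measure) = density (distr lborel borel rfl) (\<lambda>_. ennreal 1)"
    unfolding eq by simp
  then have *: "lborel = distr lborel borel (rfl :: 'a \<Rightarrow> 'a)" by (simp add: density_1)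
  show ?thesis by (subst (2) *) (simp add: nn_integral_distr)
qed

lemma nn_integral_pair_lborel:
  fixes f :: "'a::euclidean_space \<times> 'a \<Rightarrow> ennreal"
  assumes "f \<in> borel_measurable borel"
  shows "(\<integral>\<^sup>+ z. f z \<partial>lborel) = (\<integral>\<^sup>+ x. (\<integral>\<^sup>+ y. f (x, y) \<partial>lborel) \<partial>lborel)"
proof -
  have "f \<in> borel_measurable (lborel \<Otimes>\<^sub>M lborel)" using assms by (simp add: lborel_prod)
  then have "(\<integral>\<^sup>+ z. f z \<partial>(lborel \<Otimes>\<^sub>M lborel)) = (\<integral>\<^sup>+ x. (\<integral>\<^sup>+ y. f (x, y) \<partial>lborel) \<partial>lborel)"
    by (rule lborel.nn_integral_fst[symmetric])
  then show ?thesis by (simp add: lborel_prod)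
qed

lemma measurable_section_lborel:
  fixes f :: "'a::euclidean_space \<times> 'a \<Rightarrow> ennreal"
  assumes "f \<in> borel_measurable borel"
  shows "(\<lambda>x. \<integral>\<^sup>+ y. f (x, y) \<partial>lborel) \<in> borel_measurable borel"
proof -
  have "f \<in> borel_measurable (lborel \<Otimes>\<^sub>M lborel)" using assms by (simp add: lborel_prod)
  then have "(\<lambda>x. \<integral>\<^sup>+ y. f (x, y) \<partial>lborel) \<in> borel_measurable lborel"
    by (rule lborel.borel_measurable_nn_integral_fst)
  then show ?thesis by simp
qed

lemma measurable_Pair_borel:
  assumes "f \<in> borel \<rightarrow>\<^sub>M (borel :: 'a::euclidean_space measure)" "g \<in> borel \<rightarrow>\<^sub>M (borel :: 'b::euclidean_space measure)"
  shows "(\<lambda>z. (f z, g z)) \<in> borel \<rightarrow>\<^sub>M (borel :: ('a \<times> 'b) measure)"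
  unfolding borel_prod[symmetric] using assms by measurable

lemma nn_integral_rfl_pair:
  fixes f :: "'a::euclidean_space \<times> 'a \<Rightarrow> ennreal"
  assumes [measurable]: "f \<in> borel_measurable borel"
  shows "(\<integral>\<^sup>+ z. f ((if a then rfl else id) (fst z), (if b then rfl else id) (snd z)) \<partial>lborel) = (\<integral>\<^sup>+ z. f z \<partial>lborel)"
proof -
  let ?A = "if a then rfl else id :: 'a \<Rightarrow> 'a" and ?B = "if b then rfl else id :: 'a \<Rightarrow> 'a"
  have [measurable]: "?A \<in> borel \<rightarrow>\<^sub>M borel" "?B \<in> borel \<rightarrow>\<^sub>M borel" by auto
  note fst' = fst_borel_measurable[where 'a='a and 'b='a] snd_borel_measurable[where 'a='a and 'b='a]
  have "(\<lambda>z::'a\<times>'a. (?A (fst z), ?B (snd z))) \<in> borel \<rightarrow>\<^sub>M borel"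
    by (intro measurable_Pair_borel measurable_compose[OF fst'(1)] measurable_compose[OF fst'(2)]) auto
  then have m: "(\<lambda>z. f (?A (fst z), ?B (snd z))) \<in> borel_measurable borel"
    by (rule measurable_compose[OF _ assms])
  have "(\<lambda>y. (x, y)) \<in> borel \<rightarrow>\<^sub>M (borel :: ('a \<times> 'a) measure)" for x
    by (intro borel_measurable_continuous_onI continuous_intros)
  then have "(\<lambda>y. f (x, y)) \<in> borel_measurable borel" for x
    by (rule measurable_compose[OF _ assms])
  then have B: "(\<integral>\<^sup>+ y. f (x, ?B y) \<partial>lborel) = (\<integral>\<^sup>+ y. f (x, y) \<partial>lborel)" for x
    using nn_integral_rfl[of "\<lambda>y. f (x, y)"] by auto
  have "(\<integral>\<^sup>+ z. f (?A (fst z), ?B (snd z)) \<partial>lborel) = (\<integral>\<^sup>+ x. (\<integral>\<^sup>+ y. f (?A x, y) \<partial>lborel) \<partial>lborel)"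
    using nn_integral_pair_lborel[OF m] by (simp add: B)
  also have "\<dots> = (\<integral>\<^sup>+ x. (\<integral>\<^sup>+ y. f (x, y) \<partial>lborel) \<partial>lborel)"
    using nn_integral_rfl[OF measurable_section_lborel[OF assms]] by auto
  also have "\<dots> = (\<integral>\<^sup>+ z. f z \<partial>lborel)"
    using nn_integral_pair_lborel[OF assms] by simp
  finally show ?thesis .
qed

text \<open>For \<open>u\<close> vanishing off the open half space at most one summand is nonzero,
  so the sum is the even extension, with value 0 on the hyperplane. Written as a sum, it stays a
  test function by closure under addition.\<close>

definition evenext :: "('a::euclidean_space \<Rightarrow> real) \<Rightarrow> 'a \<Rightarrow> real" where
  "evenext u x = u x + u (rfl x)"

lemma evenext_measurable[measurable]: "u \<in> borel_measurable borel \<Longrightarrow> evenext u \<in> borel_measurable borel"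
  unfolding evenext_def[abs_def]
  by (intro borel_measurable_add measurable_compose[OF rfl_measurable, of u])

lemma evenext_rfl: "evenext u (rfl x) = evenext u x"
  by (simp add: evenext_def)

lemma evenext_half:
  assumes "\<And>x. x \<notin> halfspace \<Longrightarrow> u x = 0" "x \<in> halfspace"
  shows "evenext u x = u x"
  using assms(1)[of "rfl x"] assms(2) by (simp add: evenext_def halfspace_def)

lemma halfspace_sets[measurable]: "halfspace \<in> sets borel"
  unfolding halfspace_def by measurable

text \<open>\<open>halfspace\<close> is open, so the four quadrants miss the pairs with a point on
  the boundary hyperplane; these form a null set.\<close>

lemma AE_inner_en_nonzero:
  "AE z in (lborel :: ('a::euclidean_space \<times> 'a) measure). fst z \<bullet> en \<noteq> 0 \<and> snd z \<bullet> en \<noteq> 0"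
proof -
  have *: "AE z in lborel. z \<bullet> b \<noteq> 0" if "b \<in> Basis" for b :: "'a \<times> 'a"
  proof -
    have "{z::'a\<times>'a. z \<bullet> b = 0} \<in> null_sets lborel"
      using negligible_standard_hyperplane[OF that, of 0]
      by (simp add: negligible_iff_null_sets null_sets_completion_iff)
    then show ?thesis using AE_not_in by force
  qed
  have "(en, 0) \<in> (Basis :: ('a\<times>'a) set)" "(0, en) \<in> (Basis :: ('a\<times>'a) set)"
    using en_Basis by (auto simp: Basis_prod_def)
  from *[OF this(1)] *[OF this(2)] show ?thesis
    by eventually_elim (auto simp: inner_prod_def)
qed

text \<open>Each of the four quadrants of \<open>\<real>\<^sup>n \<times> \<real>\<^sup>n\<close> is reflected onto \<open>halfspace \<times> halfspace\<close>, and
  reflecting one of two points of the half space to the other side increases their distance.\<close>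

lemma Ifrac_evenext_le:
  fixes u :: "'a::euclidean_space \<Rightarrow> real"
  assumes [measurable]: "u \<in> borel_measurable borel" and z: "\<And>x. x \<notin> halfspace \<Longrightarrow> u x = 0"
    and \<sigma>: "0 < \<sigma>"
  shows "Ifrac \<sigma> UNIV (evenext u) \<le> 4 * Ifrac \<sigma> halfspace u"
proof -
  let ?H = "halfspace :: 'a set" and ?b = "real DIM('a) + 2 * \<sigma>"
  define T where "T a b z = ((if a then rfl else id) (fst z), (if b then rfl else id) (snd z))" for a b and z :: "'a \<times> 'a"
  have TT: "T a b (T a b z) = z" for a b z by (auto simp: T_def)
  note fst' = fst_borel_measurable[where 'a='a and 'b='a] snd_borel_measurable[where 'a='a and 'b='a]
  have Tm[measurable]: "T a b \<in> borel \<rightarrow>\<^sub>M borel" for a b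
    unfolding T_def
    by (intro measurable_Pair_borel measurable_compose[OF fst'(1)] measurable_compose[OF fst'(2)]) auto
  let ?g = "\<lambda>z. ennreal (\<bar>dq \<sigma> UNIV (evenext u) z\<bar> powr 2)"
  let ?f = "\<lambda>z. ennreal (\<bar>dq \<sigma> ?H u z\<bar> powr 2)"
  let ?F = "\<integral>\<^sup>+z. ?f z \<partial>lborel"
  let ?k = "\<lambda>a b z. indicator (?H \<times> ?H) (T a b z) * ?g z"
  have gm[measurable]: "?g \<in> borel_measurable borel" by measurable
  have "?H \<times> ?H = {z\<in>space borel. fst z \<in> ?H \<and> snd z \<in> ?H}" by auto
  moreover have "\<dots> \<in> sets (borel :: ('a\<times>'a) measure)" using fst' by measurable
  ultimately have [measurable]: "?H \<times> ?H \<in> sets (borel :: ('a\<times>'a) measure)" by simp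
  have le: "indicator (?H \<times> ?H) z * ?g (T a b z) \<le> ?f z" for a b z
  proof (cases "z \<in> ?H \<times> ?H")
    case True
    obtain x y where xy: "z = (x, y)" "0 < x \<bullet> en" "0 < y \<bullet> en" "x \<in> ?H" "y \<in> ?H"
      using True by (cases z) (auto simp: halfspace_def)
    have N: "norm (x - y) \<le> norm (fst (T a b z) - snd (T a b z))"
      using xy norm_diff_rfl_ge[of x y] norm_diff_rfl_ge[of y x]
      by (auto simp: T_def norm_minus_commute)
    have E: "evenext u (fst (T a b z)) = u x" "evenext u (snd (T a b z)) = u y"
      using xy evenext_half[OF z] by (auto simp: T_def evenext_rfl)
    have "\<bar>dq \<sigma> UNIV (evenext u) (T a b z)\<bar> \<le> \<bar>dq \<sigma> ?H u z\<bar>"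
    proof (cases "x = y")
      case False
      define P where "P = norm (x - y) powr (?b/2)"
      define P' where "P' = norm (fst (T a b z) - snd (T a b z)) powr (?b/2)"
      have "0 < P" using False by (simp add: P_def)
      moreover have "P \<le> P'" unfolding P_def P'_def by (rule powr_mono2) (use N \<sigma> in auto)
      ultimately have "\<bar>u x - u y\<bar> / P' \<le> \<bar>u x - u y\<bar> / P" by (intro divide_left_mono) auto
      moreover have "\<bar>dq \<sigma> UNIV (evenext u) (T a b z)\<bar> = \<bar>u x - u y\<bar> / P'"
        unfolding dq_def E P'_def by simp
      moreover have "\<bar>dq \<sigma> ?H u z\<bar> = \<bar>u x - u y\<bar> / P"
        unfolding dq_def P_def using xy(1,4,5) by simp
      ultimately show ?thesis by simp
    qed (simp add: dq_def E)
    then have "?g (T a b z) \<le> ?f z" by (intro ennreal_leI powr_mono2) auto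
    then show ?thesis using True by simp
  qed simp
  have int: "(\<integral>\<^sup>+z. ?k a b z \<partial>lborel) \<le> ?F" for a b
  proof -
    have "(\<integral>\<^sup>+z. ?k a b z \<partial>lborel) = (\<integral>\<^sup>+z. indicator (?H \<times> ?H) (T a b (T a b z)) * ?g (T a b z) \<partial>lborel)"
      using nn_integral_rfl_pair[of "\<lambda>z. ?k a b z" a b] unfolding T_def[symmetric]
      by simp
    also have "\<dots> \<le> ?F" unfolding TT by (intro nn_integral_mono le)
    finally show ?thesis .
  qed
  have "(\<integral>\<^sup>+z. ?g z \<partial>lborel) \<le> (\<integral>\<^sup>+z. ?k False False z + ?k False True z
      + (?k True False z + ?k True True z) \<partial>lborel)"
  proof (rule nn_integral_mono_AE, use AE_inner_en_nonzero in eventually_elim)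
    case (elim z)
    then have "0 < fst z \<bullet> en \<or> fst z \<bullet> en < 0" "0 < snd z \<bullet> en \<or> snd z \<bullet> en < 0" by auto
    then consider "T False False z \<in> ?H \<times> ?H" | "T False True z \<in> ?H \<times> ?H" | "T True False z \<in> ?H \<times> ?H" | "T True True z \<in> ?H \<times> ?H"
      by (auto simp: T_def halfspace_def mem_Times_iff)
    then show ?case by cases (simp_all add: add_increasing add_increasing2)
  qed
  also have "\<dots> = (\<integral>\<^sup>+z. ?k False False z \<partial>lborel) + (\<integral>\<^sup>+z. ?k False True z \<partial>lborel)
      + ((\<integral>\<^sup>+z. ?k True False z \<partial>lborel) + (\<integral>\<^sup>+z. ?k True True z \<partial>lborel))"
    using fst' by (simp add: nn_integral_add)
  also have "\<dots> \<le> ?F + ?F + (?F + ?F)"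
    by (intro add_mono int)
  also have "\<dots> = 4 * ?F"
    by (simp add: algebra_simps flip: mult_2 mult_2_right)
  finally show ?thesis unfolding Ifrac_eq_pint pint_def .
qed

lemma pint_rfl:
  "f \<in> borel_measurable borel \<Longrightarrow> pint q lborel (\<lambda>x. f (rfl x)) = pint q lborel f"
  unfolding pint_def using nn_integral_rfl[of "\<lambda>x. ennreal (\<bar>f x\<bar> powr q)"] by simp

section \<open>Test functions and convex combinations\<close>

lemma C1c_continuous: "\<phi> \<in> C1c \<Omega> \<Longrightarrow> continuous_on UNIV \<phi>"
  unfolding C1c_def using has_derivative_continuous by (blast intro: continuous_at_imp_continuous_on)

lemma C1c_measurable: "\<phi> \<in> C1c \<Omega> \<Longrightarrow> \<phi> \<in> borel_measurable borel"
  by (rule borel_measurable_continuous_onI[OF C1c_continuous])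

lemma C1c_vanish: "\<phi> \<in> C1c \<Omega> \<Longrightarrow> x \<notin> \<Omega> \<Longrightarrow> \<phi> x = 0"
  unfolding C1c_def using closure_subset[of "{x. \<phi> x \<noteq> 0}"] by auto

lemma C1c_mono: "\<phi> \<in> C1c \<Omega> \<Longrightarrow> \<Omega> \<subseteq> \<Omega>' \<Longrightarrow> \<phi> \<in> C1c \<Omega>'"
  unfolding C1c_def by auto

lemma C1c_cmult:
  assumes "\<phi> \<in> C1c \<Omega>" shows "(\<lambda>x. c * \<phi> x) \<in> C1c \<Omega>"
proof -
  obtain D where D: "\<And>x. (\<phi> has_derivative blinfun_apply (D x)) (at x)" "continuous_on UNIV D"
    and K: "compact (closure {x. \<phi> x \<noteq> 0})" "closure {x. \<phi> x \<noteq> 0} \<subseteq> \<Omega>"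
    using assms unfolding C1c_def by auto
  have sub: "closure {x. c * \<phi> x \<noteq> 0} \<subseteq> closure {x. \<phi> x \<noteq> 0}" by (intro closure_mono) auto
  have "((\<lambda>x. c * \<phi> x) has_derivative blinfun_apply (c *\<^sub>R D x)) (at x)" for x
    by (rule has_derivative_eq_rhs[OF has_derivative_mult_right[OF D(1)]]) (auto simp: scaleR_blinfun.rep_eq)
  moreover have "continuous_on UNIV (\<lambda>x. c *\<^sub>R D x)" using D(2) by (intro continuous_intros)
  moreover have "compact (closure {x. c * \<phi> x \<noteq> 0})"
    using compact_Int_closed[OF K(1) closed_closure, of "{x. c * \<phi> x \<noteq> 0}"] sub by (simp add: Int_absorb1)
  ultimately show ?thesis unfolding C1c_def using sub K
    by (intro CollectI conjI exI[of _ "\<lambda>x. c *\<^sub>R D x"]) auto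
qed

lemma C1c_add:
  assumes "f \<in> C1c \<Omega>" "g \<in> C1c \<Omega>" shows "(\<lambda>x. f x + g x) \<in> C1c \<Omega>"
proof -
  obtain D where D: "\<And>x. (f has_derivative blinfun_apply (D x)) (at x)" "continuous_on UNIV D"
    and K: "compact (closure {x. f x \<noteq> 0})" "closure {x. f x \<noteq> 0} \<subseteq> \<Omega>"
    using assms unfolding C1c_def by auto
  obtain D' where D': "\<And>x. (g has_derivative blinfun_apply (D' x)) (at x)" "continuous_on UNIV D'"
    and K': "compact (closure {x. g x \<noteq> 0})" "closure {x. g x \<noteq> 0} \<subseteq> \<Omega>"
    using assms unfolding C1c_def by auto
  have "closure {x. f x + g x \<noteq> 0} \<subseteq> closure ({x. f x \<noteq> 0} \<union> {x. g x \<noteq> 0})" by (intro closure_mono) auto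
  then have sub: "closure {x. f x + g x \<noteq> 0} \<subseteq> closure {x. f x \<noteq> 0} \<union> closure {x. g x \<noteq> 0}" by simp
  have "((\<lambda>x. f x + g x) has_derivative blinfun_apply (D x + D' x)) (at x)" for x
    by (rule has_derivative_eq_rhs[OF has_derivative_add[OF D(1) D'(1)]]) (auto simp: plus_blinfun.rep_eq)
  moreover have "continuous_on UNIV (\<lambda>x. D x + D' x)" using D(2) D'(2) by (intro continuous_intros)
  moreover have "compact (closure {x. f x + g x \<noteq> 0})"
    using compact_Int_closed[OF compact_Un[OF K(1) K'(1)] closed_closure, of "{x. f x + g x \<noteq> 0}"] sub
    by (simp add: Int_absorb1)
  ultimately show ?thesis unfolding C1c_def using sub K K'
    by (intro CollectI conjI exI[of _ "\<lambda>x. D x + D' x"]) auto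
qed

lemma C1c_diff: "f \<in> C1c \<Omega> \<Longrightarrow> g \<in> C1c \<Omega> \<Longrightarrow> (\<lambda>x. f x - g x) \<in> C1c \<Omega>"
  using C1c_add[of f \<Omega> "\<lambda>x. -1 * g x"] C1c_cmult[of g \<Omega> "-1"] by simp

text \<open>An explicit continuous inverse \<open>S\<close> is asked for because it carries the
  compact support of \<open>\<phi>\<close> onto a compact set containing the new support; dilations
  and the reflection both provide one.\<close>

lemma C1c_affine:
  assumes \<phi>: "\<phi> \<in> C1c \<Omega>" and A: "bounded_linear A" and S: "continuous_on UNIV S"
    and inv: "\<And>x. S (z + A x) = x" "\<And>y. z + A (S y) = y"
  shows "(\<lambda>x. \<phi> (z + A x)) \<in> C1c ((\<lambda>x. z + A x) -` \<Omega>)"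
proof -
  obtain D where D: "\<And>x. (\<phi> has_derivative blinfun_apply (D x)) (at x)" "continuous_on UNIV D"
    and K: "compact (closure {x. \<phi> x \<noteq> 0})" "closure {x. \<phi> x \<noteq> 0} \<subseteq> \<Omega>"
    using \<phi> unfolding C1c_def by auto
  let ?S = "closure {x. \<phi> (z + A x) \<noteq> 0}"
  have cS: "compact (S ` closure {x. \<phi> x \<noteq> 0})"
    by (rule compact_continuous_image[OF continuous_on_subset[OF S] K(1)]) simp
  have "{x. \<phi> (z + A x) \<noteq> 0} \<subseteq> S ` closure {x. \<phi> x \<noteq> 0}"
    using closure_subset[of "{x. \<phi> x \<noteq> 0}"] inv(1) by (fastforce intro: image_eqI[of _ S "z + A _"])
  then have sub: "?S \<subseteq> S ` closure {x. \<phi> x \<noteq> 0}"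
    by (intro closure_minimal compact_imp_closed[OF cS])
  have "compact ?S" using compact_Int_closed[OF cS closed_closure, of "{x. \<phi> (z + A x) \<noteq> 0}"] sub
    by (simp add: Int_absorb1)
  moreover have "S ` closure {x. \<phi> x \<noteq> 0} \<subseteq> (\<lambda>x. z + A x) -` \<Omega>" using K(2) inv(2) by auto
  then have "?S \<subseteq> (\<lambda>x. z + A x) -` \<Omega>" using sub by (rule subset_trans[rotated])
  moreover have "((\<lambda>x. \<phi> (z + A x)) has_derivative blinfun_apply (D (z + A x) o\<^sub>L Blinfun A)) (at x)" for x
  proof -
    have "((\<lambda>x. z + A x) has_derivative A) (at x)"
      using has_derivative_add[OF has_derivative_const bounded_linear_imp_has_derivative[OF A]] by simp
    from has_derivative_compose[OF this D(1)] show ?thesis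
      by (simp add: o_def bounded_linear_Blinfun_apply[OF A] blinfun_compose.rep_eq)
  qed
  moreover have "continuous_on UNIV (\<lambda>x. D (z + A x) o\<^sub>L Blinfun A)"
  proof -
    have "continuous_on UNIV (\<lambda>x. z + A x)"
      by (intro continuous_intros linear_continuous_on A)
    then have "continuous_on UNIV (\<lambda>x. D (z + A x))"
      using continuous_on_compose2[OF D(2)] by auto
    then show ?thesis by (intro continuous_intros)
  qed
  ultimately show ?thesis
    unfolding C1c_def by (intro CollectI conjI exI[of _ "\<lambda>x. D (z + A x) o\<^sub>L Blinfun A"]) auto
qed

lemma C1c_resc:
  assumes "\<phi> \<in> C1c \<Omega>" "0 < r"
  shows "resc \<sigma> r t \<phi> \<in> C1c ((\<lambda>x. t + r *\<^sub>R x) -` \<Omega>)"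
  unfolding resc_def
  by (intro C1c_cmult C1c_affine[OF assms(1), of "\<lambda>x. r *\<^sub>R x" "\<lambda>y. (1/r) *\<^sub>R (y - t)"])
     (use assms(2) in \<open>auto intro!: bounded_linear_scaleR_right continuous_intros\<close>)

lemma C1c_evenext:
  assumes "\<phi> \<in> C1c halfspace"
  shows "evenext \<phi> \<in> C1c UNIV"
proof -
  have "linear (rfl :: 'a::euclidean_space \<Rightarrow> 'a)"
    by (rule linearI) (simp_all add: rfl_def inner_add_left algebra_simps)
  then have lin: "bounded_linear (rfl :: 'a::euclidean_space \<Rightarrow> 'a)"
    by (simp add: linear_conv_bounded_linear)
  have "(\<lambda>x. \<phi> (0 + rfl x)) \<in> C1c ((\<lambda>x. 0 + rfl x) -` halfspace)"
    by (rule C1c_affine[OF assms lin, of rfl]) (auto intro: linear_continuous_on lin)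
  then have "(\<lambda>x. \<phi> (rfl x)) \<in> C1c UNIV" by (auto intro: C1c_mono)
  then have "(\<lambda>x. \<phi> x + \<phi> (rfl x)) \<in> C1c UNIV"
    using assms by (intro C1c_add) (auto intro: C1c_mono)
  then show ?thesis by (simp add: evenext_def[abs_def])
qed

lemma C1c_integrable:
  fixes \<phi> :: "'a::euclidean_space \<Rightarrow> real" and h :: "real \<Rightarrow> real"
  assumes "\<phi> \<in> C1c \<Omega>" "continuous_on UNIV h" "h 0 = 0"
  shows "integrable lborel (\<lambda>x. h (\<phi> x))"
proof -
  let ?K = "closure {x. \<phi> x \<noteq> 0}"
  have K: "compact ?K" using assms(1) by (simp add: C1c_def)
  have "continuous_on ?K (\<lambda>x. h (\<phi> x))"
    using continuous_on_compose2[OF assms(2) C1c_continuous[OF assms(1)]] by (auto intro: continuous_on_subset)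
  from borel_integrable_compact[OF K this]
  have "integrable lborel (\<lambda>x. indicator ?K x *\<^sub>R h (\<phi> x))" .
  also have "(\<lambda>x. indicator ?K x *\<^sub>R h (\<phi> x)) = (\<lambda>x. h (\<phi> x))"
  proof
    fix x show "indicator ?K x *\<^sub>R h (\<phi> x) = h (\<phi> x)"
      using closure_subset[of "{x. \<phi> x \<noteq> 0}"] assms(3) by (cases "\<phi> x = 0") (auto simp: indicator_def)
  qed
  finally show ?thesis .
qed

lemma C1c_Lpow_finite:
  assumes "\<phi> \<in> C1c \<Omega>" "0 < p"
  shows "Lpow p \<Omega>' \<phi> < \<infinity>"
proof -
  have "integrable lborel (\<lambda>x. \<bar>\<phi> x\<bar> powr p)"
  proof (rule C1c_integrable[OF assms(1)])
    show "continuous_on UNIV (\<lambda>s::real. \<bar>s\<bar> powr p)"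
      by (rule continuous_on_powr') (use assms(2) in \<open>auto intro!: continuous_intros\<close>)
  qed (use assms(2) in auto)
  then have "(\<integral>\<^sup>+x. ennreal (\<bar>\<phi> x\<bar> powr p) \<partial>lborel) < \<infinity>" by (simp add: integrable_iff_bounded)
  moreover have "Lpow p \<Omega>' \<phi> \<le> (\<integral>\<^sup>+x. ennreal (\<bar>\<phi> x\<bar> powr p) \<partial>lborel)"
    unfolding Lpow_def by (intro nn_integral_mono) (auto simp: indicator_def)
  ultimately show ?thesis by (rule le_less_trans[rotated])
qed

text \<open>Convex combinations with dyadic weights of the terms from index \<open>m\<close> on.
  Midpoints are all that the parallelogram identity uses, and rule induction takes the place of any
  bookkeeping of weights.\<close>

inductive_set midhull :: "(nat \<Rightarrow> 'a \<Rightarrow> real) \<Rightarrow> nat \<Rightarrow> ('a \<Rightarrow> real) set" for f m where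
  base: "m \<le> k \<Longrightarrow> f k \<in> midhull f m"
| mid: "g \<in> midhull f m \<Longrightarrow> h \<in> midhull f m \<Longrightarrow> (\<lambda>x. (g x + h x) / 2) \<in> midhull f m"

lemma midhull_antimono: "l \<le> m \<Longrightarrow> g \<in> midhull f m \<Longrightarrow> g \<in> midhull f l"
  by (rotate_tac, induction rule: midhull.induct) (auto intro: midhull.intros)

lemma midhull_measurable:
  assumes "\<And>k. f k \<in> borel_measurable M" "g \<in> midhull f m"
  shows "g \<in> borel_measurable M"
  using assms(2) by induction (use assms(1) in auto)

lemma midhull_C1c:
  assumes "\<And>k. f k \<in> C1c \<Omega>" "g \<in> midhull f m"
  shows "g \<in> C1c \<Omega>"
  using assms(2)
proof induction
  case (mid g h)
  then show ?case using C1c_cmult[OF C1c_add, of g \<Omega> h "1/2"] by simp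
qed (use assms(1) in auto)

text \<open>An interval around \<open>L\<close> that contains a tail of \<open>f k x\<close>
  contains every midpoint formed from that tail.\<close>

lemma midhull_tendsto:
  assumes "(\<lambda>k. f k x) \<longlonglongrightarrow> L" and w: "\<And>m. w m \<in> midhull f m"
  shows "(\<lambda>m. w m x) \<longlonglongrightarrow> L"
proof (rule LIMSEQ_I)
  fix r :: real assume "0 < r"
  then obtain N where N: "\<And>k. k \<ge> N \<Longrightarrow> norm (f k x - L) < r" using LIMSEQ_D[OF assms(1)] by blast
  have "norm (g x - L) < r" if "g \<in> midhull f m" "N \<le> m" for g m
    using that
  proof induction
    case (mid g h)
    then show ?case by (auto simp: abs_less_iff field_simps)
  qed (use N in auto)
  then show "\<exists>no. \<forall>n\<ge>no. norm (w n x - L) < r" using w by blast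
qed

lemma pint2_integral:
  assumes "f \<in> borel_measurable M" "pint 2 M f < \<infinity>"
  shows "integrable M (\<lambda>x. (f x)\<^sup>2)" "enn2real (pint 2 M f) = (\<integral>x. (f x)\<^sup>2 \<partial>M)"
  using pint_integral[OF assms] by simp_all

lemma pint2_parallelogram:
  assumes [measurable]: "f \<in> borel_measurable M" "g \<in> borel_measurable M"
    and fin: "pint 2 M f < \<infinity>" "pint 2 M g < \<infinity>"
  shows "pint 2 M (\<lambda>x. (f x + g x) / 2) < \<infinity>" "pint 2 M (\<lambda>x. f x - g x) < \<infinity>"
    and "4 * enn2real (pint 2 M (\<lambda>x. (f x + g x) / 2)) + enn2real (pint 2 M (\<lambda>x. f x - g x))
       = 2 * enn2real (pint 2 M f) + 2 * enn2real (pint 2 M g)"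
proof -
  show d: "pint 2 M (\<lambda>x. f x - g x) < \<infinity>" using pint_diff_finite[of 2 f M g] fin by simp
  have "pint 2 M (\<lambda>x. f x - - g x) < \<infinity>" using fin by (intro pint_diff_finite) (auto simp: pint_minus)
  then have "pint 2 M (\<lambda>x. (1/2) * (f x + g x)) < \<infinity>"
    by (subst pint_cmult) (auto simp: ennreal_mult_less_top)
  then show s: "pint 2 M (\<lambda>x. (f x + g x) / 2) < \<infinity>" by simp
  note i = pint2_integral[OF _ d] pint2_integral[OF _ s] pint2_integral[OF _ fin(1)] pint2_integral[OF _ fin(2)]
  have "4 * (\<integral>x. ((f x + g x) / 2)\<^sup>2 \<partial>M) + (\<integral>x. (f x - g x)\<^sup>2 \<partial>M) = (\<integral>x. 4 * ((f x + g x) / 2)\<^sup>2 + (f x - g x)\<^sup>2 \<partial>M)"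
    using i by simp
  also have "\<dots> = (\<integral>x. 2 * (f x)\<^sup>2 + 2 * (g x)\<^sup>2 \<partial>M)"
    by (intro Bochner_Integration.integral_cong) (auto simp: power2_eq_square field_simps)
  also have "\<dots> = 2 * (\<integral>x. (f x)\<^sup>2 \<partial>M) + 2 * (\<integral>x. (g x)\<^sup>2 \<partial>M)"
    using i by simp
  finally show "4 * enn2real (pint 2 M (\<lambda>x. (f x + g x) / 2)) + enn2real (pint 2 M (\<lambda>x. f x - g x))
       = 2 * enn2real (pint 2 M f) + 2 * enn2real (pint 2 M g)" using i by simp
qed

text \<open>A form of Mazur's lemma: almost minimisers of the quadratic form over the convex hulls of the
  tails form a Cauchy sequence by the parallelogram identity.\<close>

lemma midhull_Cauchy:
  fixes f :: "nat \<Rightarrow> 'a::euclidean_space \<Rightarrow> real"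
  assumes fm: "\<And>k. f k \<in> borel_measurable borel" and [measurable]: "\<Omega> \<in> sets borel" and "0 \<le> B"
    and B: "\<And>k. Ifrac \<sigma> \<Omega> (f k) \<le> ennreal B"
  obtains w e where "\<And>m. w m \<in> midhull f m" "e \<longlonglongrightarrow> 0" "\<And>m. 0 \<le> e m"
    "\<And>m l. m \<le> l \<Longrightarrow> Ifrac \<sigma> \<Omega> (\<lambda>x. w m x - w l x) \<le> ennreal (e m)"
proof -
  define J where "J g = enn2real (Ifrac \<sigma> \<Omega> g)" for g :: "'a \<Rightarrow> real"
  have par: "Ifrac \<sigma> \<Omega> (\<lambda>x. (g x + h x)/2) < \<infinity>" "Ifrac \<sigma> \<Omega> (\<lambda>x. g x - h x) < \<infinity>"
    "4 * J (\<lambda>x. (g x + h x)/2) + J (\<lambda>x. g x - h x) = 2 * J g + 2 * J h"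
    if [measurable]: "g \<in> borel_measurable borel" "h \<in> borel_measurable borel"
      and fin: "Ifrac \<sigma> \<Omega> g < \<infinity>" "Ifrac \<sigma> \<Omega> h < \<infinity>" for g h
  proof -
    have eq: "dq \<sigma> \<Omega> (\<lambda>x. (g x + h x)/2) = (\<lambda>z. (dq \<sigma> \<Omega> g z + dq \<sigma> \<Omega> h z) / 2)"
      using dq_cmult[of \<sigma> \<Omega> "1/2" "\<lambda>x. g x + h x"] by (auto simp: dq_add)
    show "Ifrac \<sigma> \<Omega> (\<lambda>x. (g x + h x)/2) < \<infinity>" "Ifrac \<sigma> \<Omega> (\<lambda>x. g x - h x) < \<infinity>"
      "4 * J (\<lambda>x. (g x + h x)/2) + J (\<lambda>x. g x - h x) = 2 * J g + 2 * J h"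
      using fin unfolding J_def Ifrac_eq_pint eq dq_diff[abs_def]
      by (intro pint2_parallelogram; measurable)+
  qed
  have hull: "Ifrac \<sigma> \<Omega> g < \<infinity> \<and> J g \<le> B" if "g \<in> midhull f m" for g m
    using that
  proof induction
    case (base k)
    have "J (f k) \<le> B" using B[of k] \<open>0 \<le> B\<close> by (simp add: J_def enn2real_leI)
    then show ?case using B[of k] by (simp add: le_less_trans)
  next
    case (mid g h)
    have "0 \<le> J (\<lambda>x. g x - h x)" by (simp add: J_def)
    with mid par[of g h] midhull_measurable[OF fm, where m=m] show ?case by auto
  qed
  \<comment> \<open>Infimum of the form over the hull of the tail from \<open>m\<close> on; it
    increases with \<open>m\<close>, because the hulls shrink, and stays below
    \<open>B\<close>.\<close>
  define d where "d m = Inf (J ` midhull f m)" for m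
  have bdd: "bdd_below (J ` midhull f m)" for m
    by (rule bdd_belowI[of _ 0]) (auto simp: J_def)
  have ne: "midhull f m \<noteq> {}" for m using midhull.base[of m m f] by auto
  have dle: "d m \<le> J g" if "g \<in> midhull f m" for m g
    unfolding d_def by (rule cInf_lower) (use that bdd in auto)
  have "\<exists>g. g \<in> midhull f m \<and> J g < d m + 1 / real (Suc m)" for m
  proof -
    have "d m < d m + 1 / real (Suc m)" by simp
    then obtain y where "y \<in> J ` midhull f m" "y < d m + 1 / real (Suc m)"
      using cInf_lessD[of "J ` midhull f m"] ne[of m] unfolding d_def by blast
    then show ?thesis by blast
  qed
  then obtain w where w: "\<And>m. w m \<in> midhull f m" "\<And>m. J (w m) < d m + 1 / real (Suc m)" by metis
  have "incseq d"
  proof (rule incseq_SucI)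
    fix m show "d m \<le> d (Suc m)"
      unfolding d_def using midhull_antimono[of m "Suc m"]
      by (intro cInf_superset_mono image_mono) (use ne bdd in auto)
  qed
  moreover have dB: "d m \<le> B" for m using dle[OF w(1)[of m]] hull[OF w(1)[of m]] by linarith
  ultimately obtain D where D: "d \<longlonglongrightarrow> D" "\<And>m. d m \<le> D" using incseq_convergent by blast
  \<comment> \<open>The form of the difference is twice the sum of the two forms minus four times
    that of the midpoint. The forms are below \<open>d m + 1/(m+1)\<close> and
    \<open>d l + 1/(l+1)\<close>, the midpoint is at least \<open>d m\<close>, and
    \<open>d l \<le> D\<close>.\<close>
  define e where "e m = 2 * (D - d m) + 4 / real (Suc m)" for m
  show thesis
  proof
    show "w m \<in> midhull f m" for m by (rule w)
    have "(\<lambda>m. 2 * (D - d m) + 4 * inverse (real (Suc m))) \<longlonglongrightarrow> 2 * (D - D) + 4 * 0"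
      by (intro tendsto_intros D LIMSEQ_inverse_real_of_nat)
    then show "e \<longlonglongrightarrow> 0" by (simp add: e_def[abs_def] divide_inverse)
    show "0 \<le> e m" for m using D(2)[of m] by (simp add: e_def)
    fix m l :: nat assume ml: "m \<le> l"
    note wl = midhull_antimono[OF ml w(1)[of l]]
    have p: "Ifrac \<sigma> \<Omega> (\<lambda>x. w m x - w l x) < \<infinity>"
      "4 * J (\<lambda>x. (w m x + w l x)/2) + J (\<lambda>x. w m x - w l x) = 2 * J (w m) + 2 * J (w l)"
      using par[of "w m" "w l"] w(1) hull[OF w(1)] midhull_measurable[OF fm w(1)] by auto
    have "d m \<le> J (\<lambda>x. (w m x + w l x)/2)"
      by (rule dle) (intro midhull.mid w wl)
    moreover have "1 / real (Suc l) \<le> 1 / real (Suc m)" using ml by (simp add: field_simps)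
    ultimately have "J (\<lambda>x. w m x - w l x) \<le> e m"
      using p(2) w(2)[of m] w(2)[of l] D(2)[of l] unfolding e_def by auto
    then show "Ifrac \<sigma> \<Omega> (\<lambda>x. w m x - w l x) \<le> ennreal (e m)"
      using p(1) unfolding J_def by (metis ennreal_enn2real ennreal_leI infinity_ennreal_def)
  qed
qed

section \<open>An improved Sobolev inequality\<close>

text \<open>The inner integral of the form; its value at \<open>x\<close> takes the place of a
  squared gradient in pointwise estimates.\<close>

definition gag :: "real \<Rightarrow> 'a::euclidean_space set \<Rightarrow> ('a \<Rightarrow> real) \<Rightarrow> 'a \<Rightarrow> ennreal" where
  "gag \<sigma> \<Omega> u x = (\<integral>\<^sup>+ y. indicator \<Omega> y *
     ennreal ((u x - u y)\<^sup>2 / norm (x - y) powr (real DIM('a) + 2 * \<sigma>)) \<partial>lborel)"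

lemma gag_integrand_measurable:
  fixes u :: "'a::euclidean_space \<Rightarrow> real"
  assumes [measurable]: "u \<in> borel_measurable borel" "\<Omega> \<in> sets borel"
  shows "(\<lambda>y. indicator \<Omega> y * ennreal ((u x - u y)\<^sup>2 / norm (x - y) powr b)) \<in> borel_measurable borel"
  by measurable

lemma
  fixes u :: "'a::euclidean_space \<Rightarrow> real"
  assumes [measurable]: "u \<in> borel_measurable borel" "\<Omega> \<in> sets borel"
  shows gag_measurable: "(\<lambda>x. indicator \<Omega> x * gag \<sigma> \<Omega> u x) \<in> borel_measurable borel"
    and Ifrac_gag: "Ifrac \<sigma> \<Omega> u = (\<integral>\<^sup>+ x. indicator \<Omega> x * gag \<sigma> \<Omega> u x \<partial>lborel)"
proof -
  let ?f = "\<lambda>z. ennreal (\<bar>dq \<sigma> \<Omega> u z\<bar> powr 2)"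
  have m: "?f \<in> borel_measurable borel" by measurable
  have P: "(norm (x - y) powr ((real DIM('a) + 2 * \<sigma>) / 2))\<^sup>2 = norm (x - y) powr (real DIM('a) + 2 * \<sigma>)" for x y :: 'a
    by (simp add: power2_eq_square flip: powr_add)
  have eq: "(\<integral>\<^sup>+ y. ?f (x, y) \<partial>lborel) = indicator \<Omega> x * gag \<sigma> \<Omega> u x" for x
  proof -
    have "?f (x, y) = indicator \<Omega> x * (indicator \<Omega> y * ennreal ((u x - u y)\<^sup>2 / norm (x - y) powr (real DIM('a) + 2 * \<sigma>)))" for y
      by (cases "x \<in> \<Omega>"; cases "y \<in> \<Omega>") (simp_all add: dq_def power_divide P)
    then have "(\<integral>\<^sup>+ y. ?f (x, y) \<partial>lborel) = (\<integral>\<^sup>+ y. indicator \<Omega> x * (indicator \<Omega> y * ennreal ((u x - u y)\<^sup>2 / norm (x - y) powr (real DIM('a) + 2 * \<sigma>))) \<partial>lborel)"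
      by simp
    also have "\<dots> = indicator \<Omega> x * gag \<sigma> \<Omega> u x"
      unfolding gag_def using gag_integrand_measurable[OF assms] by (intro nn_integral_cmult) auto
    finally show ?thesis .
  qed
  show "(\<lambda>x. indicator \<Omega> x * gag \<sigma> \<Omega> u x) \<in> borel_measurable borel"
    using measurable_section_lborel[OF m] unfolding eq .
  show "Ifrac \<sigma> \<Omega> u = (\<integral>\<^sup>+ x. indicator \<Omega> x * gag \<sigma> \<Omega> u x \<partial>lborel)"
    unfolding Ifrac_eq_pint pint_def nn_integral_pair_lborel[OF m] eq ..
qed

definition avg :: "'a::euclidean_space set \<Rightarrow> ('a \<Rightarrow> real) \<Rightarrow> real" where
  "avg E u = (LINT y:E|lborel. u y) / measure lborel E"

text \<open>The squared distance to the mean is at most the mean of the squared distances, since the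
  cross term integrates to 0; the kernel is then inserted through |x - y| \<le> R. The set
  \<open>E\<close> only has to lie within distance \<open>R\<close> of \<open>x\<close>, which
  admits balls with \<open>x\<close> on their boundary sphere as well as grid cells.\<close>

lemma diff_avg_le:
  fixes u :: "'a::euclidean_space \<Rightarrow> real"
  assumes um[measurable]: "u \<in> borel_measurable borel" and [measurable]: "\<Omega> \<in> sets borel"
    and iu: "integrable lborel u" "integrable lborel (\<lambda>x. (u x)\<^sup>2)"
    and [measurable]: "E \<in> sets borel" and E: "emeasure lborel E < \<infinity>" "0 < measure lborel E" "E \<subseteq> \<Omega>"
    and R: "\<And>y. y \<in> E \<Longrightarrow> norm (x - y) \<le> R" and \<sigma>: "0 < \<sigma>"
  shows "ennreal ((u x - avg E u)\<^sup>2) \<le>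
    ennreal (R powr (real DIM('a) + 2 * \<sigma>) / measure lborel E) * gag \<sigma> \<Omega> u x"
proof -
  let ?b = "real DIM('a) + 2 * \<sigma>" and ?m = "measure lborel E"
  define c a where "c = u x" and "a = avg E u"
  have Efin: "emeasure lborel E \<noteq> \<infinity>" using E by auto
  have i1: "set_integrable lborel E (\<lambda>_. k::real)" for k using Efin by (simp add: set_integrable_def less_top)
  have i2: "set_integrable lborel E u" "set_integrable lborel E (\<lambda>y. (u y)\<^sup>2)"
    unfolding set_integrable_def by (intro integrable_mult_indicator iu; simp)+
  have ua: "(LINT y:E|lborel. u y) = a * ?m" using E unfolding a_def avg_def by simp
  have i3: "set_integrable lborel E (\<lambda>y. (c - u y)\<^sup>2)"
  proof -
    have "set_integrable lborel E (\<lambda>y. c\<^sup>2 - (2 * c) * u y + (u y)\<^sup>2)"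
      by (intro set_integral_add set_integral_diff i1 i2 set_integrable_mult_right impI)
    then show ?thesis by (simp add: power2_diff algebra_simps)
  qed
  have i4: "set_integrable lborel E (\<lambda>y. (c - a)\<^sup>2 + 2 * (c - a) * (a - u y))"
    by (intro set_integral_add set_integral_diff i1 i2 set_integrable_mult_right impI)
  have "?m * (c - a)\<^sup>2 = (LINT y:E|lborel. (c - a)\<^sup>2 + 2 * (c - a) * (a - u y))"
  proof -
    have "(LINT y:E|lborel. (c - a)\<^sup>2 + 2 * (c - a) * (a - u y)) =
       (LINT y:E|lborel. (c - a)\<^sup>2) + 2 * (c - a) * ((LINT y:E|lborel. a) - (LINT y:E|lborel. u y))"
      by (simp add: set_integral_add set_integral_diff i1 i2 set_integral_mult_right set_integrable_mult_right)
    also have "(LINT y:E|lborel. (c - a)\<^sup>2) = ?m * (c - a)\<^sup>2" using Efin by (simp add: set_integral_const)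
    also have "(LINT y:E|lborel. a) = ?m * a" using Efin by (simp add: set_integral_const)
    finally show ?thesis unfolding ua by simp
  qed
  also have "\<dots> \<le> (LINT y:E|lborel. (c - u y)\<^sup>2)"
  proof (rule set_integral_mono[OF i4 i3])
    fix y
    have "(c - u y)\<^sup>2 = (c - a)\<^sup>2 + 2 * (c - a) * (a - u y) + (a - u y)\<^sup>2"
      by (simp add: power2_eq_square algebra_simps)
    then show "(c - a)\<^sup>2 + 2 * (c - a) * (a - u y) \<le> (c - u y)\<^sup>2" by simp
  qed
  finally have le: "?m * (c - a)\<^sup>2 \<le> (LINT y:E|lborel. (c - u y)\<^sup>2)" .
  have "ennreal (LINT y:E|lborel. (c - u y)\<^sup>2) = (\<integral>\<^sup>+ y. ennreal (indicator E y *\<^sub>R (c - u y)\<^sup>2) \<partial>lborel)"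
    unfolding set_lebesgue_integral_def
    by (rule nn_integral_eq_integral[symmetric]) (use i3 in \<open>auto simp: set_integrable_def\<close>)
  also have "\<dots> \<le> (\<integral>\<^sup>+ y. ennreal (R powr ?b) * (indicator \<Omega> y * ennreal ((u x - u y)\<^sup>2 / norm (x - y) powr ?b)) \<partial>lborel)"
  proof (rule nn_integral_mono)
    fix y
    show "ennreal (indicator E y *\<^sub>R (c - u y)\<^sup>2) \<le> ennreal (R powr ?b) * (indicator \<Omega> y * ennreal ((u x - u y)\<^sup>2 / norm (x - y) powr ?b))"
    proof (cases "y \<in> E \<and> x \<noteq> y")
      case True
      then have y: "y \<in> \<Omega>" "0 < norm (x - y)" "norm (x - y) \<le> R" using E R by auto
      define P where "P = norm (x - y) powr ?b"
      have "0 < P" using y by (simp add: P_def)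
      have "P \<le> R powr ?b" unfolding P_def by (rule powr_mono2) (use y \<sigma> in auto)
      then have "(c - u y)\<^sup>2 * P \<le> (c - u y)\<^sup>2 * R powr ?b" by (intro mult_left_mono) auto
      then have "(c - u y)\<^sup>2 \<le> R powr ?b * ((c - u y)\<^sup>2 / P)" using \<open>0 < P\<close> by (simp add: field_simps)
      then have "ennreal ((c - u y)\<^sup>2) \<le> ennreal (R powr ?b * ((c - u y)\<^sup>2 / P))" by (rule ennreal_leI)
      also have "\<dots> = ennreal (R powr ?b) * ennreal ((c - u y)\<^sup>2 / P)"
        using \<open>0 < P\<close> by (intro ennreal_mult) auto
      finally show ?thesis using True y by (simp add: P_def c_def)
    qed (auto simp: c_def)
  qed
  also have "\<dots> = ennreal (R powr ?b) * gag \<sigma> \<Omega> u x"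
    unfolding gag_def using gag_integrand_measurable[OF um] by (intro nn_integral_cmult) auto
  finally have *: "ennreal (?m * (c - a)\<^sup>2) \<le> ennreal (R powr ?b) * gag \<sigma> \<Omega> u x"
    using le by (meson ennreal_leI order_trans)
  have "ennreal ((c - a)\<^sup>2) = ennreal (1 / ?m) * ennreal (?m * (c - a)\<^sup>2)"
    using E(2) by (simp flip: ennreal_mult)
  also have "\<dots> \<le> ennreal (1 / ?m) * (ennreal (R powr ?b) * gag \<sigma> \<Omega> u x)"
    by (rule mult_left_mono[OF *]) simp
  also have "\<dots> = ennreal (R powr ?b / ?m) * gag \<sigma> \<Omega> u x"
    using E(2) by (simp add: mult.assoc[symmetric] ennreal_mult[symmetric])
  finally show ?thesis by (simp add: c_def a_def)
qed

lemma C1c_avg_diff_le: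
  fixes u :: "'a::euclidean_space \<Rightarrow> real"
  assumes u: "u \<in> C1c \<Omega>'" and "\<Omega> \<in> sets borel"
    and "E \<in> sets borel" "emeasure lborel E < \<infinity>" "0 < measure lborel E" "E \<subseteq> \<Omega>"
    and "\<And>y. y \<in> E \<Longrightarrow> norm (x - y) \<le> R" "0 < \<sigma>"
  shows "ennreal ((u x - avg E u)\<^sup>2) \<le>
    ennreal (R powr (real DIM('a) + 2 * \<sigma>) / measure lborel E) * gag \<sigma> \<Omega> u x"
proof -
  have "integrable lborel (\<lambda>x. u x)" "integrable lborel (\<lambda>x. (u x)\<^sup>2)"
    by (rule C1c_integrable[OF u]; auto intro!: continuous_intros)+
  from diff_avg_le[OF C1c_measurable[OF u] assms(2) this assms(3-)] show ?thesis by blast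
qed

text \<open>A Hedberg-type argument: the oscillation of \<open>\<phi>\<close> at scale \<open>r\<close> around \<open>x\<close> is controlled by
  \<open>r powr \<sigma> * sqrt (gag \<phi> x)\<close>, the average itself by a negative power of \<open>r\<close>; one optimises over \<open>r\<close>.\<close>

lemma improved_Sobolev_pointwise:
  fixes s :: real
  assumes n: "0 < \<sigma>" "2 * \<sigma> < n" and M: "0 < M" and K: "0 \<le> K" and G: "0 \<le> G"
    and s: "\<And>r. 0 < r \<Longrightarrow> \<exists>a. (s - a)\<^sup>2 \<le> K * r powr (2 * \<sigma>) * G \<and> \<bar>a\<bar> \<le> M * r powr (- (n - 2 * \<sigma>) / 2)"
  defines "p \<equiv> 2 * n / (n - 2 * \<sigma>)"
  shows "\<bar>s\<bar> powr p \<le> (sqrt K + 1) powr p * M powr (p - 2) * G"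
proof (cases "G = 0")
  case True
  have "s = 0"
  proof (rule ccontr)
    assume "s \<noteq> 0"
    \<comment> \<open>This radius makes the bound for the average equal to |s|/2, whereas
      \<open>G = 0\<close> forces \<open>s = a\<close>.\<close>
    define r where "r = (\<bar>s\<bar> / (2 * M)) powr (- 2 / (n - 2 * \<sigma>))"
    have "0 < r" using \<open>s \<noteq> 0\<close> M by (simp add: r_def)
    then obtain a where a: "(s - a)\<^sup>2 \<le> 0" "\<bar>a\<bar> \<le> M * r powr (- (n - 2 * \<sigma>) / 2)"
      using s[of r] True by auto
    have "- 2 / (n - 2 * \<sigma>) * (- (n - 2 * \<sigma>) / 2) = 1" using n by (simp add: field_simps)
    then have "r powr (- (n - 2 * \<sigma>) / 2) = \<bar>s\<bar> / (2 * M)"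
      unfolding r_def powr_powr using M \<open>s \<noteq> 0\<close> by (simp del: times_divide_eq_right times_divide_eq_left)
    then have "\<bar>s\<bar> \<le> M * (\<bar>s\<bar> / (2 * M))" using a by auto
    then show False using M \<open>s \<noteq> 0\<close> by simp
  qed
  then show ?thesis using n True by (simp add: p_def)
next
  case False
  then have "0 < G" using G by simp
  have "0 < n" "0 < p" using n by (auto simp: p_def)
  \<comment> \<open>The radius with r^n = M^2 / G balances the oscillation bound against the bound
    for the average: both then have the size of \<open>t\<close>.\<close>
  define r where "r = (M\<^sup>2 / G) powr (1 / n)"
  have r: "0 < r" using M \<open>0 < G\<close> by (simp add: r_def)
  have rn: "r powr n = M\<^sup>2 / G" unfolding r_def powr_powr using \<open>0 < n\<close> M \<open>0 < G\<close> by simp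
  define t where "t = M * r powr (- (n - 2 * \<sigma>) / 2)"
  have "0 < t" using M r by (simp add: t_def)
  obtain a where a: "(s - a)\<^sup>2 \<le> K * r powr (2 * \<sigma>) * G" "\<bar>a\<bar> \<le> t"
    using s[OF r] by (auto simp: t_def)
  have Gr: "G = M\<^sup>2 * r powr (- n)" using rn M \<open>0 < G\<close> r by (simp add: powr_minus field_simps)
  have "t\<^sup>2 = M\<^sup>2 * (r powr (- (n - 2 * \<sigma>) / 2) * r powr (- (n - 2 * \<sigma>) / 2))"
    by (simp add: t_def power2_eq_square)
  also have "\<dots> = M\<^sup>2 * (r powr (2 * \<sigma>) * r powr (- n))" by (simp flip: powr_add)
  finally have "K * r powr (2 * \<sigma>) * G = K * t\<^sup>2" by (simp add: Gr)
  also have "\<dots> = (sqrt K * t)\<^sup>2" using K by (simp add: power_mult_distrib)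
  finally have "(s - a)\<^sup>2 \<le> (sqrt K * t)\<^sup>2" using a(1) by simp
  then have "\<bar>s - a\<bar> \<le> sqrt K * t" using K \<open>0 < t\<close> by (simp add: abs_le_square_iff[symmetric])
  then have "\<bar>s\<bar> \<le> (sqrt K + 1) * t" using a(2) by (simp add: distrib_right)
  then have "\<bar>s\<bar> powr p \<le> ((sqrt K + 1) * t) powr p" using \<open>0 < p\<close> by (intro powr_mono2) auto
  also have "\<dots> = (sqrt K + 1) powr p * (M powr p * r powr (- n))"
  proof -
    have "- (n - 2 * \<sigma>) / 2 * p = - n" using n by (simp add: p_def field_simps)
    then show ?thesis using K M r unfolding t_def by (simp add: powr_mult powr_powr)
  qed
  also have "M powr p * r powr (- n) = M powr (p - 2) * G"
  proof -
    have "M powr (p - 2) = M powr p / M\<^sup>2" using M by (simp add: powr_diff)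
    then show ?thesis using M by (simp add: Gr)
  qed
  finally show ?thesis by (simp add: mult.assoc)
qed

text \<open>\<open>M\<close> bounds a Morrey-type norm of \<open>u\<close>. The ball is shifted
  along \<open>en\<close> until \<open>x\<close> lies on its boundary sphere, so that only averages
  inside the half space enter, at every scale. Its points are within 2r of \<open>x\<close> and its
  volume is v r^n, whence \<open>K\<close>; integrating the pointwise bound over \<open>x\<close>
  produces the form.\<close>

lemma improved_Sobolev:
  fixes \<sigma> :: real
  assumes n: "0 < \<sigma>" "2 * \<sigma> < real DIM('a::euclidean_space)"
  obtains C where "0 < C"
    "\<And>(u :: 'a \<Rightarrow> real) M. u \<in> C1c halfspace \<Longrightarrow> 0 < M \<Longrightarrow>
      (\<And>x r. x \<in> halfspace \<Longrightarrow> 0 < r \<Longrightarrow> \<bar>avg (ball (x + r *\<^sub>R en) r) u\<bar> \<le> M * r powr (- (real DIM('a) - 2 * \<sigma>) / 2)) \<Longrightarrow>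
      Lpow (pcrit \<sigma> TYPE('a)) halfspace u \<le> ennreal (C * M powr (pcrit \<sigma> TYPE('a) - 2)) * Ifrac \<sigma> halfspace u"
proof -
  let ?n = "real DIM('a)" and ?p = "pcrit \<sigma> TYPE('a)"
  define v where "v = unit_ball_vol ?n"
  have v: "0 < v" by (simp add: v_def)
  define K where "K = 2 powr (?n + 2 * \<sigma>) / v"
  have K: "0 \<le> K" using v by (simp add: K_def)
  define C where "C = (sqrt K + 1) powr ?p"
  have "0 < C" using K by (simp add: C_def add_nonneg_eq_0_iff)
  show thesis
  proof
    show "0 < C" by fact
    fix u :: "'a \<Rightarrow> real" and M :: real
    assume u: "u \<in> C1c halfspace" and M: "0 < M"
      and A: "\<And>x r. x \<in> halfspace \<Longrightarrow> 0 < r \<Longrightarrow> \<bar>avg (ball (x + r *\<^sub>R en) r) u\<bar> \<le> M * r powr (- (?n - 2 * \<sigma>) / 2)"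
    have um[measurable]: "u \<in> borel_measurable borel" by (rule C1c_measurable[OF u])
    let ?c = "C * M powr (?p - 2)"
    have c: "0 < ?c" using \<open>0 < C\<close> M by simp
    have pt: "ennreal (\<bar>u x\<bar> powr ?p) \<le> ennreal ?c * gag \<sigma> halfspace u x" if x: "x \<in> halfspace" for x
    proof (cases "gag \<sigma> halfspace u x = \<infinity>")
      case True
      then show ?thesis using \<open>0 < C\<close> M by (simp add: ennreal_mult_top)
    next
      case False
      then obtain G where G: "0 \<le> G" "gag \<sigma> halfspace u x = ennreal G"
        by (cases "gag \<sigma> halfspace u x") auto
      have "\<exists>a. (u x - a)\<^sup>2 \<le> K * r powr (2 * \<sigma>) * G \<and> \<bar>a\<bar> \<le> M * r powr (- (?n - 2 * \<sigma>) / 2)" if r: "0 < r" for r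
      proof (intro exI conjI)
        let ?E = "ball (x + r *\<^sub>R en) r"
        show "\<bar>avg ?E u\<bar> \<le> M * r powr (- (?n - 2 * \<sigma>) / 2)" by (rule A[OF x r])
        have m: "measure lborel ?E = v * r powr ?n"
          using content_ball[of r "x + r *\<^sub>R en"] r by (simp add: v_def powr_realpow)
        have d: "norm (x - y) \<le> 2 * r" if "y \<in> ?E" for y
        proof -
          have "norm (x - y) \<le> norm (x + r *\<^sub>R en - y) + norm (r *\<^sub>R (en :: 'a))"
            using norm_triangle_ineq4[of "x + r *\<^sub>R en - y" "r *\<^sub>R en"] by simp
          then show ?thesis using that r by (simp add: dist_norm)
        qed
        have sub: "?E \<subseteq> halfspace"
        proof
          fix y assume "y \<in> ?E"
          then have "norm (x + r *\<^sub>R en - y) < r" by (simp add: dist_norm)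
          moreover have "(x + r *\<^sub>R en - y) \<bullet> en \<le> norm (x + r *\<^sub>R en - y)"
            using norm_cauchy_schwarz[of "x + r *\<^sub>R en - y" en] by simp
          ultimately show "y \<in> halfspace" using x by (simp add: halfspace_def inner_diff_left inner_add_left)
        qed
        have "0 < measure lborel ?E" using v r by (simp add: m)
        moreover have "emeasure lborel ?E < \<infinity>" using emeasure_lborel_ball_finite by blast
        ultimately have "ennreal ((u x - avg ?E u)\<^sup>2) \<le> ennreal ((2 * r) powr (?n + 2 * \<sigma>) / measure lborel ?E) * ennreal G"
          unfolding G(2)[symmetric] by (intro C1c_avg_diff_le[OF u] sub d n) auto
        also have "\<dots> = ennreal ((2 * r) powr (?n + 2 * \<sigma>) / measure lborel ?E * G)"
          using G by (intro ennreal_mult[symmetric]) auto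
        also have "(2 * r) powr (?n + 2 * \<sigma>) / measure lborel ?E = K * r powr (2 * \<sigma>)"
          using r v by (simp add: m K_def powr_mult powr_add)
        finally show "(u x - avg ?E u)\<^sup>2 \<le> K * r powr (2 * \<sigma>) * G"
          using K G by (subst (asm) ennreal_le_iff) auto
      qed
      from improved_Sobolev_pointwise[OF n M K G(1) this]
      have "\<bar>u x\<bar> powr ?p \<le> ?c * G" by (simp add: C_def pcrit_def)
      then have "ennreal (\<bar>u x\<bar> powr ?p) \<le> ennreal (?c * G)" by (rule ennreal_leI)
      also have "\<dots> = ennreal ?c * gag \<sigma> halfspace u x" using c G by (simp add: ennreal_mult)
      finally show ?thesis .
    qed
    have "Lpow ?p halfspace u \<le> (\<integral>\<^sup>+ x. ennreal ?c * (indicator halfspace x * gag \<sigma> halfspace u x) \<partial>lborel)"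
      unfolding Lpow_def by (intro nn_integral_mono) (use pt in \<open>auto simp: indicator_def\<close>)
    also have "\<dots> = ennreal ?c * Ifrac \<sigma> halfspace u"
      using gag_measurable[OF um halfspace_sets] by (simp add: Ifrac_gag[OF um halfspace_sets] nn_integral_cmult)
    finally show "Lpow ?p halfspace u \<le> ennreal ?c * Ifrac \<sigma> halfspace u" .
  qed
qed

section \<open>Local compactness\<close>

definition grid :: "nat \<Rightarrow> 'a::euclidean_space \<Rightarrow> 'a" where
  "grid m x = (\<Sum>b\<in>Basis. (of_int \<lfloor>2 ^ m * (x \<bullet> b)\<rfloor> / 2 ^ m) *\<^sub>R b)"

text \<open>Open dyadic cube of side 2^(-m). Points on the faces belong to no cell, but every
  \<open>x\<close> is close to the cell attached to \<open>grid m x\<close>, so no exceptional set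
  arises.\<close>

definition cell :: "nat \<Rightarrow> 'a::euclidean_space \<Rightarrow> 'a set" where
  "cell m a = box a (a + (1 / 2 ^ m) *\<^sub>R One)"

lemma grid_inner: "b \<in> Basis \<Longrightarrow> grid m x \<bullet> b = of_int \<lfloor>2 ^ m * (x \<bullet> b)\<rfloor> / 2 ^ m"
  by (simp add: grid_def)

lemma grid_bounds:
  assumes "b \<in> Basis"
  shows "grid m x \<bullet> b \<le> x \<bullet> b" "x \<bullet> b \<le> grid m x \<bullet> b + 1 / 2 ^ m"
proof -
  have "of_int \<lfloor>2 ^ m * (x \<bullet> b)\<rfloor> \<le> 2 ^ m * (x \<bullet> b)" "2 ^ m * (x \<bullet> b) \<le> of_int \<lfloor>2 ^ m * (x \<bullet> b)\<rfloor> + 1"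
    by linarith+
  then show "grid m x \<bullet> b \<le> x \<bullet> b" "x \<bullet> b \<le> grid m x \<bullet> b + 1 / 2 ^ m"
    using assms by (simp_all add: grid_inner field_simps)
qed

lemma range_grid_countable: "countable (range (grid m :: 'a::euclidean_space \<Rightarrow> 'a))"
proof -
  have "range (grid m :: 'a \<Rightarrow> 'a) \<subseteq>
    (\<lambda>i. \<Sum>b\<in>Basis. (of_int (i b) / 2 ^ m) *\<^sub>R b) ` (Basis \<rightarrow>\<^sub>E (UNIV :: int set))"
  proof (rule image_subsetI)
    fix x :: 'a
    show "grid m x \<in> (\<lambda>i. \<Sum>b\<in>Basis. (of_int (i b) / 2 ^ m) *\<^sub>R b) ` (Basis \<rightarrow>\<^sub>E (UNIV :: int set))"
      by (rule image_eqI[of _ _ "restrict (\<lambda>b. \<lfloor>2 ^ m * (x \<bullet> b)\<rfloor>) Basis"]) (auto simp: grid_def)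
  qed
  then show ?thesis
    by (rule countable_subset) (intro countable_image countable_PiE; simp)
qed

lemma grid_cball_finite: "finite (grid m ` cball (0 :: 'a::euclidean_space) N)"
proof -
  define L where "L = \<lceil>2 ^ m * N\<rceil> + 1"
  have "grid m ` cball (0 :: 'a) N \<subseteq>
    (\<lambda>i. \<Sum>b\<in>Basis. (of_int (i b) / 2 ^ m) *\<^sub>R b) ` (Basis \<rightarrow>\<^sub>E {-L..L})"
  proof (rule image_subsetI)
    fix x :: 'a assume x: "x \<in> cball 0 N"
    have "\<lfloor>2 ^ m * (x \<bullet> b)\<rfloor> \<in> {-L..L}" if "b \<in> Basis" for b
    proof -
      have "\<bar>x \<bullet> b\<bar> \<le> N" using x Basis_le_norm[OF that, of x] by simp
      then have "\<bar>2 ^ m * (x \<bullet> b)\<bar> \<le> 2 ^ m * N" by (simp add: abs_mult)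
      then have "2 ^ m * (x \<bullet> b) \<le> 2 ^ m * N" "- (2 ^ m * N) \<le> 2 ^ m * (x \<bullet> b)" by linarith+
      then show ?thesis unfolding L_def atLeastAtMost_iff by linarith
    qed
    then show "grid m x \<in> (\<lambda>i. \<Sum>b\<in>Basis. (of_int (i b) / 2 ^ m) *\<^sub>R b) ` (Basis \<rightarrow>\<^sub>E {-L..L})"
      by (intro image_eqI[of _ _ "restrict (\<lambda>b. \<lfloor>2 ^ m * (x \<bullet> b)\<rfloor>) Basis"]) (auto simp: grid_def)
  qed
  then show ?thesis
    by (rule finite_subset) (intro finite_imageI finite_PiE; simp)
qed

lemma measure_cell: "measure lborel (cell m a :: 'a::euclidean_space set) = (1 / 2 ^ m) ^ DIM('a)"
proof -
  have "measure lborel (cell m a) = (\<Prod>b\<in>(Basis::'a set). ((1 / 2 ^ m) *\<^sub>R One :: 'a) \<bullet> b)"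
    unfolding cell_def by (subst measure_lborel_box_eq) (simp add: inner_add_left del: inner_sum_left_Basis)
  also have "\<dots> = (1 / 2 ^ m) ^ DIM('a)" by simp
  finally show ?thesis .
qed

lemma emeasure_cell_finite: "emeasure lborel (cell m a :: 'a::euclidean_space set) < \<infinity>"
  unfolding cell_def using emeasure_lborel_box_finite by blast

lemma cell_sets[measurable]: "cell m a \<in> sets borel"
  unfolding cell_def by simp

lemma dist_cell_grid:
  assumes "y \<in> cell m (grid m x)"
  shows "norm (x - y :: 'a::euclidean_space) \<le> real DIM('a) / 2 ^ m"
proof -
  have "norm (x - y) \<le> (\<Sum>b\<in>Basis. \<bar>(x - y) \<bullet> b\<bar>)" by (rule norm_le_l1)
  also have "\<dots> \<le> (\<Sum>b\<in>(Basis::'a set). 1 / 2 ^ m)"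
  proof (rule sum_mono)
    fix b :: 'a assume b: "b \<in> Basis"
    have "grid m x \<bullet> b < y \<bullet> b" "y \<bullet> b < grid m x \<bullet> b + 1 / 2 ^ m"
      using assms b by (auto simp: cell_def mem_box inner_add_left)
    then show "\<bar>(x - y) \<bullet> b\<bar> \<le> 1 / 2 ^ m"
      using grid_bounds[OF b, where m=m and x=x] by (auto simp: inner_diff_left abs_le_iff)
  qed
  also have "\<dots> = real DIM('a) / 2 ^ m" by simp
  finally show ?thesis .
qed

text \<open>The pointwise bound |u| \<le> 1 + |u|^p does the work of Hoelder's inequality.\<close>

lemma abs_integral_le_Lpow:
  fixes u :: "'a::euclidean_space \<Rightarrow> real"
  assumes u: "u \<in> C1c \<Omega>" and p: "1 \<le> p" and "0 \<le> B" and B: "Lpow p UNIV u \<le> ennreal B"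
    and E: "E \<in> sets borel" "emeasure lborel E < \<infinity>" "measure lborel E \<le> m"
  shows "\<bar>LINT y:E|lborel. u y\<bar> \<le> m + B"
proof -
  have c: "continuous_on UNIV (\<lambda>s::real. \<bar>s\<bar> powr p)"
    by (rule continuous_on_powr') (use p in \<open>auto intro!: continuous_intros\<close>)
  have i: "integrable lborel (\<lambda>x. \<bar>u x\<bar> powr p)" "integrable lborel (\<lambda>x. \<bar>u x\<bar>)"
    using C1c_integrable[OF u c] C1c_integrable[OF u, of abs] p continuous_on_rabs[OF continuous_on_id, of UNIV]
    by auto
  have iE: "integrable lborel (indicator E :: 'a \<Rightarrow> real)" using E by simp
  have "\<bar>LINT y:E|lborel. u y\<bar> \<le> (LINT y|lborel. \<bar>indicator E y *\<^sub>R u y\<bar>)"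
    unfolding set_lebesgue_integral_def by (rule integral_abs_bound)
  also have "\<dots> \<le> (LINT y|lborel. indicator E y + \<bar>u y\<bar> powr p)"
  proof (rule integral_mono)
    fix y
    have "\<bar>u y\<bar> \<le> 1 + \<bar>u y\<bar> powr p"
    proof (cases "\<bar>u y\<bar> \<le> 1")
      case False
      then have "\<bar>u y\<bar> powr 1 \<le> \<bar>u y\<bar> powr p" using p by (intro powr_mono) auto
      then show ?thesis using False by simp
    qed (simp add: add_increasing2)
    then show "\<bar>indicator E y *\<^sub>R u y\<bar> \<le> indicator E y + \<bar>u y\<bar> powr p"
      by (auto simp: indicator_def)
    show "integrable lborel (\<lambda>y. \<bar>indicator E y *\<^sub>R u y\<bar>)"
      using integrable_mult_indicator[OF _ i(2), of E] E by (simp add: abs_mult)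
  qed (use i iE in auto)
  also have "\<dots> = measure lborel E + (LINT y|lborel. \<bar>u y\<bar> powr p)" using i iE by simp
  also have "(LINT y|lborel. \<bar>u y\<bar> powr p) \<le> B"
  proof -
    have "(LINT y|lborel. \<bar>u y\<bar> powr p) = enn2real (Lpow p UNIV u)"
      unfolding Lpow_def using i by (subst integral_eq_nn_integral) auto
    also have "\<dots> \<le> B" using B \<open>0 \<le> B\<close> by (simp add: enn2real_leI)
    finally show ?thesis .
  qed
  finally show ?thesis using E(3) by simp
qed

text \<open>There are countably many pairs of a level and a grid point, and the integrals over cells
  are bounded by \<open>1 + B\<close> because cells have measure at most 1.
  \<open>function_convergent_subsequence\<close> performs the diagonal extraction.\<close>

lemma cell_averages_converge:
  fixes w :: "nat \<Rightarrow> 'a::euclidean_space \<Rightarrow> real"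
  assumes w: "\<And>k. w k \<in> C1c UNIV" and p: "1 \<le> p" and B: "0 \<le> B" "\<And>k. Lpow p UNIV (w k) \<le> ennreal B"
  obtains s where "strict_mono (s :: nat \<Rightarrow> nat)"
    "\<And>m x. convergent (\<lambda>k. avg (cell m (grid m x)) (w (s k)))"
proof -
  let ?S = "(SIGMA m:UNIV. range (grid m :: 'a \<Rightarrow> 'a))"
  let ?f = "\<lambda>k (m, a). LINT y:cell m a|lborel. w k y"
  have "countable ?S" by (intro countable_SIGMA range_grid_countable) auto
  moreover have "norm (?f k z) \<le> 1 + B" for k z
  proof -
    obtain m a where z: "z = (m, a)" by (cases z)
    have "measure lborel (cell m a) \<le> 1" unfolding measure_cell by (simp add: power_le_one)
    then show ?thesis unfolding z using abs_integral_le_Lpow[OF w p B cell_sets emeasure_cell_finite] by simp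
  qed
  ultimately obtain s where s: "strict_mono (s :: nat \<Rightarrow> nat)"
    "\<And>z. z \<in> ?S \<Longrightarrow> \<exists>l. (\<lambda>n. ?f (s n) z) \<longlonglongrightarrow> l"
    using function_convergent_subsequence[of ?S ?f "1 + B"] by blast
  have "convergent (\<lambda>k. avg (cell m (grid m x)) (w (s k)))" for m x
  proof -
    have "(m, grid m x) \<in> ?S" by auto
    from s(2)[OF this] have "convergent (\<lambda>n. LINT y:cell m (grid m x)|lborel. w (s n) y)"
      by (auto simp: convergent_def)
    then show ?thesis unfolding avg_def divide_inverse by (intro convergent_mult convergent_const)
  qed
  with s(1) show thesis by (rule that)
qed

text \<open>Outside a set that is small by Chebyshev's inequality, uniformly in \<open>k\<close>,
  each function is within e/3 of its cell average once the cells are fine enough. At that fixed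
  level only finitely many cells belong to points of the ball, so one index \<open>K\<close> makes
  all their averages Cauchy up to e/3.\<close>

lemma Cauchy_in_measure:
  fixes w :: "nat \<Rightarrow> 'a::euclidean_space \<Rightarrow> real"
  assumes w: "\<And>k. w k \<in> C1c UNIV" and \<sigma>: "0 < \<sigma>" and B: "0 \<le> B" "\<And>k. Ifrac \<sigma> UNIV (w k) \<le> ennreal B"
    and conv: "\<And>m x. convergent (\<lambda>k. avg (cell m (grid m x)) (w k))" and e: "0 < e" "0 < d"
  shows "\<exists>K. \<forall>k\<ge>K. \<forall>l\<ge>K. emeasure lborel {x \<in> cball 0 N. e < \<bar>w k x - w l x\<bar>} \<le> ennreal d"
proof -
  let ?n = "real DIM('a)"
  have wm[measurable]: "w k \<in> borel_measurable borel" for k by (rule C1c_measurable[OF w])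
  \<comment> \<open>The constant of \<open>C1c_avg_diff_le\<close> for a cell of level
    \<open>m\<close>, with R = n / 2^m and volume 2^(-mn); it decays like 2^(-2 \<sigma> m).\<close>
  define c where "c m = ?n powr (?n + 2 * \<sigma>) * (2 powr (- 2 * \<sigma>)) ^ m" for m
  have c0: "0 < c m" for m by (simp add: c_def)
  have "c \<longlonglongrightarrow> ?n powr (?n + 2 * \<sigma>) * 0"
    unfolding c_def using \<sigma> powr_less_one[of "2::real" "- 2 * \<sigma>"] by (intro tendsto_mult tendsto_const LIMSEQ_power_zero) auto
  then have "c \<longlonglongrightarrow> 0" by simp
  \<comment> \<open>The factor 18 is 9, from squaring e/3, times 2, because two exceptional sets
    share \<open>d\<close>.\<close>
  then have "(\<lambda>m. c m * (18 * B / e\<^sup>2)) \<longlonglongrightarrow> 0" by (rule tendsto_mult_left_zero)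
  then have "eventually (\<lambda>m. c m * (18 * B / e\<^sup>2) < d) sequentially" using e(2) by (rule order_tendstoD)
  then obtain m where m: "c m * (18 * B / e\<^sup>2) < d" by (auto simp: eventually_sequentially)
  let ?a = "\<lambda>k x. avg (cell m (grid m x)) (w k)"
  have osc: "ennreal ((w k x - ?a k x)\<^sup>2) \<le> ennreal (c m) * gag \<sigma> UNIV (w k) x" for k x
  proof -
    have "ennreal ((w k x - ?a k x)\<^sup>2) \<le>
       ennreal ((?n / 2 ^ m) powr (?n + 2 * \<sigma>) / measure lborel (cell m (grid m x))) * gag \<sigma> UNIV (w k) x"
      by (rule C1c_avg_diff_le[OF w _ cell_sets emeasure_cell_finite])
         (use \<sigma> dist_cell_grid in \<open>auto simp: measure_cell\<close>)
    also have "(?n / 2 ^ m) powr (?n + 2 * \<sigma>) / measure lborel (cell m (grid m x)) = c m"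
    proof -
      define q where "q = 2 powr (- real m)"
      have q: "0 < q" "1 / 2 ^ m = q" by (simp_all add: q_def powr_minus powr_realpow inverse_eq_divide)
      have "(?n / 2 ^ m) powr (?n + 2 * \<sigma>) = (?n * q) powr (?n + 2 * \<sigma>)" by (simp flip: q(2))
      also have "\<dots> = ?n powr (?n + 2 * \<sigma>) * q powr (?n + 2 * \<sigma>)" using q(1) by (simp add: powr_mult)
      also have "q powr (?n + 2 * \<sigma>) = q powr ?n * q powr (2 * \<sigma>)" by (rule powr_add)
      also have "q powr (2 * \<sigma>) = (2 powr (- 2 * \<sigma>)) powr real m"
        unfolding q_def powr_powr by (simp add: mult.commute)
      also have "\<dots> = (2 powr (- 2 * \<sigma>)) ^ m" by (rule powr_realpow) simp
      finally have "(?n / 2 ^ m) powr (?n + 2 * \<sigma>) = c m * q ^ DIM('a)"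
        using q(1) by (simp add: c_def powr_realpow)
      then show ?thesis unfolding measure_cell q(2) using q(1) by simp
    qed
    finally show ?thesis .
  qed
  let ?A = "\<lambda>k. {x \<in> UNIV. 1 \<le> ennreal (9 * c m / e\<^sup>2) * gag \<sigma> UNIV (w k) x}"
  have gm[measurable]: "gag \<sigma> UNIV (w k) \<in> borel_measurable borel" for k
    using gag_measurable[OF wm, of UNIV] by simp
  have Am: "?A k \<in> sets lborel" for k
    using measurable_sets_borel[of "\<lambda>x. ennreal (9 * c m / e\<^sup>2) * gag \<sigma> UNIV (w k) x" borel "{1..}"]
    by (simp add: vimage_def)
  have A: "emeasure lborel (?A k) \<le> ennreal (d / 2)" for k
  proof -
    have "emeasure lborel (?A k) \<le> ennreal (9 * c m / e\<^sup>2) * (\<integral>\<^sup>+ x. gag \<sigma> UNIV (w k) x * indicator UNIV x \<partial>lborel)"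
      by (rule nn_integral_Markov_inequality) auto
    also have "(\<integral>\<^sup>+ x. gag \<sigma> UNIV (w k) x * indicator UNIV x \<partial>lborel) = Ifrac \<sigma> UNIV (w k)"
      using Ifrac_gag[OF wm, of UNIV] by simp
    also have "ennreal (9 * c m / e\<^sup>2) * Ifrac \<sigma> UNIV (w k) \<le> ennreal (9 * c m / e\<^sup>2) * ennreal B"
      by (intro mult_left_mono B) auto
    also have "\<dots> = ennreal (9 * c m / e\<^sup>2 * B)" using B(1) c0[of m] by (intro ennreal_mult[symmetric]) auto
    also have "\<dots> \<le> ennreal (d / 2)" using m by (intro ennreal_leI) (simp add: field_simps)
    finally show ?thesis .
  qed
  have "\<exists>K. \<forall>k\<ge>K. \<forall>l\<ge>K. \<forall>a\<in>grid m ` cball 0 N. \<bar>avg (cell m a) (w k) - avg (cell m a) (w l)\<bar> < e/3"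
  proof -
    have "\<exists>K. \<forall>k\<ge>K. \<forall>l\<ge>K. \<bar>avg (cell m a) (w k) - avg (cell m a) (w l)\<bar> < e/3" if "a \<in> grid m ` cball 0 N" for a
    proof -
      have "Cauchy (\<lambda>k. avg (cell m a) (w k))" using conv that by (auto intro: convergent_Cauchy)
      from CauchyD[OF this, of "e/3"] e show ?thesis by simp
    qed
    then obtain K where K: "\<And>a k l. a \<in> grid m ` cball 0 N \<Longrightarrow> K a \<le> k \<Longrightarrow> K a \<le> l \<Longrightarrow>
        \<bar>avg (cell m a) (w k) - avg (cell m a) (w l)\<bar> < e/3" by metis
    let ?K = "Max (insert 0 (K ` grid m ` cball 0 N))"
    have "K a \<le> ?K" if "a \<in> grid m ` cball 0 N" for a
      by (rule Max_ge) (use that grid_cball_finite in auto)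
    then have "\<bar>avg (cell m a) (w k) - avg (cell m a) (w l)\<bar> < e/3"
      if "?K \<le> k" "?K \<le> l" "a \<in> grid m ` cball 0 N" for k l a
      using K[OF that(3) order_trans[OF _ that(1)] order_trans[OF _ that(2)]] that(3) by blast
    then show ?thesis by blast
  qed
  then obtain K where K: "\<And>k l a. K \<le> k \<Longrightarrow> K \<le> l \<Longrightarrow> a \<in> grid m ` cball 0 N \<Longrightarrow>
      \<bar>avg (cell m a) (w k) - avg (cell m a) (w l)\<bar> < e/3" by blast
  show ?thesis
  proof (intro exI allI impI)
    fix k l assume kl: "K \<le> k" "K \<le> l"
    have "{x \<in> cball 0 N. e < \<bar>w k x - w l x\<bar>} \<subseteq> ?A k \<union> ?A l"
    proof
      fix x assume x: "x \<in> {x \<in> cball 0 N. e < \<bar>w k x - w l x\<bar>}"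
      have "\<bar>?a k x - ?a l x\<bar> < e/3"
        using K[OF kl, of "grid m x"] x by auto
      then have "\<exists>j\<in>{k, l}. e/3 \<le> \<bar>w j x - ?a j x\<bar>"
      proof -
        have "e < \<bar>w k x - w l x\<bar>" using x by simp
        then have "e/3 \<le> \<bar>w k x - ?a k x\<bar> \<or> e/3 \<le> \<bar>w l x - ?a l x\<bar>"
          using \<open>\<bar>?a k x - ?a l x\<bar> < e/3\<close> by linarith
        then show ?thesis by auto
      qed
      then obtain j where j: "j \<in> {k, l}" "e/3 \<le> \<bar>w j x - ?a j x\<bar>" by blast
      have "(e/3)\<^sup>2 \<le> \<bar>w j x - ?a j x\<bar>\<^sup>2"
        using j(2) e by (intro power_mono) auto
      then have "ennreal (e\<^sup>2 / 9) \<le> ennreal ((w j x - ?a j x)\<^sup>2)"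
        by (intro ennreal_leI) (simp add: power_divide)
      also note osc
      finally have "ennreal (9 / e\<^sup>2) * ennreal (e\<^sup>2 / 9) \<le> ennreal (9 / e\<^sup>2) * (ennreal (c m) * gag \<sigma> UNIV (w j) x)"
        by (rule mult_left_mono) auto
      moreover have "ennreal (9 / e\<^sup>2) * ennreal (e\<^sup>2 / 9) = 1" using e by (simp flip: ennreal_mult)
      moreover have "ennreal (9 / e\<^sup>2) * (ennreal (c m) * gag \<sigma> UNIV (w j) x) = ennreal (9 * c m / e\<^sup>2) * gag \<sigma> UNIV (w j) x"
        using c0[of m] by (simp add: mult.assoc[symmetric] ennreal_mult[symmetric])
      ultimately show "x \<in> ?A k \<union> ?A l" using j(1) by auto
    qed
    then have "emeasure lborel {x \<in> cball 0 N. e < \<bar>w k x - w l x\<bar>} \<le> emeasure lborel (?A k \<union> ?A l)"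
      by (intro emeasure_mono sets.Un Am)
    also have "\<dots> \<le> emeasure lborel (?A k) + emeasure lborel (?A l)"
      by (intro emeasure_subadditive Am)
    also have "\<dots> \<le> ennreal (d / 2) + ennreal (d / 2)" by (intro add_mono A)
    also have "\<dots> = ennreal d" using e by (simp flip: ennreal_plus)
    finally show "emeasure lborel {x \<in> cball 0 N. e < \<bar>w k x - w l x\<bar>} \<le> ennreal d" .
  qed
qed

text \<open>Radius \<open>j\<close>, tolerance 2^(-j) and measure 2^(-j) are tied together: by
  Borel-Cantelli almost every point leaves the exceptional sets, is eventually inside the balls, and
  then sees increments dominated by a geometric series.\<close>

lemma Cauchy_in_measure_imp_AE_subseq:
  fixes w :: "nat \<Rightarrow> 'a::euclidean_space \<Rightarrow> real"
  assumes wm[measurable]: "\<And>k. w k \<in> borel_measurable borel"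
    and C: "\<And>N e d. 0 < e \<Longrightarrow> 0 < d \<Longrightarrow>
      \<exists>K. \<forall>k\<ge>K. \<forall>l\<ge>K. emeasure lborel {x \<in> cball 0 N. e < \<bar>w k x - w l x\<bar>} \<le> ennreal d"
  obtains s where "strict_mono (s :: nat \<Rightarrow> nat)" "AE x in lborel. convergent (\<lambda>k. w (s k) x)"
proof -
  let ?P = "\<lambda>j k l. emeasure lborel {x \<in> cball 0 (real j). (1/2)^j < \<bar>w k x - w l x\<bar>} \<le> ennreal ((1/2)^j)"
  have "\<exists>s. \<forall>j. (\<forall>k\<ge>s j. \<forall>l\<ge>s j. ?P j k l)
      \<and> s j < s (Suc j)"
  proof (rule dependent_nat_choice)
    show "\<exists>x. \<forall>k\<ge>x. \<forall>l\<ge>x. ?P 0 k l"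
      using C[of "(1/2)^0" "(1/2)^0" "real 0"] by simp
    fix x j
    obtain K where "\<forall>k\<ge>K. \<forall>l\<ge>K. ?P (Suc j) k l"
      using C[of "(1/2)^(Suc j)" "(1/2)^(Suc j)" "real (Suc j)"] by auto
    then show "\<exists>y. (\<forall>k\<ge>y. \<forall>l\<ge>y. ?P (Suc j) k l) \<and> x < y"
      by (intro exI[of _ "max K (Suc x)"]) auto
  qed
  then obtain s where s: "\<And>j k l. s j \<le> k \<Longrightarrow> s j \<le> l \<Longrightarrow>
      ?P j k l"
    and smono: "\<And>j. s j < s (Suc j)" by blast
  have sm: "strict_mono s" using smono by (simp add: strict_mono_Suc_iff)
  define A where "A j = {x \<in> cball 0 (real j). (1/2)^j < \<bar>w (s (Suc j)) x - w (s j) x\<bar>}" for j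
  have Am: "A j \<in> sets lborel" for j unfolding A_def by measurable
  have A: "emeasure lborel (A j) \<le> ennreal ((1/2)^j)" for j
    unfolding A_def by (rule s) (use smono[of j] in auto)
  have "AE x in lborel. eventually (\<lambda>j. x \<in> space lborel - A j) sequentially"
  proof (rule borel_cantelli_AE1[OF Am])
    show "emeasure lborel (A j) < \<infinity>" for j using A[of j] by (simp add: le_less_trans)
    have "measure lborel (A j) \<le> (1/2)^j" for j
      using A[of j] by (simp add: measure_def enn2real_leI)
    then show "summable (\<lambda>j. measure lborel (A j))"
      by (intro summable_comparison_test'[OF summable_geometric[of "1/2::real"], of 0]) auto
  qed
  then have "AE x in lborel. convergent (\<lambda>k. w (s k) x)"
  proof eventually_elim
    case (elim x)
    obtain N0 where N0: "\<And>j. N0 \<le> j \<Longrightarrow> x \<notin> A j" using elim by (auto simp: eventually_sequentially)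
    define N where "N = max N0 (nat \<lceil>norm x\<rceil>)"
    have le: "norm (w (s (Suc j)) x - w (s j) x) \<le> (1/2)^j" if "N \<le> j" for j
    proof -
      have "norm x \<le> real j" using that unfolding N_def by linarith
      then show ?thesis using N0[of j] that by (auto simp: A_def N_def)
    qed
    have "summable (\<lambda>j. w (s (Suc j)) x - w (s j) x)"
      by (rule summable_comparison_test'[OF summable_geometric[of "1/2::real"] le]) auto
    then have "convergent (\<lambda>n. \<Sum>j<n. w (s (Suc j)) x - w (s j) x)" by (simp add: summable_iff_convergent)
    then have "convergent (\<lambda>n. w (s n) x - w (s 0) x)" unfolding sum_lessThan_telescope[of "\<lambda>j. w (s j) x"] .
    from convergent_add[OF this convergent_const[of "w (s 0) x"]] show ?case by simp
  qed
  with sm show thesis by (rule that)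
qed

text \<open>Finite-dimensional data (the cell averages) converge along a subsequence and the form
  controls the rest. An almost everywhere limit is the input of Fatou's and the Brezis-Lieb
  lemma.\<close>

lemma Rellich:
  fixes w :: "nat \<Rightarrow> 'a::euclidean_space \<Rightarrow> real"
  assumes w: "\<And>k. w k \<in> C1c UNIV" and \<sigma>: "0 < \<sigma>" and p: "1 \<le> p" and B: "0 \<le> B"
    "\<And>k. Ifrac \<sigma> UNIV (w k) \<le> ennreal B" "\<And>k. Lpow p UNIV (w k) \<le> ennreal B"
  obtains s U where "strict_mono (s :: nat \<Rightarrow> nat)" "U \<in> borel_measurable borel"
    "AE x in lborel. (\<lambda>k. w (s k) x) \<longlonglongrightarrow> U x"
proof -
  have wm[measurable]: "w k \<in> borel_measurable borel" for k by (rule C1c_measurable[OF w])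
  obtain s where s: "strict_mono (s :: nat \<Rightarrow> nat)" "\<And>m x. convergent (\<lambda>k. avg (cell m (grid m x)) (w (s k)))"
    by (rule cell_averages_converge[where w=w and p=p and B=B, OF w p B(1,3)]) (rule that; assumption)
  have "\<exists>K. \<forall>k\<ge>K. \<forall>l\<ge>K. emeasure lborel {x \<in> cball 0 N. e < \<bar>w (s k) x - w (s l) x\<bar>} \<le> ennreal d"
    if "0 < e" "0 < d" for N e d
    by (rule Cauchy_in_measure[where w="\<lambda>k. w (s k)", OF w \<sigma> B(1,2) s(2) that])
  then obtain t where t: "strict_mono (t :: nat \<Rightarrow> nat)" "AE x in lborel. convergent (\<lambda>k. w (s (t k)) x)"
    by (rule Cauchy_in_measure_imp_AE_subseq[of "\<lambda>k. w (s k)", OF wm]) (assumption | rule that; assumption)+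
  define U where "U x = lim (\<lambda>k. w (s (t k)) x)" for x
  show thesis
  proof
    show "strict_mono (s \<circ> t)" using s(1) t(1) by (rule strict_mono_o)
    have "(\<lambda>x. lim (\<lambda>k. w (s (t k)) x)) \<in> borel_measurable borel"
      by (rule borel_measurable_lim_metric[OF wm])
    then show "U \<in> borel_measurable borel" by (simp add: U_def[abs_def])
    show "AE x in lborel. (\<lambda>k. w ((s \<circ> t) k) x) \<longlonglongrightarrow> U x"
      using t(2) by eventually_elim (simp add: U_def convergent_LIMSEQ_iff)
  qed
qed

section \<open>The Sobolev quotients\<close>

lemma pcrit_facts:
  assumes "0 < \<sigma>" "2 * \<sigma> < real DIM('a::euclidean_space)"
  shows "2 < pcrit \<sigma> TYPE('a)" "0 < (real DIM('a) - 2 * \<sigma>) / real DIM('a)" "(real DIM('a) - 2 * \<sigma>) / real DIM('a) < 1"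
  using assms by (simp_all add: pcrit_def field_simps)

lemma Quot_nonneg: "0 \<le> Quot \<sigma> \<Omega> u"
  by (simp add: Quot_def)

lemma Quot_le_imp:
  fixes u :: "'a::euclidean_space \<Rightarrow> real"
  assumes "0 < Lpow (pcrit \<sigma> TYPE('a)) \<Omega> u" "Lpow (pcrit \<sigma> TYPE('a)) \<Omega> u < \<infinity>" "S \<le> Quot \<sigma> \<Omega> u"
  shows "S * enn2real (Lpow (pcrit \<sigma> TYPE('a)) \<Omega> u) powr ((real DIM('a) - 2 * \<sigma>) / real DIM('a)) \<le> enn2real (Ifrac \<sigma> \<Omega> u)"
proof -
  have "0 < enn2real (Lpow (pcrit \<sigma> TYPE('a)) \<Omega> u)" using assms(1,2) by (simp add: enn2real_positive_iff)
  then show ?thesis using assms(3) by (simp add: Quot_def pos_le_divide_eq)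
qed

text \<open>The constant as a Sobolev inequality. Functions vanishing almost everywhere are
  included, since \<open>powr\<close> with base 0 is 0.\<close>

lemma Sfull_le:
  fixes u :: "'a::euclidean_space \<Rightarrow> real"
  assumes "u \<in> Hfull \<sigma>" "Lpow (pcrit \<sigma> TYPE('a)) UNIV u < \<infinity>"
  shows "Sfull \<sigma> TYPE('a) * enn2real (Lpow (pcrit \<sigma> TYPE('a)) UNIV u) powr ((real DIM('a) - 2 * \<sigma>) / real DIM('a)) \<le> enn2real (Ifrac \<sigma> UNIV u)"
proof (cases "Lpow (pcrit \<sigma> TYPE('a)) UNIV u = 0")
  case False
  then have 0: "0 < Lpow (pcrit \<sigma> TYPE('a)) UNIV u" by (simp add: zero_less_iff_neq_zero)
  have "Sfull \<sigma> TYPE('a) \<le> Quot \<sigma> UNIV u"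
    unfolding Sfull_def by (rule cINF_lower) (use assms 0 in \<open>auto intro!: bdd_belowI[of _ 0] simp: Quot_nonneg\<close>)
  then show ?thesis by (rule Quot_le_imp[OF 0 assms(2)])
qed simp

lemma Shalf_le:
  fixes u :: "'a::euclidean_space \<Rightarrow> real"
  assumes "u \<in> Hhalf \<sigma>" "Lpow (pcrit \<sigma> TYPE('a)) halfspace u < \<infinity>"
  shows "ennreal (Shalf \<sigma> TYPE('a) * enn2real (Lpow (pcrit \<sigma> TYPE('a)) halfspace u) powr ((real DIM('a) - 2 * \<sigma>) / real DIM('a))) \<le> Ifrac \<sigma> halfspace u"
proof (cases "Lpow (pcrit \<sigma> TYPE('a)) halfspace u = 0 \<or> Ifrac \<sigma> halfspace u = \<infinity>")
  case False
  then have 0: "0 < Lpow (pcrit \<sigma> TYPE('a)) halfspace u" by (simp add: zero_less_iff_neq_zero)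
  have "Shalf \<sigma> TYPE('a) \<le> Quot \<sigma> halfspace u"
    unfolding Shalf_def by (rule cINF_lower) (use assms 0 in \<open>auto intro!: bdd_belowI[of _ 0] simp: Quot_nonneg\<close>)
  from ennreal_leI[OF Quot_le_imp[OF 0 assms(2) this]] show ?thesis
    using False by (subst (asm) ennreal_enn2real) (auto simp: less_top)
qed auto

lemma C1c_Hhalf:
  fixes u :: "'a::euclidean_space \<Rightarrow> real"
  assumes "u \<in> C1c halfspace" "0 < \<sigma>" "2 * \<sigma> < real DIM('a)"
  shows "u \<in> Hhalf \<sigma>"
proof -
  have "Ifrac \<sigma> halfspace (\<lambda>x. u x - u x) = 0" "Lpow (pcrit \<sigma> TYPE('a)) halfspace (\<lambda>x. u x - u x) = 0"
    using pcrit_facts(1)[OF assms(2,3)] by (simp_all add: Ifrac_def Lpow_def)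
  then show ?thesis
    unfolding Hhalf_def using C1c_measurable[OF assms(1)] C1c_vanish[OF assms(1)] assms(1)
    by (intro CollectI conjI exI[of _ "\<lambda>_. u"]) auto
qed

text \<open>Scale and translation invariance of the quotient: rescaling back moves the competitor to
  the standard half space. It provides the Sobolev inequality, with one constant, on half spaces
  that recede to infinity.\<close>

lemma Shalf_le_shifted:
  fixes u :: "'a::euclidean_space \<Rightarrow> real"
  assumes u: "u \<in> C1c ((\<lambda>x. t + r *\<^sub>R x) -` halfspace)" and r: "0 < r" and \<sigma>: "0 < \<sigma>" "2 * \<sigma> < real DIM('a)"
  defines "\<Omega> \<equiv> (\<lambda>x. t + r *\<^sub>R x) -` halfspace"
  shows "ennreal (Shalf \<sigma> TYPE('a) * enn2real (Lpow (pcrit \<sigma> TYPE('a)) \<Omega> u) powr ((real DIM('a) - 2 * \<sigma>) / real DIM('a))) \<le> Ifrac \<sigma> \<Omega> u"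
proof -
  let ?t = "- (1 / r) *\<^sub>R t"
  let ?v = "resc \<sigma> (1 / r) ?t u"
  have inv: "t + r *\<^sub>R (?t + (1 / r) *\<^sub>R x) = x" for x using r by (simp add: algebra_simps)
  then have eq: "(\<lambda>x. ?t + (1 / r) *\<^sub>R x) -` \<Omega> = halfspace" by (auto simp: \<Omega>_def)
  have um: "u \<in> borel_measurable borel" by (rule C1c_measurable[OF u])
  have \<Omega>: "\<Omega> \<in> sets borel" unfolding \<Omega>_def
    using measurable_sets_borel[of "\<lambda>x. t + r *\<^sub>R x" borel halfspace] by simp
  have v: "?v \<in> C1c halfspace" using C1c_resc[of u \<Omega> "1 / r" \<sigma> ?t] u r unfolding eq by (simp add: \<Omega>_def)
  have "Lpow (pcrit \<sigma> TYPE('a)) halfspace ?v < \<infinity>"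
    by (rule C1c_Lpow_finite[OF v]) (use pcrit_facts[OF \<sigma>] in auto)
  from Shalf_le[OF C1c_Hhalf[OF v \<sigma>] this] show ?thesis
    using Ifrac_resc[OF um \<Omega>, of "1 / r" \<sigma> ?t] Lpow_resc[OF um \<Omega>, of "1 / r" \<sigma> ?t] r \<sigma> unfolding eq by simp
qed

section \<open>Membership in the whole-space class and comparison of the two constants\<close>

lemma pint_level_finite:
  assumes [measurable]: "u \<in> borel_measurable M" and q: "0 < q" and fin: "pint q M u < \<infinity>" and "0 < \<tau>"
  shows "emeasure M {x \<in> space M. \<tau> < \<bar>u x\<bar>} < \<infinity>"
proof -
  have "emeasure M {x \<in> space M. \<tau> < \<bar>u x\<bar>} \<le> emeasure M {x \<in> space M. 1 \<le> ennreal (1 / \<tau> powr q) * ennreal (\<bar>u x\<bar> powr q)}"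
  proof (rule emeasure_mono)
    show "{x \<in> space M. \<tau> < \<bar>u x\<bar>} \<subseteq> {x \<in> space M. 1 \<le> ennreal (1 / \<tau> powr q) * ennreal (\<bar>u x\<bar> powr q)}"
    proof clarify
      fix x assume "\<tau> < \<bar>u x\<bar>"
      then have "\<tau> powr q \<le> \<bar>u x\<bar> powr q" using q \<open>0 < \<tau>\<close> by (intro powr_mono2) auto
      then have "1 \<le> 1 / \<tau> powr q * \<bar>u x\<bar> powr q" using \<open>0 < \<tau>\<close> by (simp add: field_simps)
      then show "1 \<le> ennreal (1 / \<tau> powr q) * ennreal (\<bar>u x\<bar> powr q)"
        by (simp flip: ennreal_mult ennreal_1 add: ennreal_leI del: ennreal_1)
    qed
  qed measurable
  also have "\<dots> \<le> ennreal (1 / \<tau> powr q) * (\<integral>\<^sup>+ x. ennreal (\<bar>u x\<bar> powr q) * indicator (space M) x \<partial>M)"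
    by (rule nn_integral_Markov_inequality) auto
  also have "(\<integral>\<^sup>+ x. ennreal (\<bar>u x\<bar> powr q) * indicator (space M) x \<partial>M) = pint q M u"
    unfolding pint_def by (intro nn_integral_cong) (auto simp: indicator_def)
  also have "ennreal (1 / \<tau> powr q) * pint q M u < \<infinity>" using fin by (simp add: ennreal_mult_less_top)
  finally show ?thesis .
qed

lemma Hfull_I:
  fixes u :: "'a::euclidean_space \<Rightarrow> real"
  assumes [measurable]: "u \<in> borel_measurable borel" and "Ifrac \<sigma> UNIV u < \<infinity>" and "Lpow p UNIV u < \<infinity>" "0 < p"
  shows "u \<in> Hfull \<sigma>"
proof -
  have "pint p lborel u < \<infinity>" using assms(3) by (simp add: Lpow_eq_pint)
  from pint_level_finite[OF _ assms(4) this] show ?thesis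
    unfolding Hfull_def using assms(2) by auto
qed

lemma Lpow_evenext_le:
  assumes "0 < p"
  obtains C where "0 \<le> C" "\<And>u :: 'a::euclidean_space \<Rightarrow> real. u \<in> borel_measurable borel \<Longrightarrow> (\<And>x. x \<notin> halfspace \<Longrightarrow> u x = 0) \<Longrightarrow>
    Lpow p UNIV (evenext u) \<le> ennreal C * Lpow p halfspace u"
proof -
  obtain C where C: "0 \<le> C" "\<And>M (f :: 'a \<Rightarrow> real) g. f \<in> borel_measurable M \<Longrightarrow> g \<in> borel_measurable M \<Longrightarrow>
       pint p M (\<lambda>x. f x + g x) \<le> 2 * pint p M f + ennreal C * pint p M g"
    using pint_add_le[OF assms] by metis
  show thesis
  proof
    show "0 \<le> 2 + C" using C(1) by simp
    fix u :: "'a \<Rightarrow> real" assume um: "u \<in> borel_measurable borel" and z: "\<And>x. x \<notin> halfspace \<Longrightarrow> u x = 0"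
    have um': "(\<lambda>x. u (rfl x)) \<in> borel_measurable borel" by (rule measurable_compose[OF rfl_measurable um])
    have eq: "(\<lambda>x. indicator halfspace x * u x) = u"
    proof
      fix x show "indicator halfspace x * u x = u x" using z[of x] by (cases "x \<in> halfspace") auto
    qed
    have "Lpow p UNIV (evenext u) = pint p lborel (\<lambda>x. u x + u (rfl x))"
      unfolding Lpow_eq_pint by (simp add: evenext_def)
    also have "\<dots> \<le> 2 * pint p lborel u + ennreal C * pint p lborel (\<lambda>x. u (rfl x))"
      by (rule C(2)) (use um um' in auto)
    also have "\<dots> = ennreal (2 + C) * pint p lborel u"
      using C(1) pint_rfl[OF um] by (simp add: distrib_right)
    finally show "Lpow p UNIV (evenext u) \<le> ennreal (2 + C) * Lpow p halfspace u"
      unfolding Lpow_eq_pint eq .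
  qed
qed

text \<open>The even extension is a competitor on the whole space whose form is at most four times
  larger and whose mass is not smaller. This is the source of the positivity of
  \<open>Shalf\<close>.\<close>

lemma Sfull_le_half:
  fixes u :: "'a::euclidean_space \<Rightarrow> real"
  assumes um: "u \<in> borel_measurable borel" and z: "\<And>x. x \<notin> halfspace \<Longrightarrow> u x = 0"
    and \<sigma>: "0 < \<sigma>" "2 * \<sigma> < real DIM('a)" and S: "0 \<le> Sfull \<sigma> TYPE('a)"
    and fin: "Ifrac \<sigma> halfspace u < \<infinity>" "Lpow (pcrit \<sigma> TYPE('a)) halfspace u < \<infinity>"
  shows "Sfull \<sigma> TYPE('a) * enn2real (Lpow (pcrit \<sigma> TYPE('a)) halfspace u) powr ((real DIM('a) - 2 * \<sigma>) / real DIM('a))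
      \<le> 4 * enn2real (Ifrac \<sigma> halfspace u)"
proof -
  let ?p = "pcrit \<sigma> TYPE('a)" and ?al = "(real DIM('a) - 2 * \<sigma>) / real DIM('a)"
  have p: "0 < ?p" using pcrit_facts[OF \<sigma>] by simp
  obtain C where "Lpow ?p UNIV (evenext u) \<le> ennreal C * Lpow ?p halfspace u"
    using Lpow_evenext_le[OF p] um z by metis
  also have "\<dots> < \<infinity>" using fin by (simp add: ennreal_mult_less_top)
  finally have Lf: "Lpow ?p UNIV (evenext u) < \<infinity>" .
  have I: "Ifrac \<sigma> UNIV (evenext u) \<le> 4 * Ifrac \<sigma> halfspace u" by (rule Ifrac_evenext_le[OF um z \<sigma>(1)])
  also have "\<dots> < \<infinity>" using fin by (simp add: ennreal_mult_less_top)
  finally have If: "Ifrac \<sigma> UNIV (evenext u) < \<infinity>" .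
  have "Lpow ?p halfspace u \<le> Lpow ?p UNIV (evenext u)"
    unfolding Lpow_def
  proof (rule nn_integral_mono)
    fix x show "ennreal (\<bar>u x\<bar> powr ?p) * indicator halfspace x \<le> ennreal (\<bar>evenext u x\<bar> powr ?p) * indicator UNIV x"
      using evenext_half[of u x, OF z] by (cases "x \<in> halfspace") auto
  qed
  then have "enn2real (Lpow ?p halfspace u) \<le> enn2real (Lpow ?p UNIV (evenext u))"
    using Lf by (intro enn2real_mono) auto
  then have "Sfull \<sigma> TYPE('a) * enn2real (Lpow ?p halfspace u) powr ?al
      \<le> Sfull \<sigma> TYPE('a) * enn2real (Lpow ?p UNIV (evenext u)) powr ?al"
    using S pcrit_facts[OF \<sigma>] by (intro mult_left_mono powr_mono2) auto
  also have "\<dots> \<le> enn2real (Ifrac \<sigma> UNIV (evenext u))"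
    by (rule Sfull_le[OF Hfull_I[OF evenext_measurable[OF um] If Lf p] Lf])
  also have "\<dots> \<le> enn2real (4 * Ifrac \<sigma> halfspace u)"
    using I fin by (intro enn2real_mono) (auto simp: ennreal_mult_less_top)
  also have "\<dots> = 4 * enn2real (Ifrac \<sigma> halfspace u)" by (simp add: enn2real_mult)
  finally show ?thesis .
qed

text \<open>Brezis-Lieb is applied to \<open>f k\<close> with limit \<open>g\<close> and to
  \<open>f k - w\<close> with limit \<open>g - w\<close>. Both have the same remainder
  \<open>f k - g\<close>, which is eliminated between the two.\<close>

lemma pint_diff_limit:
  fixes f :: "nat \<Rightarrow> 'b \<Rightarrow> real"
  assumes q: "0 < q" and fm[measurable]: "\<And>k. f k \<in> borel_measurable M" and gm[measurable]: "g \<in> borel_measurable M"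
    and wm[measurable]: "w \<in> borel_measurable M"
    and lim: "AE x in M. (\<lambda>k. f k x) \<longlonglongrightarrow> g x" and "0 \<le> B"
    and B: "\<And>k. pint q M (f k) \<le> ennreal B" and w: "pint q M w < \<infinity>"
    and L: "(\<lambda>k. enn2real (pint q M (f k))) \<longlonglongrightarrow> L"
  shows "(\<lambda>k. enn2real (pint q M (\<lambda>x. f k x - w x))) \<longlonglongrightarrow>
      L - enn2real (pint q M g) + enn2real (pint q M (\<lambda>x. g x - w x))"
    and "(\<lambda>k. enn2real (pint q M (\<lambda>x. f k x - g x))) \<longlonglongrightarrow> L - enn2real (pint q M g)"
    and "enn2real (pint q M g) \<le> L"
proof -
  have 1: "(\<lambda>k. enn2real (pint q M (f k)) - enn2real (pint q M (\<lambda>x. f k x - g x))) \<longlonglongrightarrow> enn2real (pint q M g)"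
    by (rule brezis_lieb[OF q fm gm lim \<open>0 \<le> B\<close> B])
  from tendsto_diff[OF L 1]
  show 2: "(\<lambda>k. enn2real (pint q M (\<lambda>x. f k x - g x))) \<longlonglongrightarrow> L - enn2real (pint q M g)" by simp
  from LIMSEQ_le_const[OF 2, of 0] show "enn2real (pint q M g) \<le> L" by auto
  obtain C where C: "0 \<le> C" "\<And>M (f :: 'b \<Rightarrow> real) g. f \<in> borel_measurable M \<Longrightarrow> g \<in> borel_measurable M \<Longrightarrow>
       pint q M (\<lambda>x. f x + g x) \<le> 2 * pint q M f + ennreal C * pint q M g"
    using pint_add_le[OF q] by metis
  define B' where "B' = 2 * B + C * enn2real (pint q M w)"
  have "0 \<le> B'" using C(1) \<open>0 \<le> B\<close> by (simp add: B'_def)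
  have B': "pint q M (\<lambda>x. f k x - w x) \<le> ennreal B'" for k
  proof -
    have "pint q M (\<lambda>x. f k x + - w x) \<le> 2 * pint q M (f k) + ennreal C * pint q M (\<lambda>x. - w x)"
      by (rule C(2)) auto
    also have "\<dots> \<le> 2 * ennreal B + ennreal C * ennreal (enn2real (pint q M w))"
      using B w by (intro add_mono mult_left_mono) (auto simp: pint_minus)
    also have "\<dots> = ennreal B'" using C(1) \<open>0 \<le> B\<close> by (simp add: B'_def ennreal_mult)
    finally show ?thesis by simp
  qed
  have "AE x in M. (\<lambda>k. f k x - w x) \<longlonglongrightarrow> g x - w x"
    using lim by eventually_elim (intro tendsto_intros)
  from brezis_lieb[OF q _ _ this \<open>0 \<le> B'\<close> B']
  have "(\<lambda>k. enn2real (pint q M (\<lambda>x. f k x - w x)) - enn2real (pint q M (\<lambda>x. f k x - g x))) \<longlonglongrightarrow> enn2real (pint q M (\<lambda>x. g x - w x))"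
    by simp
  from tendsto_add[OF this 2]
  show "(\<lambda>k. enn2real (pint q M (\<lambda>x. f k x - w x))) \<longlonglongrightarrow>
      L - enn2real (pint q M g) + enn2real (pint q M (\<lambda>x. g x - w x))" by (simp add: add.commute)
qed

lemma AE_lborel_pair:
  fixes P :: "'a::euclidean_space \<Rightarrow> bool"
  assumes "AE x in lborel. P x"
  shows "AE z in (lborel :: ('a \<times> 'a) measure). P (fst z) \<and> P (snd z)"
proof -
  obtain N where N: "N \<in> null_sets lborel" "{x. \<not> P x} \<subseteq> N"
    using assms unfolding eventually_ae_filter by auto
  have Nb: "N \<in> sets borel" using N by auto
  have mf: "(\<lambda>z::'a\<times>'a. indicator N (fst z) :: ennreal) \<in> borel_measurable borel"
    by (rule measurable_compose[OF fst_borel_measurable]) (use Nb in simp)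
  have ms: "(\<lambda>z::'a\<times>'a. indicator N (snd z) :: ennreal) \<in> borel_measurable borel"
    by (rule measurable_compose[OF snd_borel_measurable]) (use Nb in simp)
  have iN: "(\<integral>\<^sup>+ y. indicator N y \<partial>(lborel :: 'a measure)) = 0" using N by (simp add: null_sets_def)
  have aN: "AE x in lborel. indicator N x = (0 :: ennreal)"
    using AE_not_in[OF N(1)] by eventually_elim simp
  have "(\<integral>\<^sup>+ z. indicator N (fst z) \<partial>(lborel :: ('a\<times>'a) measure)) = (\<integral>\<^sup>+ x. (\<integral>\<^sup>+ y. indicator N x \<partial>(lborel :: 'a measure)) \<partial>(lborel :: 'a measure))"
    using nn_integral_pair_lborel[OF mf] by simp
  also have "\<dots> = (\<integral>\<^sup>+ x. 0 \<partial>(lborel :: 'a measure))"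
    by (rule nn_integral_cong_AE) (use aN in eventually_elim, simp)
  finally have f0: "(\<integral>\<^sup>+ z. indicator N (fst z) \<partial>(lborel :: ('a\<times>'a) measure)) = 0" by simp
  have "(\<integral>\<^sup>+ z. indicator N (snd z) \<partial>(lborel :: ('a\<times>'a) measure)) = 0"
    using nn_integral_pair_lborel[OF ms] by (simp add: iN)
  with f0 have "AE z in (lborel :: ('a\<times>'a) measure). indicator N (fst z) = (0::ennreal)"
    "AE z in (lborel :: ('a\<times>'a) measure). indicator N (snd z) = (0::ennreal)"
    using mf ms by (simp_all add: nn_integral_0_iff_AE)
  then show ?thesis by eventually_elim (use N(2) in \<open>auto simp: indicator_def split: if_splits\<close>)
qed

text \<open>Uniform integrability: the part of \<open>f k\<close> truncated at height
  \<open>l\<close> tends to 0 by dominated convergence on a fixed ball containing all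
  \<open>E k\<close>, and the part above \<open>l\<close> contributes at most B / l^(p-1).\<close>

lemma nonvanishing:
  fixes f :: "nat \<Rightarrow> 'a::euclidean_space \<Rightarrow> real"
  assumes f: "\<And>k. f k \<in> C1c UNIV" and p: "1 < p" and B: "0 \<le> B" "\<And>k. Lpow p UNIV (f k) \<le> ennreal B"
    and E: "\<And>k. E k \<in> sets borel" "\<And>k. E k \<subseteq> cball 0 R"
    and c: "0 < c" "\<And>k. c \<le> \<bar>LINT y:E k|lborel. f k y\<bar>"
  shows "\<not> (AE x in lborel. (\<lambda>k. f k x) \<longlonglongrightarrow> 0)"
proof
  assume lim: "AE x in lborel. (\<lambda>k. f k x) \<longlonglongrightarrow> 0"
  have fm[measurable]: "f k \<in> borel_measurable borel" for k by (rule C1c_measurable[OF f])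
  have cp: "continuous_on UNIV (\<lambda>s::real. \<bar>s\<bar> powr p)"
    by (rule continuous_on_powr') (use p in \<open>auto intro!: continuous_intros\<close>)
  have ip: "integrable lborel (\<lambda>x. \<bar>f k x\<bar> powr p)" for k using C1c_integrable[OF f cp] p by auto
  have Bp: "(LINT y|lborel. \<bar>f k y\<bar> powr p) \<le> B" for k
  proof -
    have "(LINT y|lborel. \<bar>f k y\<bar> powr p) = enn2real (Lpow p UNIV (f k))"
      unfolding Lpow_def using ip by (subst integral_eq_nn_integral) auto
    also have "\<dots> \<le> B" using B by (simp add: enn2real_leI)
    finally show ?thesis .
  qed
  \<comment> \<open>Chosen so that the part above \<open>l\<close> stays below c/2; the maximum with
    1 keeps \<open>l\<close> positive.\<close>
  define l where "l = max 1 ((2 * (B + 1) / c) powr (1 / (p - 1)))"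
  have l: "1 \<le> l" by (simp add: l_def)
  have lc: "B / l powr (p - 1) < c / 2"
  proof -
    have "2 * (B + 1) / c = ((2 * (B + 1) / c) powr (1 / (p - 1))) powr (p - 1)"
      using p B c by (simp add: powr_powr)
    also have "\<dots> \<le> l powr (p - 1)" using p by (intro powr_mono2) (auto simp: l_def)
    finally have "2 * (B + 1) \<le> c * l powr (p - 1)" using c by (simp add: field_simps)
    moreover have "0 < l powr (p - 1)" using l by simp
    ultimately show ?thesis by (simp add: field_simps)
  qed
  let ?K = "cball (0::'a) R"
  let ?h = "\<lambda>k y. indicator ?K y * min \<bar>f k y\<bar> l"
  have iK: "integrable lborel (indicator ?K :: 'a \<Rightarrow> real)"
    using emeasure_lborel_cball_finite[of 0 R] by (intro integrable_real_indicator) auto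
  have il: "integrable lborel (\<lambda>y. indicator ?K y * l)" by (rule integrable_mult_left[OF iK])
  have "(\<lambda>k. LINT y|lborel. ?h k y) \<longlonglongrightarrow> (LINT y|lborel. (0 :: real) + 0 * indicator ?K (y::'a))"
  proof (rule integral_dominated_convergence[where w="\<lambda>y. indicator ?K y * l"])
    show "AE y in lborel. (\<lambda>k. ?h k y) \<longlonglongrightarrow> 0 + 0 * indicator ?K y"
      using lim
    proof eventually_elim
      case (elim y)
      have "(\<lambda>k. ?h k y) \<longlonglongrightarrow> indicator ?K y * min \<bar>0\<bar> l" by (intro tendsto_intros elim)
      then show ?case using l by simp
    qed
    show "integrable lborel (\<lambda>y. indicator ?K y * l)" by (rule il)
  qed (use l in \<open>auto simp: indicator_def\<close>)
  then have "(\<lambda>k. LINT y|lborel. ?h k y) \<longlonglongrightarrow> 0" by simp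
  then have "eventually (\<lambda>k. (LINT y|lborel. ?h k y) < c / 2) sequentially"
    using c by (intro order_tendstoD) auto
  then obtain k where k: "(LINT y|lborel. ?h k y) < c / 2" by (auto simp: eventually_sequentially)
  have ih: "integrable lborel (?h k)"
    by (rule Bochner_Integration.integrable_bound[OF il]) (use l in \<open>auto simp: indicator_def\<close>)
  have i1: "integrable lborel (\<lambda>x. \<bar>f k x\<bar>)"
    using C1c_integrable[OF f, of abs] continuous_on_rabs[OF continuous_on_id, of UNIV] by auto
  have "c \<le> \<bar>LINT y:E k|lborel. f k y\<bar>" by (rule c)
  also have "\<dots> \<le> (LINT y|lborel. \<bar>indicator (E k) y *\<^sub>R f k y\<bar>)"
    unfolding set_lebesgue_integral_def by (rule integral_abs_bound)
  also have "\<dots> \<le> (LINT y|lborel. ?h k y + \<bar>f k y\<bar> powr p / l powr (p - 1))"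
  proof (rule integral_mono)
    show "integrable lborel (\<lambda>y. \<bar>indicator (E k) y *\<^sub>R f k y\<bar>)"
      using integrable_mult_indicator[OF _ i1, of "E k"] E by (simp add: abs_mult)
    show "integrable lborel (\<lambda>y. ?h k y + \<bar>f k y\<bar> powr p / l powr (p - 1))" using ih ip by auto
    fix y
    have le: "\<bar>f k y\<bar> \<le> min \<bar>f k y\<bar> l + \<bar>f k y\<bar> powr p / l powr (p - 1)"
    proof (cases "\<bar>f k y\<bar> \<le> l")
      case False
      have "l powr (p - 1) \<le> \<bar>f k y\<bar> powr (p - 1)" using False l p by (intro powr_mono2) auto
      then have "\<bar>f k y\<bar> * l powr (p - 1) \<le> \<bar>f k y\<bar> * \<bar>f k y\<bar> powr (p - 1)" by (intro mult_left_mono) auto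
      also have "\<dots> = \<bar>f k y\<bar> powr p" using False l by (simp add: powr_diff)
      finally have "\<bar>f k y\<bar> \<le> \<bar>f k y\<bar> powr p / l powr (p - 1)" using l by (simp add: pos_le_divide_eq)
      then show ?thesis using l by (simp add: add_increasing)
    qed simp
    show "\<bar>indicator (E k) y *\<^sub>R f k y\<bar> \<le> ?h k y + \<bar>f k y\<bar> powr p / l powr (p - 1)"
    proof (cases "y \<in> E k")
      case True
      then have "y \<in> ?K" using E by blast
      then show ?thesis using le True by simp
    next
      case False
      then show ?thesis using l by (simp add: indicator_def)
    qed
  qed
  also have "\<dots> = (LINT y|lborel. ?h k y) + (LINT y|lborel. \<bar>f k y\<bar> powr p) / l powr (p - 1)"
    using ih ip by simp
  also have "\<dots> \<le> (LINT y|lborel. ?h k y) + B / l powr (p - 1)"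
    using Bp[of k] by (intro add_left_mono divide_right_mono) auto
  also have "\<dots> < c" using k lc by linarith
  finally show False by simp
qed

text \<open>After division by a + b this is x < x^s for both fractions x and 1 - x. It is used with
  s = 2/p, where its strictness makes a splitting of the mass too expensive.\<close>

lemma powr_add_less:
  fixes a b s :: real
  assumes "0 < a" "0 < b" "0 < s" "s < 1"
  shows "(a + b) powr s < a powr s + b powr s"
proof -
  have *: "x < x powr s" if "0 < x" "x < 1" for x :: real
    using powr_less_mono'[of x s 1] that assms by simp
  define x where "x = a / (a + b)"
  have x: "0 < x" "x < 1" "1 - x = b / (a + b)" using assms by (auto simp: x_def field_simps)
  have "1 < x powr s + (1 - x) powr s" using *[of x] *[of "1 - x"] x by simp
  then have "(a + b) powr s * 1 < (a + b) powr s * (x powr s + (1 - x) powr s)"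
    using assms by (intro mult_strict_left_mono) auto
  also have "\<dots> = a powr s + b powr s"
    unfolding x(3) unfolding x_def using assms by (simp add: distrib_left flip: powr_mult)
  finally show ?thesis by simp
qed

section \<open>Splitting off a profile\<close>

text \<open>The domain may move with \<open>k\<close>: at a fixed pair its indicator is eventually
  constant, so convergence is asked for only at points of the limiting domain.\<close>

lemma dq_tendsto:
  assumes ev: "\<And>x. \<forall>\<^sub>F k in sequentially. x \<in> \<Omega>s k \<longleftrightarrow> x \<in> \<Omega>"
    and lim: "fst z \<in> \<Omega> \<longrightarrow> (\<lambda>k. f k (fst z)) \<longlonglongrightarrow> U (fst z)" "snd z \<in> \<Omega> \<longrightarrow> (\<lambda>k. f k (snd z)) \<longlonglongrightarrow> U (snd z)"
  shows "(\<lambda>k. dq \<sigma> (\<Omega>s k) (f k) z) \<longlonglongrightarrow> dq \<sigma> \<Omega> U (z :: 'a::euclidean_space \<times> 'a)"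
proof -
  let ?N = "norm (fst z - snd z) powr ((real DIM('a) + 2 * \<sigma>) / 2)"
  have ev': "\<forall>\<^sub>F k in sequentially. z \<in> \<Omega>s k \<times> \<Omega>s k \<longleftrightarrow> z \<in> \<Omega> \<times> \<Omega>"
    using ev[of "fst z"] ev[of "snd z"] by eventually_elim (auto simp: mem_Times_iff)
  show ?thesis
  proof (cases "z \<in> \<Omega> \<times> \<Omega>")
    case True
    then have l: "(\<lambda>k. f k (fst z)) \<longlonglongrightarrow> U (fst z)" "(\<lambda>k. f k (snd z)) \<longlonglongrightarrow> U (snd z)"
      using lim unfolding mem_Times_iff by blast+
    have "(\<lambda>k. (f k (fst z) - f k (snd z)) * inverse ?N) \<longlonglongrightarrow> (U (fst z) - U (snd z)) * inverse ?N"
      by (intro tendsto_mult tendsto_diff tendsto_const l)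
    moreover have "\<forall>\<^sub>F k in sequentially. (f k (fst z) - f k (snd z)) * inverse ?N = dq \<sigma> (\<Omega>s k) (f k) z"
      using ev'
    proof eventually_elim
      case (elim k)
      then have "z \<in> \<Omega>s k \<times> \<Omega>s k" using True by simp
      then show ?case unfolding dq_def divide_inverse by simp
    qed
    ultimately have "(\<lambda>k. dq \<sigma> (\<Omega>s k) (f k) z) \<longlonglongrightarrow> (U (fst z) - U (snd z)) * inverse ?N"
      by (rule Lim_transform_eventually)
    moreover have "dq \<sigma> \<Omega> U z = (U (fst z) - U (snd z)) * inverse ?N"
      unfolding dq_def divide_inverse using True by simp
    ultimately show ?thesis by (simp only:)
  next
    case False
    have "\<forall>\<^sub>F k in sequentially. dq \<sigma> (\<Omega>s k) (f k) z = dq \<sigma> \<Omega> U z"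
      using ev'
    proof eventually_elim
      case (elim k)
      then have "z \<notin> \<Omega>s k \<times> \<Omega>s k" using False by simp
      then show ?case unfolding dq_def using False by simp
    qed
    then show ?thesis by (rule tendsto_eventually)
  qed
qed

text \<open>The midpoint combinations keep the limit \<open>U\<close>, so Fatou's lemma with
  \<open>l\<close> tending to infinity turns their Cauchy estimate into an estimate of the distance
  to \<open>U\<close>. The Cauchy estimate is exported too, because \<open>boundary_case\<close>
  converts it into convergence of the critical norms.\<close>

lemma C1c_approx:
  fixes f :: "nat \<Rightarrow> 'a::euclidean_space \<Rightarrow> real"
  assumes f: "\<And>k. f k \<in> C1c \<Omega>" and \<Omega>[measurable]: "\<Omega> \<in> sets borel" and B: "0 \<le> B" "\<And>k. Ifrac \<sigma> \<Omega> (f k) \<le> ennreal B"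
    and Um[measurable]: "U \<in> borel_measurable borel" and lim: "AE x in lborel. x \<in> \<Omega> \<longrightarrow> (\<lambda>k. f k x) \<longlonglongrightarrow> U x"
  obtains w e where "\<And>m. w m \<in> C1c \<Omega>" "e \<longlonglongrightarrow> 0" "\<And>m. 0 \<le> e m" "\<And>m. Ifrac \<sigma> \<Omega> (\<lambda>x. w m x - U x) \<le> ennreal (e m)"
    "\<And>m l. m \<le> l \<Longrightarrow> Ifrac \<sigma> \<Omega> (\<lambda>x. w m x - w l x) \<le> ennreal (e m)"
    "AE x in lborel. x \<in> \<Omega> \<longrightarrow> (\<lambda>m. w m x) \<longlonglongrightarrow> U x"
proof -
  have fm: "f k \<in> borel_measurable borel" for k by (rule C1c_measurable[OF f])
  obtain w e where w: "\<And>m. w m \<in> midhull f m" and e: "e \<longlonglongrightarrow> 0" "\<And>m. 0 \<le> e m"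
    and c: "\<And>m l. m \<le> l \<Longrightarrow> Ifrac \<sigma> \<Omega> (\<lambda>x. w m x - w l x) \<le> ennreal (e m)"
    by (rule midhull_Cauchy[where f=f and \<Omega>=\<Omega> and B=B and \<sigma>=\<sigma>, OF fm \<Omega> B]) (rule that; assumption)
  have wC: "w m \<in> C1c \<Omega>" for m by (rule midhull_C1c[where f=f, OF f w])
  have wm[measurable]: "w m \<in> borel_measurable borel" for m by (rule C1c_measurable[OF wC])
  have wl: "AE x in lborel. x \<in> \<Omega> \<longrightarrow> (\<lambda>m. w m x) \<longlonglongrightarrow> U x"
    using lim
  proof eventually_elim
    case (elim x)
    show ?case using elim midhull_tendsto[where f=f and x=x and L="U x" and w=w, OF _ w] by simp
  qed
  have "Ifrac \<sigma> \<Omega> (\<lambda>x. w m x - U x) \<le> ennreal (e m)" for m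
    unfolding Ifrac_eq_pint
  proof (rule pint_Fatou[where f="\<lambda>l. dq \<sigma> \<Omega> (\<lambda>x. w m x - w l x)"])
    show "AE z in lborel. (\<lambda>l. dq \<sigma> \<Omega> (\<lambda>x. w m x - w l x) z) \<longlonglongrightarrow> dq \<sigma> \<Omega> (\<lambda>x. w m x - U x) z"
      using AE_lborel_pair[OF wl]
    proof eventually_elim
      case (elim z)
      have "fst z \<in> \<Omega> \<longrightarrow> (\<lambda>l. w m (fst z) - w l (fst z)) \<longlonglongrightarrow> w m (fst z) - U (fst z)"
        "snd z \<in> \<Omega> \<longrightarrow> (\<lambda>l. w m (snd z) - w l (snd z)) \<longlonglongrightarrow> w m (snd z) - U (snd z)"
        using elim by (auto intro!: tendsto_diff)
      then show ?case
        by (rule dq_tendsto[where \<Omega>s="\<lambda>_. \<Omega>" and f="\<lambda>l x. w m x - w l x" and U="\<lambda>x. w m x - U x", rotated]) simp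
    qed
    show "\<forall>\<^sub>F l in sequentially. pint 2 lborel (dq \<sigma> \<Omega> (\<lambda>x. w m x - w l x)) \<le> ennreal (e m)"
      using eventually_ge_at_top[of m] by eventually_elim (use c in \<open>simp add: Ifrac_eq_pint\<close>)
    show "dq \<sigma> \<Omega> (\<lambda>x. w m x - w l x) \<in> borel_measurable lborel" for l by simp
    show "dq \<sigma> \<Omega> (\<lambda>x. w m x - U x) \<in> borel_measurable lborel" by simp
  qed simp
  then show thesis by (rule that[of w e, OF wC e _ c wl])
qed

lemma pint_eq_0_iff:
  assumes [measurable]: "f \<in> borel_measurable M"
  shows "pint q M f = 0 \<longleftrightarrow> (AE x in M. f x = 0)"
  unfolding pint_def by (subst nn_integral_0_iff_AE) auto

lemma Lpow_eq_pint_vanish: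
  assumes "\<And>x. x \<notin> \<Omega> \<Longrightarrow> f x = 0"
  shows "Lpow p \<Omega> f = pint p lborel f"
proof -
  have "(\<lambda>x. indicator \<Omega> x * f x) = f"
  proof
    fix x show "indicator \<Omega> x * f x = f x" using assms[of x] by (cases "x \<in> \<Omega>") auto
  qed
  then show ?thesis by (simp add: Lpow_eq_pint)
qed

text \<open>The missing mass of a sequence with almost everywhere limit \<open>U\<close>: the remainder \<open>\<psi> k - U\<close> is
  replaced by \<open>\<psi> k - w m\<close> with \<open>w m\<close> close to \<open>U\<close>, which is an admissible competitor.\<close>

lemma profile_decomposition:
  fixes \<psi> :: "nat \<Rightarrow> 'a::euclidean_space \<Rightarrow> real"
  assumes p: "1 < p" and al: "0 < al"
    and \<Omega>[measurable]: "\<Omega> \<in> sets borel" and \<Omega>s[measurable]: "\<And>k. \<Omega>s k \<in> sets borel" and sub: "\<And>k. \<Omega>s k \<subseteq> \<Omega>"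
    and ev: "\<And>K. compact K \<Longrightarrow> K \<subseteq> \<Omega> \<Longrightarrow> \<forall>\<^sub>F k in sequentially. K \<subseteq> \<Omega>s k"
    and \<psi>: "\<And>k. \<psi> k \<in> C1c (\<Omega>s k)" and Um[measurable]: "U \<in> borel_measurable borel"
    and lim: "AE x in lborel. x \<in> \<Omega> \<longrightarrow> (\<lambda>k. \<psi> k x) \<longlonglongrightarrow> U x"
    and B: "0 \<le> B" "\<And>k. Ifrac \<sigma> (\<Omega>s k) (\<psi> k) \<le> ennreal B" "\<And>k. Lpow p (\<Omega>s k) (\<psi> k) \<le> ennreal B"
    and I: "(\<lambda>k. enn2real (Ifrac \<sigma> (\<Omega>s k) (\<psi> k))) \<longlonglongrightarrow> 1"
    and L: "(\<lambda>k. enn2real (Lpow p (\<Omega>s k) (\<psi> k))) \<longlonglongrightarrow> L"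
    and S: "\<And>k f. f \<in> C1c (\<Omega>s k) \<Longrightarrow> ennreal (S * enn2real (Lpow p (\<Omega>s k) f) powr al) \<le> Ifrac \<sigma> (\<Omega>s k) f" "0 \<le> S"
    and w: "\<And>m. w m \<in> C1c \<Omega>" "\<And>m. Ifrac \<sigma> \<Omega> (\<lambda>x. w m x - U x) \<le> ennreal (e m)" "e \<longlonglongrightarrow> 0" "\<And>m. 0 \<le> e m"
    and E: "\<And>k. E k \<in> sets borel" "\<And>k. E k \<subseteq> cball 0 R"
    and c: "0 < c" "\<And>k. c \<le> \<bar>LINT y:E k|lborel. \<psi> k y\<bar>"
  shows "Ifrac \<sigma> \<Omega> U < \<infinity>" "Lpow p \<Omega> U < \<infinity>" "0 < enn2real (Lpow p \<Omega> U)" "enn2real (Lpow p \<Omega> U) \<le> L"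
    and "S * (L - enn2real (Lpow p \<Omega> U)) powr al \<le> 1 - enn2real (Ifrac \<sigma> \<Omega> U)"
    and "(\<lambda>k. enn2real (pint 2 lborel (\<lambda>z. dq \<sigma> (\<Omega>s k) (\<psi> k) z - dq \<sigma> \<Omega> U z))) \<longlonglongrightarrow> 1 - enn2real (Ifrac \<sigma> \<Omega> U)"
proof -
  let ?g = "\<lambda>x. indicator \<Omega> x * U x"
  have gm[measurable]: "?g \<in> borel_measurable borel" by measurable
  have \<psi>m[measurable]: "\<psi> k \<in> borel_measurable borel" for k by (rule C1c_measurable[OF \<psi>])
  have wm[measurable]: "w m \<in> borel_measurable borel" for m by (rule C1c_measurable[OF w(1)])
  have ev1: "\<forall>\<^sub>F k in sequentially. x \<in> \<Omega>s k \<longleftrightarrow> x \<in> \<Omega>" for x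
  proof (cases "x \<in> \<Omega>")
    case True
    then show ?thesis using ev[of "{x}"] by simp
  next
    case False
    then have "\<forall>k. x \<in> \<Omega>s k \<longleftrightarrow> x \<in> \<Omega>" using sub by blast
    then show ?thesis by simp
  qed
  have dlim: "AE z in lborel. (\<lambda>k. dq \<sigma> (\<Omega>s k) (\<psi> k) z) \<longlonglongrightarrow> dq \<sigma> \<Omega> U z"
    using AE_lborel_pair[OF lim]
    by eventually_elim (rule dq_tendsto[where \<Omega>s=\<Omega>s and f=\<psi>, OF ev1], auto)
  have glim: "AE x in lborel. (\<lambda>k. \<psi> k x) \<longlonglongrightarrow> ?g x"
    using lim
  proof eventually_elim
    case (elim x)
    show ?case
    proof (cases "x \<in> \<Omega>")
      case False
      then have "\<psi> k x = 0" for k using sub C1c_vanish[OF \<psi>] by blast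
      then show ?thesis using False by simp
    qed (use elim in simp)
  qed
  have Lp: "Lpow p (\<Omega>s k) (\<psi> k) = pint p lborel (\<psi> k)" for k
    by (rule Lpow_eq_pint_vanish[OF C1c_vanish[OF \<psi>]])
  have LU: "Lpow p \<Omega> U = pint p lborel ?g" by (rule Lpow_eq_pint)
  have dm: "dq \<sigma> (\<Omega>s k) (\<psi> k) \<in> borel_measurable lborel" for k by simp
  have dUm: "dq \<sigma> \<Omega> U \<in> borel_measurable lborel" by simp
  have dB: "pint 2 lborel (dq \<sigma> (\<Omega>s k) (\<psi> k)) \<le> ennreal B" for k using B(2) by (simp add: Ifrac_eq_pint)
  have gB: "pint p lborel (\<psi> k) \<le> ennreal B" for k using B(3) by (simp add: Lp)
  have IB: "Ifrac \<sigma> \<Omega> U \<le> ennreal B"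
    unfolding Ifrac_eq_pint by (rule pint_Fatou[OF dm dUm dlim]) (use dB in auto)
  have LB: "Lpow p \<Omega> U \<le> ennreal B"
    unfolding LU by (rule pint_Fatou[where f=\<psi>, OF _ _ glim]) (use gB p in auto)
  show Ifin: "Ifrac \<sigma> \<Omega> U < \<infinity>" using IB by (rule le_less_trans) simp
  show Lfin: "Lpow p \<Omega> U < \<infinity>" using LB by (rule le_less_trans) simp
  \<comment> \<open>All \<open>E k\<close> lie in one fixed ball and carry an integral of size at
    least \<open>c\<close>, which \<open>nonvanishing\<close> forbids for a sequence tending to 0
    almost everywhere.\<close>
  show "0 < enn2real (Lpow p \<Omega> U)"
  proof (rule ccontr)
    assume "\<not> 0 < enn2real (Lpow p \<Omega> U)"
    then have "pint p lborel ?g = 0" using Lfin unfolding LU by (auto simp: enn2real_positive_iff)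
    then have "AE x in lborel. ?g x = 0" by (subst (asm) pint_eq_0_iff) auto
    with glim have "AE x in lborel. (\<lambda>k. \<psi> k x) \<longlonglongrightarrow> 0" by eventually_elim simp
    moreover have "\<not> (AE x in lborel. (\<lambda>k. \<psi> k x) \<longlonglongrightarrow> 0)"
      by (rule nonvanishing[OF C1c_mono[OF \<psi> subset_UNIV] p B(1) _ E c])
         (use gB in \<open>simp add: Lpow_eq_pint\<close>)
    ultimately show False by contradiction
  qed
  have I': "(\<lambda>k. enn2real (pint 2 lborel (dq \<sigma> (\<Omega>s k) (\<psi> k)))) \<longlonglongrightarrow> 1" using I by (simp add: Ifrac_eq_pint)
  have L': "(\<lambda>k. enn2real (pint p lborel (\<psi> k))) \<longlonglongrightarrow> L" using L by (simp add: Lp)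
  have p0: "0 < p" using p by simp
  show lim1: "(\<lambda>k. enn2real (pint 2 lborel (\<lambda>z. dq \<sigma> (\<Omega>s k) (\<psi> k) z - dq \<sigma> \<Omega> U z))) \<longlonglongrightarrow> 1 - enn2real (Ifrac \<sigma> \<Omega> U)"
    unfolding Ifrac_eq_pint
    by (rule pint_diff_limit(2)[where f="\<lambda>k. dq \<sigma> (\<Omega>s k) (\<psi> k)" and w="dq \<sigma> \<Omega> U" and B=B, OF _ dm dUm dUm dlim B(1) dB _ I'])
       (use Ifin in \<open>simp_all add: Ifrac_eq_pint\<close>)
  show lL: "enn2real (Lpow p \<Omega> U) \<le> L"
    unfolding LU
    by (rule pint_diff_limit(3)[where f=\<psi> and w="?g" and B=B, OF p0 _ _ _ glim B(1) gB _ L'])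
       (use Lfin in \<open>simp_all add: LU\<close>)
  \<comment> \<open>With \<open>m\<close> fixed, the Sobolev inequality for
    \<open>\<psi> k - w m\<close> is passed to the limit in \<open>k\<close>; the limiting form
    exceeds \<open>1 - Ifrac \<sigma> \<Omega> U\<close> by the distance of \<open>w m\<close> to
    \<open>U\<close>, which is at most \<open>e m\<close>.\<close>
  have step: "S * (L - enn2real (Lpow p \<Omega> U)) powr al \<le> 1 - enn2real (Ifrac \<sigma> \<Omega> U) + e m" for m
  proof -
    let ?D = "\<lambda>k. pint 2 lborel (\<lambda>z. dq \<sigma> (\<Omega>s k) (\<psi> k) z - dq \<sigma> \<Omega> (w m) z)"
    let ?D' = "pint 2 lborel (\<lambda>z. dq \<sigma> \<Omega> U z - dq \<sigma> \<Omega> (w m) z)"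
    let ?M = "\<lambda>k. pint p lborel (\<lambda>x. \<psi> k x - w m x)"
    have wI: "Ifrac \<sigma> \<Omega> (w m) < \<infinity>"
    proof -
      have d: "pint 2 lborel (dq \<sigma> \<Omega> (\<lambda>x. w m x - U x)) < \<infinity>"
        using w(2)[of m] unfolding Ifrac_eq_pint by (rule le_less_trans) simp
      have "pint 2 lborel (\<lambda>z. dq \<sigma> \<Omega> (\<lambda>x. w m x - U x) z - (- dq \<sigma> \<Omega> U z)) < \<infinity>"
        by (rule pint_diff_finite) (use d Ifin in \<open>auto simp: pint_minus Ifrac_eq_pint\<close>)
      moreover have "(\<lambda>z. dq \<sigma> \<Omega> (\<lambda>x. w m x - U x) z - (- dq \<sigma> \<Omega> U z)) = dq \<sigma> \<Omega> (w m)"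
        by (auto simp: dq_diff)
      ultimately show ?thesis by (simp add: Ifrac_eq_pint)
    qed
    have wL: "pint p lborel (w m) < \<infinity>"
      using C1c_Lpow_finite[where \<Omega>'=UNIV, OF w(1)[of m] p0] by (simp add: Lpow_eq_pint)
    have wdm: "dq \<sigma> \<Omega> (w m) \<in> borel_measurable lborel" by simp
    have a1: "(\<lambda>k. enn2real (?D k)) \<longlonglongrightarrow>
       1 - enn2real (pint 2 lborel (dq \<sigma> \<Omega> U)) + enn2real (?D')"
      by (rule pint_diff_limit(1)[where f="\<lambda>k. dq \<sigma> (\<Omega>s k) (\<psi> k)" and w="dq \<sigma> \<Omega> (w m)" and B=B, OF _ dm dUm wdm dlim B(1) dB _ I'])
         (use wI in \<open>simp_all add: Ifrac_eq_pint\<close>)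
    have em: "enn2real (?D') \<le> e m"
    proof -
      have "pint 2 lborel (\<lambda>z. dq \<sigma> \<Omega> (w m) z - dq \<sigma> \<Omega> U z) \<le> ennreal (e m)"
        using w(2)[of m] unfolding Ifrac_eq_pint dq_diff[abs_def] .
      then show ?thesis using w(4)[of m] by (subst pint_minus_commute) (simp add: enn2real_leI)
    qed
    have a2: "(\<lambda>k. enn2real (?M k)) \<longlonglongrightarrow>
       L - enn2real (pint p lborel ?g) + enn2real (pint p lborel (\<lambda>x. ?g x - w m x))"
      by (rule pint_diff_limit(1)[where f=\<psi> and w="w m" and B=B, OF p0 _ _ _ glim B(1) gB wL L']) simp_all
    let ?La = "L - enn2real (pint p lborel ?g) + enn2real (pint p lborel (\<lambda>x. ?g x - w m x))"
    have K: "compact (closure {x. w m x \<noteq> 0})" "closure {x. w m x \<noteq> 0} \<subseteq> \<Omega>"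
      using w(1)[of m] by (auto simp: C1c_def)
    have "\<forall>\<^sub>F k in sequentially. S * enn2real (?M k) powr al
        \<le> enn2real (?D k)"
      using ev[OF K]
    proof eventually_elim
      case (elim k)
      have wk: "w m \<in> C1c (\<Omega>s k)" using w(1)[of m] elim by (simp add: C1c_def)
      have f: "(\<lambda>x. \<psi> k x - w m x) \<in> C1c (\<Omega>s k)" by (rule C1c_diff[OF \<psi> wk])
      have "ennreal (S * enn2real (?M k) powr al) \<le> Ifrac \<sigma> (\<Omega>s k) (\<lambda>x. \<psi> k x - w m x)"
      proof -
        have "Lpow p (\<Omega>s k) (\<lambda>x. \<psi> k x - w m x) = ?M k"
          by (rule Lpow_eq_pint_vanish) (rule C1c_vanish[OF f])
        then show ?thesis using S(1)[OF f] by simp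
      qed
      \<comment> \<open>\<open>?D k\<close> mixes two domains. On pairs inside
        \<open>\<Omega>s k\<close> the integrands agree; elsewhere the left one is 0, so an
        inequality remains and its direction is the right one.\<close>
      also have "\<dots> \<le> ?D k"
        unfolding Ifrac_eq_pint pint_def
      proof (intro nn_integral_mono ennreal_leI powr_mono2)
        fix z
        show "\<bar>dq \<sigma> (\<Omega>s k) (\<lambda>x. \<psi> k x - w m x) z\<bar> \<le> \<bar>dq \<sigma> (\<Omega>s k) (\<psi> k) z - dq \<sigma> \<Omega> (w m) z\<bar>"
        proof (cases "z \<in> \<Omega>s k \<times> \<Omega>s k")
          case True
          then have "z \<in> \<Omega> \<times> \<Omega>" using sub by (auto simp: mem_Times_iff)
          then have "dq \<sigma> \<Omega> (w m) z = dq \<sigma> (\<Omega>s k) (w m) z" using True by (simp add: dq_def)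
          then show ?thesis by (simp add: dq_diff)
        qed (simp add: dq_def)
      qed auto
      finally have le: "ennreal (S * enn2real (?M k) powr al) \<le> ?D k" .
      have "?D k < \<infinity>"
        by (rule pint_diff_finite[OF _ dm wdm]) (use dB[of k] wI in \<open>auto simp: Ifrac_eq_pint intro: le_less_trans\<close>)
      then have "enn2real (ennreal (S * enn2real (?M k) powr al)) \<le> enn2real (?D k)"
        using le by (intro enn2real_mono) auto
      then show ?case using S(2) by simp
    qed
    moreover have "(\<lambda>k. S * enn2real (?M k) powr al) \<longlonglongrightarrow> S * ?La powr al"
      using al by (intro tendsto_mult tendsto_const tendsto_powr' a2) auto
    ultimately have "S * ?La powr al \<le> 1 - enn2real (pint 2 lborel (dq \<sigma> \<Omega> U)) + enn2real (?D')"
      using a1 by (intro tendsto_le[OF sequentially_bot a1]) auto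
    \<comment> \<open>The mass of \<open>U - w m\<close> only enlarges the left side and is dropped,
      so closeness of \<open>w m\<close> to \<open>U\<close> in the form is enough.\<close>
    moreover have "S * (L - enn2real (pint p lborel ?g)) powr al \<le> S * ?La powr al"
      using S(2) lL al by (intro mult_left_mono powr_mono2) (auto simp: LU)
    ultimately show ?thesis using em unfolding LU Ifrac_eq_pint by linarith
  qed
  have "(\<lambda>m. 1 - enn2real (Ifrac \<sigma> \<Omega> U) + e m) \<longlonglongrightarrow> 1 - enn2real (Ifrac \<sigma> \<Omega> U) + 0"
    by (intro tendsto_intros w)
  from LIMSEQ_le_const[OF this] step
  show "S * (L - enn2real (Lpow p \<Omega> U)) powr al \<le> 1 - enn2real (Ifrac \<sigma> \<Omega> U)" by auto
qed

text \<open>The translation \<open>y\<close> is kept free of the ball's centre \<open>z\<close>,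
  because the two cases recentre differently: at \<open>z\<close> itself, or at its projection on
  the boundary.\<close>

lemma integral_ball_resc:
  fixes u :: "'a::euclidean_space \<Rightarrow> real"
  assumes um[measurable]: "u \<in> borel_measurable borel" and r: "0 < r"
  shows "(LINT x:ball ((1 / r) *\<^sub>R (z - y)) 1|lborel. resc \<sigma> r y u x)
     = r powr ((real DIM('a) - 2 * \<sigma>) / 2) * unit_ball_vol (real DIM('a)) * avg (ball z r) u"
proof -
  let ?g = "\<lambda>x. indicator (ball z r) x * u x"
  have gm: "?g \<in> borel_measurable borel"
    by (intro borel_measurable_times borel_measurable_indicator um) simp
  have gT: "(\<lambda>x. ?g (y + r *\<^sub>R x)) \<in> borel_measurable borel"
    by (rule measurable_compose[OF _ gm]) simp
  have "(LINT x|lborel. ?g x) = (LINT x|density (distr lborel borel (\<lambda>x. y + r *\<^sub>R x)) (\<lambda>_. \<bar>r\<bar>^DIM('a)). ?g x)"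
    using lborel_affine[of r y] r by simp
  also have "\<dots> = (LINT x|distr lborel borel (\<lambda>x. y + r *\<^sub>R x). (r ^ DIM('a)) *\<^sub>R ?g x)"
    using r gm by (subst integral_density) auto
  also have "\<dots> = r ^ DIM('a) * (LINT x|lborel. ?g (y + r *\<^sub>R x))"
    using gm by (subst integral_distr) auto
  finally have 1: "(LINT x|lborel. ?g x) = r ^ DIM('a) * (LINT x|lborel. ?g (y + r *\<^sub>R x))" .
  have mem: "y + r *\<^sub>R x \<in> ball z r \<longleftrightarrow> x \<in> ball ((1 / r) *\<^sub>R (z - y)) 1" for x
  proof -
    have "z - (y + r *\<^sub>R x) = r *\<^sub>R ((1 / r) *\<^sub>R (z - y) - x)" using r by (simp add: algebra_simps)
    then have "norm (z - (y + r *\<^sub>R x)) = r * norm ((1 / r) *\<^sub>R (z - y) - x)" using r by (metis norm_scaleR abs_of_pos)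
    then show ?thesis using r by (simp add: dist_norm)
  qed
  have "(LINT x:ball ((1 / r) *\<^sub>R (z - y)) 1|lborel. resc \<sigma> r y u x)
     = (LINT x|lborel. r powr ((real DIM('a) - 2 * \<sigma>) / 2) * ?g (y + r *\<^sub>R x))"
    unfolding set_lebesgue_integral_def
  proof (intro Bochner_Integration.integral_cong refl)
    fix x
    have "indicator (ball z r) (y + r *\<^sub>R x) = (indicator (ball ((1 / r) *\<^sub>R (z - y)) 1) x :: real)"
      by (simp only: indicator_def mem)
    then show "indicator (ball ((1 / r) *\<^sub>R (z - y)) 1) x *\<^sub>R resc \<sigma> r y u x = r powr ((real DIM('a) - 2 * \<sigma>) / 2) * ?g (y + r *\<^sub>R x)"
      by (simp only: resc_def real_scaleR_def ac_simps)
  qed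
  also have "\<dots> = r powr ((real DIM('a) - 2 * \<sigma>) / 2) * (LINT x|lborel. ?g (y + r *\<^sub>R x))" by simp
  also have "(LINT x|lborel. ?g (y + r *\<^sub>R x)) = unit_ball_vol (real DIM('a)) * avg (ball z r) u"
  proof -
    have "measure lborel (ball z r) = unit_ball_vol (real DIM('a)) * r ^ DIM('a)"
      using content_ball[of r z] r by simp
    then have "avg (ball z r) u = (r ^ DIM('a) * (LINT x|lborel. ?g (y + r *\<^sub>R x))) / (unit_ball_vol (real DIM('a)) * r ^ DIM('a))"
      unfolding avg_def set_lebesgue_integral_def real_scaleR_def 1 by (simp only:)
    moreover have "a = V * (b * a / (V * b))" if "V \<noteq> 0" "b \<noteq> 0" for a b V :: real using that by simp
    moreover have "unit_ball_vol (real DIM('a)) \<noteq> 0" using unit_ball_vol_pos[of "real DIM('a)"] by linarith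
    ultimately show ?thesis using r by (metis power_not_zero less_irrefl)
  qed
  finally show ?thesis by simp
qed

section \<open>Concentration\<close>

text \<open>Contraposition of \<open>improved_Sobolev\<close> with \<open>M\<close> so small that
  the resulting mass bound would fall below \<open>L\<close>. The critical scaling turns the large
  average into an integral of size at least \<open>c\<close> over a unit ball, and
  \<open>r k < z k \<bullet> en\<close> records that the original ball lies in the half
  space.\<close>

lemma concentration:
  fixes \<phi> :: "nat \<Rightarrow> 'a::euclidean_space \<Rightarrow> real"
  assumes \<sigma>: "0 < \<sigma>" "2 * \<sigma> < real DIM('a)"
    and \<phi>: "\<And>k. \<phi> k \<in> C1c halfspace" and B: "0 \<le> B" "\<And>k. Ifrac \<sigma> halfspace (\<phi> k) \<le> ennreal B"
    and L: "0 < L" "\<And>k. ennreal L \<le> Lpow (pcrit \<sigma> TYPE('a)) halfspace (\<phi> k)"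
  obtains c z r where "0 < c" "\<And>k. 0 < r k" "\<And>k. r k < z k \<bullet> en"
    "\<And>k y. c \<le> \<bar>LINT x:ball ((1 / r k) *\<^sub>R (z k - y)) 1|lborel. resc \<sigma> (r k) y (\<phi> k) x\<bar>"
proof -
  let ?n = "real DIM('a)" and ?p = "pcrit \<sigma> TYPE('a)"
  obtain C where C: "0 < C"
    "\<And>(u :: 'a \<Rightarrow> real) M. u \<in> C1c halfspace \<Longrightarrow> 0 < M \<Longrightarrow>
      (\<And>x r. x \<in> halfspace \<Longrightarrow> 0 < r \<Longrightarrow> \<bar>avg (ball (x + r *\<^sub>R en) r) u\<bar> \<le> M * r powr (- (?n - 2 * \<sigma>) / 2)) \<Longrightarrow>
      Lpow ?p halfspace u \<le> ennreal (C * M powr (?p - 2)) * Ifrac \<sigma> halfspace u"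
    using improved_Sobolev[OF \<sigma>] by metis
  have p2: "0 < ?p - 2" using pcrit_facts[OF \<sigma>] by simp
  \<comment> \<open>Then C M^(p-2) B equals L B / (2 (B + 1)), which is below \<open>L\<close> even
    for \<open>B = 0\<close>.\<close>
  define M where "M = (L / (2 * C * (B + 1))) powr (1 / (?p - 2))"
  have M: "0 < M" using L C B by (simp add: M_def)
  have Mp: "C * M powr (?p - 2) * B < L"
  proof -
    have "M powr (?p - 2) = L / (2 * C * (B + 1))"
      unfolding M_def powr_powr using p2 L C B by simp
    moreover have "C * (L / (2 * C * D)) * B = L * (B / (2 * D))" for D using C(1) by simp
    ultimately have "C * M powr (?p - 2) * B = L * (B / (2 * (B + 1)))" by (simp only:)
    also have "\<dots> < L * 1" using L B by (intro mult_strict_left_mono) auto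
    finally show ?thesis by simp
  qed
  have "\<exists>x r. x \<in> halfspace \<and> 0 < r \<and> M * r powr (- (?n - 2 * \<sigma>) / 2) < \<bar>avg (ball (x + r *\<^sub>R en) r) (\<phi> k)\<bar>" for k
  proof (rule ccontr)
    assume "\<not> ?thesis"
    then have "Lpow ?p halfspace (\<phi> k) \<le> ennreal (C * M powr (?p - 2)) * Ifrac \<sigma> halfspace (\<phi> k)"
      by (intro C(2)[OF \<phi> M]) (meson not_less)
    also have "\<dots> \<le> ennreal (C * M powr (?p - 2)) * ennreal B" by (intro mult_left_mono B) simp
    also have "\<dots> = ennreal (C * M powr (?p - 2) * B)" using C B by (intro ennreal_mult[symmetric]) auto
    also have "\<dots> < ennreal L" using Mp L by (intro ennreal_lessI) auto
    finally show False using L(2)[of k] by simp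
  qed
  then obtain x r where xr: "\<And>k. x k \<in> halfspace" "\<And>k. 0 < r k"
    "\<And>k. M * r k powr (- (?n - 2 * \<sigma>) / 2) < \<bar>avg (ball (x k + r k *\<^sub>R en) (r k)) (\<phi> k)\<bar>" by metis
  let ?V = "unit_ball_vol ?n"
  have V: "0 < ?V" by simp
  show thesis
  proof (rule that[of "?V * M" r "\<lambda>k. x k + r k *\<^sub>R en"])
    show "0 < ?V * M" using V M by (rule mult_pos_pos)
    show "0 < r k" for k by (rule xr)
    show "r k < (x k + r k *\<^sub>R en) \<bullet> en" for k
      using xr(1)[of k] by (simp add: inner_add_left halfspace_def)
    fix k y
    let ?a = "avg (ball (x k + r k *\<^sub>R en) (r k)) (\<phi> k)" and ?s = "r k powr ((?n - 2 * \<sigma>) / 2)"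
    have s: "0 < ?s" using xr(2)[of k] by simp
    have "- (?n - 2 * \<sigma>) / 2 = - ((?n - 2 * \<sigma>) / 2)" by (simp only: minus_divide_left)
    then have "r k powr (- (?n - 2 * \<sigma>) / 2) = 1 / ?s" by (simp only: powr_minus_divide)
    then have "M / ?s < \<bar>?a\<bar>" using xr(3)[of k] by simp
    then have "M \<le> ?s * \<bar>?a\<bar>" using s by (simp add: field_simps)
    then have "?V * M \<le> ?V * (?s * \<bar>?a\<bar>)" using V by (intro mult_left_mono) auto
    also have "\<dots> = \<bar>?s * ?V * ?a\<bar>" using V s by (simp add: abs_mult)
    also have "\<dots> = \<bar>LINT x':ball ((1 / r k) *\<^sub>R ((x k + r k *\<^sub>R en) - y)) 1|lborel. resc \<sigma> (r k) y (\<phi> k) x'\<bar>"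
      by (subst integral_ball_resc[OF C1c_measurable[OF \<phi>] xr(2)]) simp
    finally show "?V * M \<le> \<bar>LINT x':ball ((1 / r k) *\<^sub>R ((x k + r k *\<^sub>R en) - y)) 1|lborel. resc \<sigma> (r k) y (\<phi> k) x'\<bar>" .
  qed
qed

text \<open>The rescaled half spaces differ from term to term. Extending evenly before rescaling
  puts all terms on the whole space, where one form bound, enlarged by the factor 4, and one mass
  bound hold, as \<open>Rellich\<close> demands.\<close>

lemma AE_subseq_limit:
  fixes \<phi> :: "nat \<Rightarrow> 'a::euclidean_space \<Rightarrow> real"
  assumes \<sigma>: "0 < \<sigma>" "2 * \<sigma> < real DIM('a)"
    and \<phi>: "\<And>k. \<phi> k \<in> C1c halfspace" and B: "0 \<le> B" "\<And>k. Ifrac \<sigma> halfspace (\<phi> k) \<le> ennreal B"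
    "\<And>k. Lpow (pcrit \<sigma> TYPE('a)) halfspace (\<phi> k) \<le> ennreal B" and r: "\<And>k. 0 < r k"
  obtains s U where "strict_mono (s :: nat \<Rightarrow> nat)" "U \<in> borel_measurable borel"
    "\<And>k. resc \<sigma> (r k) (y k) (evenext (\<phi> k)) \<in> C1c UNIV"
    "\<And>k. Ifrac \<sigma> UNIV (resc \<sigma> (r k) (y k) (evenext (\<phi> k))) \<le> ennreal (4 * B)"
    "AE x in lborel. (\<lambda>k. resc \<sigma> (r (s k)) (y (s k)) (evenext (\<phi> (s k))) x) \<longlonglongrightarrow> U x"
proof -
  let ?p = "pcrit \<sigma> TYPE('a)"
  have p: "2 < ?p" using pcrit_facts[OF \<sigma>] by simp
  define \<Psi> where "\<Psi> k = resc \<sigma> (r k) (y k) (evenext (\<phi> k))" for k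
  have em: "evenext (\<phi> k) \<in> borel_measurable borel" for k by (rule evenext_measurable[OF C1c_measurable[OF \<phi>]])
  have \<Psi>: "\<Psi> k \<in> C1c UNIV" for k
    using C1c_resc[where r="r k" and t="y k" and \<sigma>=\<sigma>, OF C1c_evenext[OF \<phi>[of k]] r] by (simp add: \<Psi>_def)
  have I: "Ifrac \<sigma> UNIV (\<Psi> k) \<le> ennreal (4 * B)" for k
  proof -
    have "Ifrac \<sigma> UNIV (\<Psi> k) = Ifrac \<sigma> UNIV (evenext (\<phi> k))"
      using Ifrac_resc[where r="r k" and \<Omega>=UNIV and t="y k" and \<sigma>=\<sigma>, OF em[of k] _ r] by (simp add: \<Psi>_def)
    also have "\<dots> \<le> 4 * Ifrac \<sigma> halfspace (\<phi> k)"
      by (rule Ifrac_evenext_le[OF C1c_measurable[OF \<phi>] C1c_vanish[OF \<phi>] \<sigma>(1)])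
    also have "\<dots> \<le> 4 * ennreal B" by (intro mult_left_mono B) simp
    also have "\<dots> = ennreal (4 * B)" using B(1) by (simp add: ennreal_mult)
    finally show ?thesis .
  qed
  have "0 < ?p" using p by simp
  obtain C where C: "0 \<le> C" "\<And>u :: 'a \<Rightarrow> real. u \<in> borel_measurable borel \<Longrightarrow> (\<And>x. x \<notin> halfspace \<Longrightarrow> u x = 0) \<Longrightarrow>
    Lpow ?p UNIV (evenext u) \<le> ennreal C * Lpow ?p halfspace u"
    using Lpow_evenext_le[OF \<open>0 < ?p\<close>] by metis
  have Lp: "Lpow ?p UNIV (\<Psi> k) \<le> ennreal (C * B)" for k
  proof -
    have "Lpow ?p UNIV (\<Psi> k) = Lpow ?p UNIV (evenext (\<phi> k))"
      using Lpow_resc[where r="r k" and \<Omega>=UNIV and t="y k" and \<sigma>=\<sigma>, OF em[of k] _ r \<sigma>(2)] by (simp add: \<Psi>_def)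
    also have "\<dots> \<le> ennreal C * Lpow ?p halfspace (\<phi> k)"
      by (rule C(2)[OF C1c_measurable[OF \<phi>] C1c_vanish[OF \<phi>]])
    also have "\<dots> \<le> ennreal C * ennreal B" by (intro mult_left_mono B) simp
    also have "\<dots> = ennreal (C * B)" using B(1) C(1) by (simp add: ennreal_mult)
    finally show ?thesis .
  qed
  let ?B = "max (4 * B) (C * B)"
  have B0: "0 \<le> ?B" using B(1) by simp
  have I': "Ifrac \<sigma> UNIV (\<Psi> k) \<le> ennreal ?B" for k
    using I[of k] by (rule order_trans) (intro ennreal_leI max.cobounded1)
  have L': "Lpow ?p UNIV (\<Psi> k) \<le> ennreal ?B" for k
    using Lp[of k] by (rule order_trans) (intro ennreal_leI max.cobounded2)
  have p1: "1 \<le> ?p" using p by simp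
  obtain s U where s: "strict_mono (s :: nat \<Rightarrow> nat)" and U: "U \<in> borel_measurable borel"
    and lim: "AE x in lborel. (\<lambda>k. \<Psi> (s k) x) \<longlonglongrightarrow> U x"
    by (rule Rellich[where w=\<Psi> and p="?p" and B="?B", OF \<Psi> \<sigma>(1) p1 B0 I' L']) (rule that; assumption)
  show thesis
    by (rule that[OF s U \<Psi>[unfolded \<Psi>_def] I[unfolded \<Psi>_def] lim[unfolded \<Psi>_def]])
qed

lemma halfspace_vimage:
  assumes "0 < r"
  shows "(\<lambda>x. y + r *\<^sub>R x) -` halfspace = {x :: 'a::euclidean_space. - (y \<bullet> en) / r < x \<bullet> en}"
  using assms by (auto simp: halfspace_def inner_add_left field_simps)

lemma resc_evenext_eq:
  assumes "\<phi> \<in> C1c halfspace" "y + r *\<^sub>R x \<in> halfspace"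
  shows "resc \<sigma> r y (evenext \<phi>) x = resc \<sigma> r y \<phi> x"
  unfolding resc_def using evenext_half[OF C1c_vanish[OF assms(1)] assms(2)] by simp

text \<open>Recentring at \<open>z k\<close> makes the rescaled half spaces exhaust the space, so
  the form of \<open>U\<close> is bounded below by \<open>Sfull\<close> while the remainder still
  obeys \<open>Shalf\<close>. With a profile of mass l > 0 the two costs add up to more than S
  L^(2/p) = 1.\<close>

lemma interior_case_impossible:
  fixes \<phi> :: "nat \<Rightarrow> 'a::euclidean_space \<Rightarrow> real"
  assumes \<sigma>: "0 < \<sigma>" "2 * \<sigma> < real DIM('a)"
    and S: "0 < Shalf \<sigma> TYPE('a)" "Shalf \<sigma> TYPE('a) < Sfull \<sigma> TYPE('a)"
    and \<phi>: "\<And>k. \<phi> k \<in> C1c halfspace" and B: "0 \<le> B" "\<And>k. Ifrac \<sigma> halfspace (\<phi> k) \<le> ennreal B"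
    "\<And>k. Lpow (pcrit \<sigma> TYPE('a)) halfspace (\<phi> k) \<le> ennreal B"
    and I: "(\<lambda>k. enn2real (Ifrac \<sigma> halfspace (\<phi> k))) \<longlonglongrightarrow> 1"
    and L: "(\<lambda>k. enn2real (Lpow (pcrit \<sigma> TYPE('a)) halfspace (\<phi> k))) \<longlonglongrightarrow> L"
    and SL: "Shalf \<sigma> TYPE('a) * L powr ((real DIM('a) - 2 * \<sigma>) / real DIM('a)) = 1"
    and r: "\<And>k. 0 < r k" and c: "0 < c"
    "\<And>k y. c \<le> \<bar>LINT x:ball ((1 / r k) *\<^sub>R (z k - y)) 1|lborel. resc \<sigma> (r k) y (\<phi> k) x\<bar>"
    and t: "filterlim (\<lambda>k. z k \<bullet> en / r k) at_top sequentially"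
  shows False
proof -
  let ?p = "pcrit \<sigma> TYPE('a)" and ?al = "(real DIM('a) - 2 * \<sigma>) / real DIM('a)"
  let ?S = "Shalf \<sigma> TYPE('a)" and ?F = "Sfull \<sigma> TYPE('a)"
  note pf = pcrit_facts[OF \<sigma>]
  define \<Psi> where "\<Psi> k = resc \<sigma> (r k) (z k) (evenext (\<phi> k))" for k
  obtain s U where s: "strict_mono (s :: nat \<Rightarrow> nat)" and U: "U \<in> borel_measurable borel"
    and \<Psi>: "\<And>k. \<Psi> k \<in> C1c UNIV" and I\<Psi>: "\<And>k. Ifrac \<sigma> UNIV (\<Psi> k) \<le> ennreal (4 * B)"
    and lim: "AE x in lborel. (\<lambda>k. \<Psi> (s k) x) \<longlonglongrightarrow> U x"
    by (rule AE_subseq_limit[where r=r and y=z and \<phi>=\<phi> and B=B, OF \<sigma> \<phi> B r, folded \<Psi>_def]) (rule that; assumption)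
  have B4: "0 \<le> 4 * B" using B(1) by simp
  have UNm: "UNIV \<in> sets (borel :: 'a measure)" by simp
  have lim': "AE x in lborel. x \<in> UNIV \<longrightarrow> (\<lambda>k. \<Psi> (s k) x) \<longlonglongrightarrow> U x" using lim by simp
  obtain w e where w: "\<And>m. w m \<in> C1c UNIV" "e \<longlonglongrightarrow> 0" "\<And>m. 0 \<le> e m" "\<And>m. Ifrac \<sigma> UNIV (\<lambda>x. w m x - U x) \<le> ennreal (e m)"
    by (rule C1c_approx[where f="\<lambda>k. \<Psi> (s k)" and B="4 * B" and \<Omega>=UNIV and U=U and \<sigma>=\<sigma>, OF \<Psi> UNm B4 I\<Psi> U lim'])
       (rule that; assumption)
  define \<psi> where "\<psi> k = resc \<sigma> (r (s k)) (z (s k)) (\<phi> (s k))" for k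
  define \<Omega>s where "\<Omega>s k = (\<lambda>x. z (s k) + r (s k) *\<^sub>R x) -` (halfspace :: 'a set)" for k
  have \<phi>m: "\<phi> k \<in> borel_measurable borel" for k by (rule C1c_measurable[OF \<phi>])
  have ts: "filterlim (\<lambda>k. z (s k) \<bullet> en / r (s k)) at_top sequentially"
    using filterlim_compose[OF t filterlim_subseq[OF s]] by (simp add: o_def)
  have \<Omega>m: "\<Omega>s k \<in> sets borel" for k
    using measurable_sets_borel[of "\<lambda>x. z (s k) + r (s k) *\<^sub>R x" borel halfspace] by (simp add: \<Omega>s_def)
  have \<psi>: "\<psi> k \<in> C1c (\<Omega>s k)" for k
    unfolding \<psi>_def \<Omega>s_def by (rule C1c_resc[OF \<phi> r])
  have I\<psi>: "Ifrac \<sigma> (\<Omega>s k) (\<psi> k) = Ifrac \<sigma> halfspace (\<phi> (s k))" for k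
    unfolding \<psi>_def \<Omega>s_def by (rule Ifrac_resc[OF \<phi>m halfspace_sets r])
  have L\<psi>: "Lpow ?p (\<Omega>s k) (\<psi> k) = Lpow ?p halfspace (\<phi> (s k))" for k
    unfolding \<psi>_def \<Omega>s_def by (rule Lpow_resc[OF \<phi>m halfspace_sets r \<sigma>(2)])
  \<comment> \<open>The pulled-back half space is the set of points whose height exceeds minus
    \<open>z (s k) \<bullet> en / r (s k)\<close>, and this threshold tends to minus
    infinity.\<close>
  have ev: "\<forall>\<^sub>F k in sequentially. K \<subseteq> \<Omega>s k" if K: "compact K" for K
  proof -
    obtain b where b: "\<And>x. x \<in> K \<Longrightarrow> norm x \<le> b" using compact_imp_bounded[OF K] by (auto simp: bounded_iff)
    have "\<forall>\<^sub>F k in sequentially. b < z (s k) \<bullet> en / r (s k)"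
      using ts by (simp add: filterlim_at_top_dense)
    then show ?thesis
    proof eventually_elim
      case (elim k)
      show ?case unfolding \<Omega>s_def halfspace_vimage[OF r]
      proof clarify
        fix x assume "x \<in> K"
        then have "\<bar>x \<bullet> en\<bar> \<le> b" using b[of x] Basis_le_norm[OF en_Basis, of x] by linarith
        then show "- (z (s k) \<bullet> en) / r (s k) < x \<bullet> en" using elim by simp
      qed
    qed
  qed
  have lim\<psi>: "AE x in lborel. x \<in> UNIV \<longrightarrow> (\<lambda>k. \<psi> k x) \<longlonglongrightarrow> U x"
    using lim
  proof eventually_elim
    case (elim x)
    have "\<forall>\<^sub>F k in sequentially. \<Psi> (s k) x = \<psi> k x"
      using ev[OF compact_insert[OF compact_empty], of x]
    proof eventually_elim
      case (elim k)
      then show ?case unfolding \<Psi>_def \<psi>_def \<Omega>s_def by (intro resc_evenext_eq \<phi>) auto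
    qed
    with elim have "(\<lambda>k. \<psi> k x) \<longlonglongrightarrow> U x" by (rule Lim_transform_eventually)
    then show ?case by simp
  qed
  have I1: "(\<lambda>k. enn2real (Ifrac \<sigma> (\<Omega>s k) (\<psi> k))) \<longlonglongrightarrow> 1"
    unfolding I\<psi> using LIMSEQ_subseq_LIMSEQ[OF I s] by (simp add: o_def)
  have L1: "(\<lambda>k. enn2real (Lpow ?p (\<Omega>s k) (\<psi> k))) \<longlonglongrightarrow> L"
    unfolding L\<psi> using LIMSEQ_subseq_LIMSEQ[OF L s] by (simp add: o_def)
  have c': "c \<le> \<bar>LINT y:ball 0 1|lborel. \<psi> k y\<bar>" for k
    using c(2)[of "s k" "z (s k)"] by (simp add: \<psi>_def)
  have p1: "1 < ?p" using pf by simp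
  note D = profile_decomposition[where \<psi>=\<psi> and \<Omega>s=\<Omega>s and \<Omega>=UNIV and U=U and w=w and e=e and B=B and E="\<lambda>_. ball 0 1"
      and R=1 and c=c and S="?S" and p="?p" and al="?al" and L=L and \<sigma>=\<sigma>,
      OF p1 pf(2) _ \<Omega>m subset_UNIV ev \<psi> U lim\<psi> B(1) _ _ I1 L1 _ _ w(1,4,2,3) _ _ c(1) c', unfolded I\<psi> L\<psi>]
  have D1: "f \<in> C1c (\<Omega>s k) \<Longrightarrow> ennreal (?S * enn2real (Lpow ?p (\<Omega>s k) f) powr ?al) \<le> Ifrac \<sigma> (\<Omega>s k) f" for k f
    unfolding \<Omega>s_def by (rule Shalf_le_shifted[OF _ r \<sigma>])
  have DD: "Ifrac \<sigma> UNIV U < \<infinity>" "Lpow ?p UNIV U < \<infinity>" "0 < enn2real (Lpow ?p UNIV U)" "enn2real (Lpow ?p UNIV U) \<le> L"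
    "?S * (L - enn2real (Lpow ?p UNIV U)) powr ?al \<le> 1 - enn2real (Ifrac \<sigma> UNIV U)"
    by (rule D; (use B(2,3) D1 S(1) in auto))+
  let ?l = "enn2real (Lpow ?p UNIV U)"
  have p0: "0 < ?p" using pf by simp
  have F: "?F * ?l powr ?al \<le> enn2real (Ifrac \<sigma> UNIV U)"
    by (rule Sfull_le[OF Hfull_I[OF U DD(1,2) p0] DD(2)])
  \<comment> \<open>Weak subadditivity suffices here, and l = L is allowed; the strictness comes
    from the inequality between the two constants.\<close>
  have "L powr ?al \<le> (L - ?l) powr ?al + ?l powr ?al"
  proof (cases "?l = L")
    case False
    then have "0 < L - ?l" using DD(4) by linarith
    then have "(L - ?l + ?l) powr ?al < (L - ?l) powr ?al + ?l powr ?al"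
      by (rule powr_add_less[OF _ DD(3) pf(2,3)])
    then show ?thesis by simp
  qed (use pf in simp)
  then have "?S * L powr ?al \<le> ?S * ((L - ?l) powr ?al + ?l powr ?al)"
    using S(1) by (intro mult_left_mono) auto
  moreover have "?S * ?l powr ?al < ?F * ?l powr ?al" using S(2) DD(3) by (intro mult_strict_right_mono) auto
  ultimately show False using SL F DD(5) by (simp add: distrib_left)
qed

lemma tendsto_0_ennreal_bound:
  fixes f :: "nat \<Rightarrow> ennreal"
  assumes "\<And>k. f k \<le> ennreal (e k)" "e \<longlonglongrightarrow> 0"
  shows "f \<longlonglongrightarrow> 0"
proof (rule tendsto_sandwich[OF _ _ tendsto_const])
  show "(\<lambda>k. ennreal (e k)) \<longlonglongrightarrow> 0" using tendsto_ennrealI[OF assms(2)] by simp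
qed (use assms(1) in auto)

text \<open>Recentring at boundary points leaves the half space invariant, so profile and remainder
  obey the same constant. Strict subadditivity leaves the remainder no mass, equality then gives the
  profile form 1, and the Brezis-Lieb limit of the remaining form, 1 - 1, is strong
  convergence.\<close>

lemma boundary_case:
  fixes \<phi> :: "nat \<Rightarrow> 'a::euclidean_space \<Rightarrow> real"
  assumes \<sigma>: "0 < \<sigma>" "2 * \<sigma> < real DIM('a)"
    and S: "0 < Shalf \<sigma> TYPE('a)"
    and \<phi>: "\<And>k. \<phi> k \<in> C1c halfspace" and B: "0 \<le> B" "\<And>k. Ifrac \<sigma> halfspace (\<phi> k) \<le> ennreal B"
    "\<And>k. Lpow (pcrit \<sigma> TYPE('a)) halfspace (\<phi> k) \<le> ennreal B"
    and I: "(\<lambda>k. enn2real (Ifrac \<sigma> halfspace (\<phi> k))) \<longlonglongrightarrow> 1"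
    and L: "(\<lambda>k. enn2real (Lpow (pcrit \<sigma> TYPE('a)) halfspace (\<phi> k))) \<longlonglongrightarrow> L"
    and SL: "Shalf \<sigma> TYPE('a) * L powr ((real DIM('a) - 2 * \<sigma>) / real DIM('a)) = 1"
    and r: "\<And>k. 0 < r k" "\<And>k. r k < z k \<bullet> en" and c: "0 < c"
    "\<And>k y. c \<le> \<bar>LINT x:ball ((1 / r k) *\<^sub>R (z k - y)) 1|lborel. resc \<sigma> (r k) y (\<phi> k) x\<bar>"
    and t: "\<And>k. z k \<bullet> en / r k \<le> T"
  obtains s y v where "strict_mono (s :: nat \<Rightarrow> nat)" "\<And>k. y k \<bullet> en = 0" "v \<in> Hhalf \<sigma>"
    "(\<lambda>k. Ifrac \<sigma> halfspace (\<lambda>x. resc \<sigma> (r (s k)) (y k) (\<phi> (s k)) x - v x)) \<longlonglongrightarrow> 0"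
    "Ifrac \<sigma> halfspace v = 1" "Lpow (pcrit \<sigma> TYPE('a)) halfspace v < \<infinity>"
    "enn2real (Lpow (pcrit \<sigma> TYPE('a)) halfspace v) = L" "0 < L"
proof -
  let ?p = "pcrit \<sigma> TYPE('a)" and ?al = "(real DIM('a) - 2 * \<sigma>) / real DIM('a)"
  let ?S = "Shalf \<sigma> TYPE('a)" and ?H = "halfspace :: 'a set"
  note pf = pcrit_facts[OF \<sigma>]
  have p0: "0 < ?p" and p1: "1 < ?p" using pf by simp_all
  \<comment> \<open>The projection of the ball's centre on the boundary hyperplane.\<close>
  define y where "y k = z k - (z k \<bullet> en) *\<^sub>R en" for k
  have yen: "y k \<bullet> en = 0" for k by (simp add: y_def inner_diff_left)
  have vim: "(\<lambda>x. y k + r k *\<^sub>R x) -` ?H = ?H" for k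
    unfolding halfspace_vimage[OF r(1)] yen by (simp add: halfspace_def)
  define \<Psi> where "\<Psi> k = resc \<sigma> (r k) (y k) (evenext (\<phi> k))" for k
  obtain s U where s: "strict_mono (s :: nat \<Rightarrow> nat)" and U: "U \<in> borel_measurable borel"
    and \<Psi>: "\<And>k. \<Psi> k \<in> C1c UNIV" and I\<Psi>: "\<And>k. Ifrac \<sigma> UNIV (\<Psi> k) \<le> ennreal (4 * B)"
    and lim: "AE x in lborel. (\<lambda>k. \<Psi> (s k) x) \<longlonglongrightarrow> U x"
    by (rule AE_subseq_limit[where r=r and y=y and \<phi>=\<phi> and B=B, OF \<sigma> \<phi> B r(1), folded \<Psi>_def]) (rule that; assumption)
  define \<psi> where "\<psi> k = resc \<sigma> (r (s k)) (y (s k)) (\<phi> (s k))" for k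
  have \<phi>m: "\<phi> k \<in> borel_measurable borel" for k by (rule C1c_measurable[OF \<phi>])
  have \<psi>: "\<psi> k \<in> C1c ?H" for k
    using C1c_resc[where r="r (s k)" and t="y (s k)" and \<sigma>=\<sigma>, OF \<phi>[of "s k"] r(1)] unfolding vim \<psi>_def .
  have I\<psi>: "Ifrac \<sigma> ?H (\<psi> k) = Ifrac \<sigma> ?H (\<phi> (s k))" for k
    using Ifrac_resc[where r="r (s k)" and t="y (s k)" and \<sigma>=\<sigma>, OF \<phi>m[of "s k"] halfspace_sets r(1)] unfolding vim \<psi>_def .
  have L\<psi>: "Lpow ?p ?H (\<psi> k) = Lpow ?p ?H (\<phi> (s k))" for k
    using Lpow_resc[where r="r (s k)" and t="y (s k)" and \<sigma>=\<sigma>, OF \<phi>m[of "s k"] halfspace_sets r(1) \<sigma>(2)] unfolding vim \<psi>_def .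
  have I\<psi>B: "Ifrac \<sigma> ?H (\<psi> k) \<le> ennreal B" and L\<psi>B: "Lpow ?p ?H (\<psi> k) \<le> ennreal B" for k
    unfolding I\<psi> L\<psi> by (rule B)+
  have lim\<psi>: "AE x in lborel. x \<in> ?H \<longrightarrow> (\<lambda>k. \<psi> k x) \<longlonglongrightarrow> U x"
    using lim
  proof eventually_elim
    case (elim x)
    show ?case
    proof
      assume x: "x \<in> ?H"
      have "\<psi> k x = \<Psi> (s k) x" for k
        unfolding \<Psi>_def \<psi>_def by (rule resc_evenext_eq[OF \<phi>, symmetric]) (use x vim[of "s k"] in auto)
      then show "(\<lambda>k. \<psi> k x) \<longlonglongrightarrow> U x" using elim by (simp only:)
    qed
  qed
  obtain w e where w: "\<And>m. w m \<in> C1c ?H" and e: "e \<longlonglongrightarrow> 0" "\<And>m. 0 \<le> e m"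
    and wU: "\<And>m. Ifrac \<sigma> ?H (\<lambda>x. w m x - U x) \<le> ennreal (e m)"
    and ww: "\<And>m l. m \<le> l \<Longrightarrow> Ifrac \<sigma> ?H (\<lambda>x. w m x - w l x) \<le> ennreal (e m)"
    and wl: "AE x in lborel. x \<in> ?H \<longrightarrow> (\<lambda>m. w m x) \<longlonglongrightarrow> U x"
    by (rule C1c_approx[where f=\<psi> and B=B and \<Omega>="?H" and U=U and \<sigma>=\<sigma>, OF \<psi> halfspace_sets B(1) I\<psi>B U lim\<psi>])
       (rule that; assumption)
  have I1: "(\<lambda>k. enn2real (Ifrac \<sigma> ?H (\<psi> k))) \<longlonglongrightarrow> 1"
    unfolding I\<psi> using LIMSEQ_subseq_LIMSEQ[OF I s] by (simp add: o_def)
  have L1: "(\<lambda>k. enn2real (Lpow ?p ?H (\<psi> k))) \<longlonglongrightarrow> L"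
    unfolding L\<psi> using LIMSEQ_subseq_LIMSEQ[OF L s] by (simp add: o_def)
  define E where "E k = ball ((1 / r (s k)) *\<^sub>R (z (s k) - y (s k))) 1" for k
  have Es: "E k \<in> sets borel" for k by (simp add: E_def)
  \<comment> \<open>The rescaled centre is a multiple of \<open>en\<close> of length at most
    \<open>T\<close>, and the unit radius adds 1.\<close>
  have Esub: "E k \<subseteq> cball 0 (T + 1)" for k
  proof
    fix x assume "x \<in> E k"
    have "(1 / r (s k)) *\<^sub>R (z (s k) - y (s k)) = (z (s k) \<bullet> en / r (s k)) *\<^sub>R en" by (simp add: y_def)
    moreover have "0 \<le> z (s k) \<bullet> en / r (s k)" using r[of "s k"] by simp
    ultimately have n: "norm ((1 / r (s k)) *\<^sub>R (z (s k) - y (s k))) \<le> T" using t[of "s k"] by simp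
    show "x \<in> cball 0 (T + 1)"
      using \<open>x \<in> E k\<close> n norm_triangle_sub[of x "(1 / r (s k)) *\<^sub>R (z (s k) - y (s k))"]
      by (simp add: E_def dist_norm norm_minus_commute)
  qed
  have c': "c \<le> \<bar>LINT y:E k|lborel. \<psi> k y\<bar>" for k
    using c(2)[of "s k" "y (s k)"] by (simp add: \<psi>_def E_def)
  have Sle: "ennreal (?S * enn2real (Lpow ?p ?H f) powr ?al) \<le> Ifrac \<sigma> ?H f" if "f \<in> C1c ?H" for f
    by (rule Shalf_le[OF C1c_Hhalf[OF that \<sigma>] C1c_Lpow_finite[OF that p0]])
  have evK: "\<forall>\<^sub>F k in sequentially. K \<subseteq> ?H" if "K \<subseteq> ?H" for K using that by simp
  note D = profile_decomposition[where \<psi>=\<psi> and \<Omega>s="\<lambda>_. ?H" and \<Omega>="?H" and U=U and w=w and e=e and B=B and E=E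
      and R="T + 1" and c=c and S="?S" and p="?p" and al="?al" and L=L and \<sigma>=\<sigma>,
      OF p1 pf(2) halfspace_sets halfspace_sets subset_refl evK \<psi> U lim\<psi> B(1) I\<psi>B L\<psi>B I1 L1 Sle less_imp_le[OF S] w wU e Es Esub c(1) c']
  \<comment> \<open>\<open>U\<close> is a limit of even extensions and lives on both sides of the
    hyperplane; elements of \<open>Hhalf\<close> vanish outside the half space.\<close>
  define v where "v x = indicator ?H x * U x" for x
  have vm[measurable]: "v \<in> borel_measurable borel"
    unfolding v_def using U by (intro borel_measurable_times borel_measurable_indicator) auto
  have v0: "v x = 0" if "x \<notin> ?H" for x using that by (simp add: v_def)
  have vU: "v x = U x" if "x \<in> ?H" for x using that by (simp add: v_def)
  have dqv: "dq \<sigma> ?H (\<lambda>x. f x - v x) = dq \<sigma> ?H (\<lambda>x. f x - U x)" and dqv0: "dq \<sigma> ?H v = dq \<sigma> ?H U" for f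
    by (auto simp: dq_def fun_eq_iff indicator_def vU mem_Times_iff)
  have Iv: "Ifrac \<sigma> ?H v = Ifrac \<sigma> ?H U" by (simp add: Ifrac_eq_pint dqv0)
  have Lv: "Lpow ?p ?H v = Lpow ?p ?H U"
    unfolding Lpow_def by (intro nn_integral_cong) (auto simp: vU indicator_def)
  have wm[measurable]: "w m \<in> borel_measurable borel" for m by (rule C1c_measurable[OF w])
  \<comment> \<open>The Sobolev inequality for \<open>w m - w l\<close>, with \<open>?S\<close>
    positive, turns the bound \<open>e m\<close> on the form into a bound on the critical mass;
    Fatou's lemma then sends \<open>l\<close> to infinity.\<close>
  have Lw: "Lpow ?p ?H (\<lambda>x. w m x - v x) \<le> ennreal ((e m / ?S) powr (1 / ?al))" for m
    unfolding Lpow_eq_pint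
  proof (rule pint_Fatou[where f="\<lambda>l x. indicator ?H x * (w m x - w l x)"])
    show "AE x in lborel. (\<lambda>l. indicator ?H x * (w m x - w l x)) \<longlonglongrightarrow> indicator ?H x * (w m x - v x)"
      using wl
    proof eventually_elim
      case (elim x)
      show ?case
      proof (cases "x \<in> ?H")
        case True
        then have "(\<lambda>l. w m x - w l x) \<longlonglongrightarrow> w m x - v x"
          using elim by (auto simp: vU intro: tendsto_diff)
        then show ?thesis using True by simp
      qed simp
    qed
    show "\<forall>\<^sub>F l in sequentially. pint ?p lborel (\<lambda>x. indicator ?H x * (w m x - w l x)) \<le> ennreal ((e m / ?S) powr (1 / ?al))"
      using eventually_ge_at_top[of m]
    proof eventually_elim
      case (elim l)
      have f: "(\<lambda>x. w m x - w l x) \<in> C1c ?H" by (rule C1c_diff[OF w w])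
      let ?q = "Lpow ?p ?H (\<lambda>x. w m x - w l x)"
      have "ennreal (?S * enn2real ?q powr ?al) \<le> ennreal (e m)"
        using Sle[OF f] ww[OF elim] by (rule order_trans)
      then have "enn2real ?q powr ?al \<le> e m / ?S" using S e(2)[of m] by (simp add: field_simps)
      then have "(enn2real ?q powr ?al) powr (1 / ?al) \<le> (e m / ?S) powr (1 / ?al)"
        using pf \<sigma> by (intro powr_mono2) auto
      also have "(enn2real ?q powr ?al) powr (1 / ?al) = enn2real ?q" using \<sigma> by (simp add: powr_powr)
      finally have "ennreal (enn2real ?q) \<le> ennreal ((e m / ?S) powr (1 / ?al))" by (rule ennreal_leI)
      moreover have "?q < \<infinity>" by (rule C1c_Lpow_finite[OF f p0])
      then have "ennreal (enn2real ?q) = ?q" by (simp add: less_top)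
      ultimately show ?case unfolding Lpow_eq_pint[symmetric] by (simp only:)
    qed
  qed (use p0 in \<open>simp_all, measurable\<close>)
  have e1: "(\<lambda>m. (e m / ?S) powr (1 / ?al)) \<longlonglongrightarrow> 0"
  proof -
    have "(\<lambda>m. (e m / ?S) powr (1 / ?al)) \<longlonglongrightarrow> (0 / ?S) powr (1 / ?al)"
      using S \<sigma> e by (intro tendsto_powr' tendsto_divide tendsto_const) auto
    then show ?thesis by simp
  qed
  have vH: "v \<in> Hhalf \<sigma>"
    unfolding Hhalf_def
  proof (intro CollectI conjI exI[of _ w] allI impI)
    show "v \<in> borel_measurable lborel" by simp
    show "(\<lambda>m. Ifrac \<sigma> ?H (\<lambda>x. w m x - v x)) \<longlonglongrightarrow> 0"
      by (rule tendsto_0_ennreal_bound[OF _ e(1)]) (use wU in \<open>simp add: Ifrac_eq_pint dqv\<close>)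
    show "(\<lambda>m. Lpow ?p ?H (\<lambda>x. w m x - v x)) \<longlonglongrightarrow> 0"
      by (rule tendsto_0_ennreal_bound[OF Lw e1])
  qed (use w v0 in auto)
  let ?l = "enn2real (Lpow ?p ?H U)" and ?A = "enn2real (Ifrac \<sigma> ?H U)"
  have Sl: "?S * ?l powr ?al \<le> ?A"
  proof -
    have "ennreal (?S * ?l powr ?al) \<le> Ifrac \<sigma> ?H U"
      using Shalf_le[OF vH] D(2) unfolding Lv Iv by blast
    then have "enn2real (ennreal (?S * ?l powr ?al)) \<le> ?A" using D(1) by (intro enn2real_mono) auto
    then show ?thesis using S by simp
  qed
  \<comment> \<open>Otherwise both masses are positive and the forms of profile and remainder would
    add up to more than \<open>?S * L powr ?al = 1\<close>.\<close>
  have lL: "?l = L"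
  proof (rule ccontr)
    assume "?l \<noteq> L"
    then have "0 < L - ?l" using D(4) by linarith
    then have "(L - ?l + ?l) powr ?al < (L - ?l) powr ?al + ?l powr ?al"
      by (rule powr_add_less[OF _ D(3) pf(2,3)])
    then have "?S * L powr ?al < ?S * ((L - ?l) powr ?al + ?l powr ?al)"
      using S by (intro mult_strict_left_mono) auto
    then show False using SL D(5) Sl by (simp add: distrib_left)
  qed
  have A1: "?A = 1" using D(5) Sl SL unfolding lL by simp
  have conv: "(\<lambda>k. Ifrac \<sigma> ?H (\<lambda>x. \<psi> k x - v x)) \<longlonglongrightarrow> 0"
  proof -
    have eq: "Ifrac \<sigma> ?H (\<lambda>x. \<psi> k x - v x) = pint 2 lborel (\<lambda>z. dq \<sigma> ?H (\<psi> k) z - dq \<sigma> ?H U z)" for k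
      by (simp add: Ifrac_eq_pint dq_diff[abs_def] dqv0)
    have \<psi>m: "\<psi> k \<in> borel_measurable borel" for k by (rule C1c_measurable[OF \<psi>])
    have fin: "pint 2 lborel (\<lambda>z. dq \<sigma> ?H (\<psi> k) z - dq \<sigma> ?H U z) < \<infinity>" for k
    proof (rule pint_diff_finite)
      show "pint 2 lborel (dq \<sigma> ?H (\<psi> k)) < \<infinity>" using I\<psi>B[of k] unfolding Ifrac_eq_pint by (rule le_less_trans) simp
      show "pint 2 lborel (dq \<sigma> ?H U) < \<infinity>" using D(1) by (simp add: Ifrac_eq_pint)
    qed (use U \<psi>m in auto)
    have "(\<lambda>k. ennreal (enn2real (pint 2 lborel (\<lambda>z. dq \<sigma> ?H (\<psi> k) z - dq \<sigma> ?H U z)))) \<longlonglongrightarrow> ennreal (1 - ?A)"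
      by (rule tendsto_ennrealI[OF D(6)])
    then show ?thesis unfolding eq using fin A1 by (simp add: less_top)
  qed
  have "Ifrac \<sigma> ?H v = 1"
  proof -
    have "Ifrac \<sigma> ?H U = ennreal ?A" using D(1) by (simp add: less_top)
    then show ?thesis unfolding Iv A1 by simp
  qed
  moreover have "0 < L" using D(3) lL by simp
  ultimately show thesis
    using that[of s "\<lambda>k. y (s k)" v] s yen vH conv D(2) lL unfolding \<psi>_def Lv by blast
qed

section \<open>Reduction to test functions and conclusion\<close>

lemma Hhalf_approx:
  fixes u :: "'a::euclidean_space \<Rightarrow> real"
  assumes "u \<in> Hhalf \<sigma>" "0 < d"
  shows "\<exists>\<phi> \<in> C1c halfspace. Ifrac \<sigma> halfspace (\<lambda>x. \<phi> x - u x) < ennreal d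
    \<and> Lpow (pcrit \<sigma> TYPE('a)) halfspace (\<lambda>x. \<phi> x - u x) < ennreal d"
proof -
  obtain \<phi> where \<phi>: "\<And>k. \<phi> k \<in> C1c halfspace"
    "(\<lambda>k. Ifrac \<sigma> halfspace (\<lambda>x. \<phi> k x - u x)) \<longlonglongrightarrow> 0"
    "(\<lambda>k. Lpow (pcrit \<sigma> TYPE('a)) halfspace (\<lambda>x. \<phi> k x - u x)) \<longlonglongrightarrow> 0"
    using assms(1) unfolding Hhalf_def by blast
  have d: "0 < ennreal d" using assms(2) by simp
  have "\<forall>\<^sub>F k in sequentially. Ifrac \<sigma> halfspace (\<lambda>x. \<phi> k x - u x) < ennreal d
    \<and> Lpow (pcrit \<sigma> TYPE('a)) halfspace (\<lambda>x. \<phi> k x - u x) < ennreal d"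
    using order_tendstoD(2)[OF \<phi>(2) d] order_tendstoD(2)[OF \<phi>(3) d] by eventually_elim simp
  then show ?thesis using \<phi>(1) by (auto simp: eventually_sequentially)
qed

text \<open>The alternative is decided by the ratio of the height of the concentration ball to its
  radius. If the ratio does not tend to infinity, it is bounded along a subsequence, and the
  boundary case applies to that subsequence.\<close>

lemma minimizing_C1c_compact:
  fixes \<phi> :: "nat \<Rightarrow> 'a::euclidean_space \<Rightarrow> real"
  assumes \<sigma>: "0 < \<sigma>" "2 * \<sigma> < real DIM('a)"
    and S: "0 < Shalf \<sigma> TYPE('a)" "Shalf \<sigma> TYPE('a) < Sfull \<sigma> TYPE('a)"
    and \<phi>: "\<And>k. \<phi> k \<in> C1c halfspace" and B: "0 \<le> B" "\<And>k. Ifrac \<sigma> halfspace (\<phi> k) \<le> ennreal B"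
    "\<And>k. Lpow (pcrit \<sigma> TYPE('a)) halfspace (\<phi> k) \<le> ennreal B"
    and I: "(\<lambda>k. enn2real (Ifrac \<sigma> halfspace (\<phi> k))) \<longlonglongrightarrow> 1"
    and L: "(\<lambda>k. enn2real (Lpow (pcrit \<sigma> TYPE('a)) halfspace (\<phi> k))) \<longlonglongrightarrow> L" "0 < L"
    and SL: "Shalf \<sigma> TYPE('a) * L powr ((real DIM('a) - 2 * \<sigma>) / real DIM('a)) = 1"
  obtains s lam y v where "strict_mono (s :: nat \<Rightarrow> nat)" "\<And>k. 0 < lam k" "\<And>k. y k \<bullet> en = 0" "v \<in> Hhalf \<sigma>"
    "(\<lambda>k. Ifrac \<sigma> halfspace (\<lambda>x. resc \<sigma> (lam k) (y k) (\<phi> (s k)) x - v x)) \<longlonglongrightarrow> 0"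
    "Ifrac \<sigma> halfspace v = 1" "Lpow (pcrit \<sigma> TYPE('a)) halfspace v < \<infinity>"
    "enn2real (Lpow (pcrit \<sigma> TYPE('a)) halfspace v) = L"
proof -
  let ?p = "pcrit \<sigma> TYPE('a)"
  have "\<forall>\<^sub>F k in sequentially. L / 2 < enn2real (Lpow ?p halfspace (\<phi> k))"
    using L by (intro order_tendstoD(1)[OF L(1)]) simp
  then obtain k0 where k0: "\<And>k. k0 \<le> k \<Longrightarrow> L / 2 < enn2real (Lpow ?p halfspace (\<phi> k))"
    by (auto simp: eventually_sequentially)
  \<comment> \<open>Dropping finitely many terms makes the lower bound L/2 on the mass hold for
    every index, as \<open>concentration\<close> demands.\<close>
  define f where "f k = \<phi> (k + k0)" for k
  have f: "f k \<in> C1c halfspace" "Ifrac \<sigma> halfspace (f k) \<le> ennreal B" "Lpow ?p halfspace (f k) \<le> ennreal B" for k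
    unfolding f_def by (rule \<phi> B)+
  have fI: "(\<lambda>k. enn2real (Ifrac \<sigma> halfspace (f k))) \<longlonglongrightarrow> 1"
    and fL: "(\<lambda>k. enn2real (Lpow ?p halfspace (f k))) \<longlonglongrightarrow> L"
    unfolding f_def using LIMSEQ_ignore_initial_segment[OF I, of k0] LIMSEQ_ignore_initial_segment[OF L(1), of k0] by simp_all
  have fL2: "ennreal (L / 2) \<le> Lpow ?p halfspace (f k)" for k
  proof -
    have "ennreal (L / 2) \<le> ennreal (enn2real (Lpow ?p halfspace (f k)))"
      using k0[of "k + k0"] by (intro ennreal_leI) (simp add: f_def)
    also have "\<dots> = Lpow ?p halfspace (f k)"
      using f(3)[of k] by (intro ennreal_enn2real) (auto intro: le_less_trans)
    finally show ?thesis .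
  qed
  have L2: "0 < L / 2" using L by simp
  obtain c z r where c: "0 < c" and r: "\<And>k. 0 < r k" "\<And>k. r k < z k \<bullet> en"
    and cI: "\<And>k y. c \<le> \<bar>LINT x:ball ((1 / r k) *\<^sub>R (z k - y)) 1|lborel. resc \<sigma> (r k) y (f k) x\<bar>"
    by (rule concentration[where \<phi>=f and B=B and L="L/2", OF \<sigma> f(1) B(1) f(2) L2 fL2]) (rule that; assumption)
  have "\<not> filterlim (\<lambda>k. z k \<bullet> en / r k) at_top sequentially"
    using interior_case_impossible[where \<phi>=f and r=r and z=z and c=c and B=B, OF \<sigma> S f(1) B(1) f(2,3) fI fL SL r(1) c cI] by blast
  then obtain T where "\<not> (\<forall>\<^sub>F k in sequentially. T < z k \<bullet> en / r k)"
    unfolding filterlim_at_top_dense by blast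
  then have "\<exists>\<^sub>F k in sequentially. z k \<bullet> en / r k \<le> T" by (simp add: frequently_def not_le)
  then have "infinite {k. z k \<bullet> en / r k \<le> T}"
    by (simp add: cofinite_eq_sequentially[symmetric] frequently_cofinite)
  then obtain q where q: "strict_mono (q :: nat \<Rightarrow> nat)" "\<And>k. z (q k) \<bullet> en / r (q k) \<le> T"
    using infinite_enumerate[of "{k. z k \<bullet> en / r k \<le> T}"] by auto
  have gI: "(\<lambda>k. enn2real (Ifrac \<sigma> halfspace (f (q k)))) \<longlonglongrightarrow> 1"
    and gL: "(\<lambda>k. enn2real (Lpow ?p halfspace (f (q k)))) \<longlonglongrightarrow> L"
    using LIMSEQ_subseq_LIMSEQ[OF fI q(1)] LIMSEQ_subseq_LIMSEQ[OF fL q(1)] by (simp_all add: o_def)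
  obtain s y v where s: "strict_mono (s :: nat \<Rightarrow> nat)" and y: "\<And>k. y k \<bullet> en = 0" and v: "v \<in> Hhalf \<sigma>"
    "(\<lambda>k. Ifrac \<sigma> halfspace (\<lambda>x. resc \<sigma> (r (q (s k))) (y k) (f (q (s k))) x - v x)) \<longlonglongrightarrow> 0"
    "Ifrac \<sigma> halfspace v = 1" "Lpow ?p halfspace v < \<infinity>" "enn2real (Lpow ?p halfspace v) = L"
    by (rule boundary_case[where \<phi>="\<lambda>k. f (q k)" and r="\<lambda>k. r (q k)" and z="\<lambda>k. z (q k)" and c=c and T=T and B=B,
        OF \<sigma> S(1) f(1) B(1) f(2,3) gI gL SL r c cI q(2)]) (rule that; assumption)
  show thesis
  proof (rule that[of "\<lambda>k. q (s k) + k0" "\<lambda>k. r (q (s k))" y v])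
    show "strict_mono (\<lambda>k. q (s k) + k0)"
      using strict_mono_o[OF q(1) s] by (simp add: strict_mono_def)
  qed (use v y r in \<open>simp_all add: f_def\<close>)
qed

theorem theorem1p2:
  fixes \<sigma> :: real and u :: "nat \<Rightarrow> 'a::euclidean_space \<Rightarrow> real"
  assumes "0 < \<sigma>"
    and "DIM('a) = 1 \<Longrightarrow> \<sigma> < 1/2"
    and "DIM('a) \<ge> 2 \<Longrightarrow> \<sigma> < 1 \<and> \<sigma> \<noteq> 1/2"
    and "Shalf \<sigma> TYPE('a) < Sfull \<sigma> TYPE('a)"
    and "\<And>k. u k \<in> Hhalf \<sigma>"
    and "\<And>k. 0 < Lpow (pcrit \<sigma> TYPE('a)) halfspace (u k)"
    and "\<And>k. Lpow (pcrit \<sigma> TYPE('a)) halfspace (u k) < \<infinity>"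
    and "(\<lambda>k. Quot \<sigma> halfspace (u k)) \<longlonglongrightarrow> Shalf \<sigma> TYPE('a)"
    and "\<And>k. Ifrac \<sigma> halfspace (u k) = 1"
  shows "(\<exists>r :: nat \<Rightarrow> nat. \<exists>lam :: nat \<Rightarrow> real. \<exists>a :: nat \<Rightarrow> 'a. \<exists>v.
            strict_mono r \<and> (\<forall>k. 0 < lam k \<and> a k \<bullet> en = 0) \<and> v \<in> Hhalf \<sigma> \<and>
            (\<lambda>k. Ifrac \<sigma> halfspace
               (\<lambda>x. lam k powr ((real DIM('a) - 2 * \<sigma>) / 2) * u (r k) (lam k *\<^sub>R (x - a k)) - v x))
             \<longlonglongrightarrow> 0)
       \<and> (\<exists>w :: 'a \<Rightarrow> real. w \<in> Hhalf \<sigma> \<and> 0 < Lpow (pcrit \<sigma> TYPE('a)) halfspace w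
            \<and> Lpow (pcrit \<sigma> TYPE('a)) halfspace w < \<infinity> \<and> Quot \<sigma> halfspace w = Shalf \<sigma> TYPE('a))"
proof -
  let ?n = "real DIM('a)" and ?p = "pcrit \<sigma> TYPE('a)" and ?H = "halfspace :: 'a set"
  let ?al = "(?n - 2 * \<sigma>) / ?n" and ?S = "Shalf \<sigma> TYPE('a)" and ?F = "Sfull \<sigma> TYPE('a)"
  have \<sigma>: "0 < \<sigma>" "2 * \<sigma> < ?n"
  proof -
    have "1 \<le> DIM('a)" using DIM_positive[where 'a='a] by linarith
    then consider "DIM('a) = 1" | "2 \<le> DIM('a)" by linarith
    then show "2 * \<sigma> < ?n"
    proof cases
      case 1
      then show ?thesis using assms(2) by simp
    next
      case 2
      then have "\<sigma> < 1" "2 \<le> ?n" using assms(3) by simp_all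
      then show ?thesis by linarith
    qed
  qed (rule assms(1))
  note pf = pcrit_facts[OF \<sigma>]
  have p0: "0 < ?p" using pf by simp
  have um: "u k \<in> borel_measurable borel" and u0: "\<And>x. x \<notin> ?H \<Longrightarrow> u k x = 0" for k
    using assms(5)[of k] by (simp_all add: Hhalf_def)
  define l where "l k = enn2real (Lpow ?p ?H (u k))" for k
  have l: "0 < l k" for k unfolding l_def using assms(6,7) by (simp add: enn2real_positive_iff)
  have Q: "Quot \<sigma> ?H (u k) = 1 / l k powr ?al" for k by (simp add: Quot_def l_def assms(9))
  \<comment> \<open>Quotients are nonnegative, so the strict inequality between the constants gives
    \<open>0 < ?F\<close>. Even reflection bounds every quotient below by \<open>?F / 4\<close>, and
    in the limit \<open>?S\<close> is positive.\<close>
  have S0: "0 \<le> ?S"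
    by (rule LIMSEQ_le_const[OF assms(8)]) (simp add: Quot_nonneg)
  have F0: "0 < ?F" using S0 assms(4) by simp
  have "?F / 4 \<le> Quot \<sigma> ?H (u k)" for k
  proof -
    have "?F * l k powr ?al \<le> 4 * enn2real (Ifrac \<sigma> ?H (u k))"
      unfolding l_def by (rule Sfull_le_half[OF um u0 \<sigma> _ _ assms(7)]) (use F0 in \<open>simp_all add: assms(9)\<close>)
    then have "?F * l k powr ?al \<le> 4" by (simp add: assms(9))
    then show ?thesis using l[of k] unfolding Q by (simp add: field_simps)
  qed
  then have "?F / 4 \<le> ?S" by (intro LIMSEQ_le_const[OF assms(8)]) simp
  then have S: "0 < ?S" using F0 by simp
  \<comment> \<open>With form 1 the quotient is the mass to the power -2/p, so the limit of the
    quotients fixes the limit of the masses.\<close>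
  define L where "L = (1 / ?S) powr (1 / ?al)"
  have L: "0 < L" using S by (simp add: L_def)
  have Lal: "L powr ?al = 1 / ?S" unfolding L_def powr_powr using \<sigma> S by simp
  have SL: "?S * L powr ?al = 1" unfolding Lal using S by simp
  have lL: "l \<longlonglongrightarrow> L"
  proof -
    have "(\<lambda>k. (1 / Quot \<sigma> ?H (u k)) powr (1 / ?al)) \<longlonglongrightarrow> (1 / ?S) powr (1 / ?al)"
      using S by (intro tendsto_powr tendsto_divide tendsto_const assms(8)) auto
    moreover have "(1 / Quot \<sigma> ?H (u k)) powr (1 / ?al) = l k" for k
      unfolding Q using l[of k] \<sigma> by (simp add: powr_powr)
    ultimately show ?thesis by (simp add: L_def)
  qed
  \<comment> \<open>Errors at most 1/(k+1) in form and mass leave both limits unchanged. Test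
    functions are integrable and closed under differences and midpoints, which the compactness
    argument uses throughout.\<close>
  have "\<forall>k. \<exists>\<phi> \<in> C1c ?H. Ifrac \<sigma> ?H (\<lambda>x. \<phi> x - u k x) < ennreal (inverse (real (Suc k)))
    \<and> Lpow ?p ?H (\<lambda>x. \<phi> x - u k x) < ennreal (inverse (real (Suc k)))"
    using Hhalf_approx[OF assms(5)] by simp
  then obtain \<phi> where \<phi>: "\<And>k. \<phi> k \<in> C1c ?H"
    and dI: "\<And>k. Ifrac \<sigma> ?H (\<lambda>x. \<phi> k x - u k x) < ennreal (inverse (real (Suc k)))"
    and dL: "\<And>k. Lpow ?p ?H (\<lambda>x. \<phi> k x - u k x) < ennreal (inverse (real (Suc k)))" by metis
  have \<phi>m: "\<phi> k \<in> borel_measurable borel" for k by (rule C1c_measurable[OF \<phi>])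
  have dm: "(\<lambda>x. \<phi> k x - u k x) \<in> borel_measurable borel" for k
    by (intro borel_measurable_diff \<phi>m um)
  have dI0: "(\<lambda>k. Ifrac \<sigma> ?H (\<lambda>x. \<phi> k x - u k x)) \<longlonglongrightarrow> 0"
    by (rule tendsto_0_ennreal_bound[OF less_imp_le[OF dI] LIMSEQ_inverse_real_of_nat])
  have dL0: "(\<lambda>k. Lpow ?p ?H (\<lambda>x. \<phi> k x - u k x)) \<longlonglongrightarrow> 0"
    by (rule tendsto_0_ennreal_bound[OF less_imp_le[OF dL] LIMSEQ_inverse_real_of_nat])
  have dIf: "Ifrac \<sigma> ?H (\<lambda>x. \<phi> k x - u k x) < \<infinity>" and dLf: "Lpow ?p ?H (\<lambda>x. \<phi> k x - u k x) < \<infinity>" for k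
    using dI[of k] dL[of k] by (auto intro: less_trans)
  have \<phi>I: "(\<lambda>k. enn2real (Ifrac \<sigma> ?H (\<phi> k))) \<longlonglongrightarrow> 1"
  proof -
    have "(\<lambda>k. enn2real (pint 2 lborel (\<lambda>z. dq \<sigma> ?H (u k) z + dq \<sigma> ?H (\<lambda>x. \<phi> k x - u k x) z)) - enn2real (pint 2 lborel (dq \<sigma> ?H (u k)))) \<longlonglongrightarrow> 0"
      by (rule pint_perturbation[where B=1 and f="\<lambda>k. dq \<sigma> ?H (u k)" and g="\<lambda>k. dq \<sigma> ?H (\<lambda>x. \<phi> k x - u k x)"])
         (use um dm dIf dI0 assms(9) in \<open>simp_all add: Ifrac_eq_pint\<close>)
    moreover have "(\<lambda>z. dq \<sigma> ?H (u k) z + dq \<sigma> ?H (\<lambda>x. \<phi> k x - u k x) z) = dq \<sigma> ?H (\<phi> k)" for k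
      by (simp add: dq_diff)
    ultimately have "(\<lambda>k. enn2real (Ifrac \<sigma> ?H (\<phi> k)) - 1) \<longlonglongrightarrow> 0"
      using assms(9) by (simp add: Ifrac_eq_pint)
    then show ?thesis by (rule LIM_zero_cancel)
  qed
  obtain B0 where B0: "0 \<le> B0" "\<And>k. l k \<le> B0"
  proof -
    obtain K where "0 < K" "\<And>k. norm (l k) \<le> K"
      using lL convergent_imp_Bseq[of l] by (auto simp: convergent_def Bseq_def)
    then show thesis using that[of K] by (auto simp: abs_le_iff)
  qed
  have \<phi>L: "(\<lambda>k. enn2real (Lpow ?p ?H (\<phi> k))) \<longlonglongrightarrow> L"
  proof -
    have uL: "pint ?p lborel (\<lambda>x. indicator ?H x * u k x) \<le> ennreal B0" for k
    proof -
      have "Lpow ?p ?H (u k) = ennreal (l k)" unfolding l_def using assms(7)[of k] by (simp add: less_top)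
      then show ?thesis using B0(2)[of k] by (simp add: Lpow_eq_pint[symmetric] ennreal_leI)
    qed
    have m1: "(\<lambda>x. indicator ?H x * u k x) \<in> borel_measurable lborel"
      and m2: "(\<lambda>x. indicator ?H x * (\<phi> k x - u k x)) \<in> borel_measurable lborel" for k
      using um dm by (auto intro!: borel_measurable_times borel_measurable_indicator)
    have "(\<lambda>k. enn2real (pint ?p lborel (\<lambda>x. indicator ?H x * u k x + indicator ?H x * (\<phi> k x - u k x))) - enn2real (pint ?p lborel (\<lambda>x. indicator ?H x * u k x))) \<longlonglongrightarrow> 0"
      by (rule pint_perturbation[where B=B0 and f="\<lambda>k x. indicator ?H x * u k x" and g="\<lambda>k x. indicator ?H x * (\<phi> k x - u k x)", OF p0 m1 m2 B0(1) uL])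
         (use dLf dL0 in \<open>simp_all add: Lpow_eq_pint\<close>)
    moreover have "(\<lambda>x. indicator ?H x * u k x + indicator ?H x * (\<phi> k x - u k x)) = (\<lambda>x. indicator ?H x * \<phi> k x)" for k
      by (simp add: algebra_simps)
    ultimately have "(\<lambda>k. enn2real (Lpow ?p ?H (\<phi> k)) - l k) \<longlonglongrightarrow> 0"
      by (simp add: Lpow_eq_pint l_def)
    from tendsto_add[OF this lL] show ?thesis by simp
  qed
  have \<phi>If: "Ifrac \<sigma> ?H (\<phi> k) < \<infinity>" for k
  proof -
    have "pint 2 lborel (\<lambda>z. dq \<sigma> ?H (\<lambda>x. \<phi> k x - u k x) z - (- dq \<sigma> ?H (u k) z)) < \<infinity>"
      by (rule pint_diff_finite) (use um dm dIf[of k] assms(9) in \<open>auto simp: pint_minus Ifrac_eq_pint\<close>)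
    moreover have "(\<lambda>z. dq \<sigma> ?H (\<lambda>x. \<phi> k x - u k x) z - (- dq \<sigma> ?H (u k) z)) = dq \<sigma> ?H (\<phi> k)"
      by (auto simp: dq_diff)
    ultimately show ?thesis by (simp add: Ifrac_eq_pint)
  qed
  have \<phi>Lf: "Lpow ?p ?H (\<phi> k) < \<infinity>" for k by (rule C1c_Lpow_finite[OF \<phi> p0])
  obtain B where B: "0 \<le> B" "\<And>k. Ifrac \<sigma> ?H (\<phi> k) \<le> ennreal B" "\<And>k. Lpow ?p ?H (\<phi> k) \<le> ennreal B"
  proof -
    obtain K1 where K1: "0 < K1" "\<And>k. norm (enn2real (Ifrac \<sigma> ?H (\<phi> k))) \<le> K1"
      using \<phi>I convergent_imp_Bseq[of "\<lambda>k. enn2real (Ifrac \<sigma> ?H (\<phi> k))"] by (auto simp: convergent_def Bseq_def)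
    obtain K2 where K2: "0 < K2" "\<And>k. norm (enn2real (Lpow ?p ?H (\<phi> k))) \<le> K2"
      using \<phi>L convergent_imp_Bseq[of "\<lambda>k. enn2real (Lpow ?p ?H (\<phi> k))"] by (auto simp: convergent_def Bseq_def)
    have "Ifrac \<sigma> ?H (\<phi> k) \<le> ennreal (max K1 K2)" for k
    proof -
      have "Ifrac \<sigma> ?H (\<phi> k) = ennreal (enn2real (Ifrac \<sigma> ?H (\<phi> k)))" using \<phi>If[of k] by (simp add: less_top)
      also have "\<dots> \<le> ennreal (max K1 K2)" using K1(2)[of k] by (intro ennreal_leI) auto
      finally show ?thesis .
    qed
    moreover have "Lpow ?p ?H (\<phi> k) \<le> ennreal (max K1 K2)" for k
    proof -
      have "Lpow ?p ?H (\<phi> k) = ennreal (enn2real (Lpow ?p ?H (\<phi> k)))" using \<phi>Lf[of k] by (simp add: less_top)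
      also have "\<dots> \<le> ennreal (max K1 K2)" using K2(2)[of k] by (intro ennreal_leI) auto
      finally show ?thesis .
    qed
    ultimately show thesis using that[of "max K1 K2"] K1(1) by auto
  qed
  obtain s lam y v where s: "strict_mono (s :: nat \<Rightarrow> nat)" and lam: "\<And>k. 0 < lam k" and y: "\<And>k. y k \<bullet> en = 0" and v: "v \<in> Hhalf \<sigma>"
    and vlim: "(\<lambda>k. Ifrac \<sigma> ?H (\<lambda>x. resc \<sigma> (lam k) (y k) (\<phi> (s k)) x - v x)) \<longlonglongrightarrow> 0"
    and vI: "Ifrac \<sigma> ?H v = 1" and vL: "Lpow ?p ?H v < \<infinity>" "enn2real (Lpow ?p ?H v) = L"
    by (rule minimizing_C1c_compact[where \<phi>=\<phi> and B=B and L=L, OF \<sigma> S assms(4) \<phi> B \<phi>I \<phi>L L SL]) (rule that; assumption)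
  have vm: "v \<in> borel_measurable borel" using v by (simp add: Hhalf_def)
  \<comment> \<open>The rescaling preserves both the form and the half space, so the error
    \<open>\<phi> - u\<close> is as small after it as before.\<close>
  have lim: "(\<lambda>k. Ifrac \<sigma> ?H (\<lambda>x. resc \<sigma> (lam k) (y k) (u (s k)) x - v x)) \<longlonglongrightarrow> 0"
  proof -
    obtain C where C: "0 \<le> C" "\<And>M (f :: 'a \<times> 'a \<Rightarrow> real) g. f \<in> borel_measurable M \<Longrightarrow> g \<in> borel_measurable M \<Longrightarrow>
       pint 2 M (\<lambda>x. f x + g x) \<le> 2 * pint 2 M f + ennreal C * pint 2 M g"
      using pint_add_le[of 2] by (metis zero_less_numeral)
    have vim: "(\<lambda>x. y k + lam k *\<^sub>R x) -` ?H = ?H" for k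
      unfolding halfspace_vimage[OF lam] y by (simp add: halfspace_def)
    have dR: "Ifrac \<sigma> ?H (resc \<sigma> (lam k) (y k) (\<lambda>x. \<phi> (s k) x - u (s k) x)) = Ifrac \<sigma> ?H (\<lambda>x. \<phi> (s k) x - u (s k) x)" for k
      using Ifrac_resc[where r="lam k" and t="y k" and \<sigma>=\<sigma>, OF dm[of "s k"] halfspace_sets lam] unfolding vim .
    let ?R = "\<lambda>k. 2 * Ifrac \<sigma> ?H (\<lambda>x. resc \<sigma> (lam k) (y k) (\<phi> (s k)) x - v x) + ennreal C * Ifrac \<sigma> ?H (\<lambda>x. \<phi> (s k) x - u (s k) x)"
    have le: "Ifrac \<sigma> ?H (\<lambda>x. resc \<sigma> (lam k) (y k) (u (s k)) x - v x) \<le>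
      ?R k" for k
    proof -
      let ?f = "dq \<sigma> ?H (\<lambda>x. resc \<sigma> (lam k) (y k) (\<phi> (s k)) x - v x)"
      let ?g = "dq \<sigma> ?H (resc \<sigma> (lam k) (y k) (\<lambda>x. \<phi> (s k) x - u (s k) x))"
      have "dq \<sigma> ?H (\<lambda>x. resc \<sigma> (lam k) (y k) (u (s k)) x - v x) = (\<lambda>z. ?f z + - ?g z)"
        by (auto simp: dq_diff resc_diff)
      then have "Ifrac \<sigma> ?H (\<lambda>x. resc \<sigma> (lam k) (y k) (u (s k)) x - v x) = pint 2 lborel (\<lambda>z. ?f z + - ?g z)"
        by (simp add: Ifrac_eq_pint)
      also have "\<dots> \<le> 2 * pint 2 lborel ?f + ennreal C * pint 2 lborel (\<lambda>z. - ?g z)"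
      proof (rule C(2))
        show "?f \<in> borel_measurable lborel"
          using dq_measurable[OF borel_measurable_diff[OF resc_measurable[OF \<phi>m] vm] halfspace_sets] by simp
        show "(\<lambda>z. - ?g z) \<in> borel_measurable lborel"
          using borel_measurable_uminus[OF dq_measurable[OF resc_measurable[OF dm] halfspace_sets]] by simp
      qed
      finally show ?thesis unfolding dR[symmetric] by (simp add: pint_minus Ifrac_eq_pint)
    qed
    have "(\<lambda>k. ?R k) \<longlonglongrightarrow> 2 * 0 + ennreal C * 0"
      using LIMSEQ_subseq_LIMSEQ[OF dI0 s] by (intro tendsto_add ennreal_tendsto_cmult vlim) (simp_all add: o_def)
    then have up: "(\<lambda>k. ?R k) \<longlonglongrightarrow> 0"
      by simp
    show ?thesis
      by (rule tendsto_sandwich[OF _ _ tendsto_const up]) (use le in simp_all)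
  qed
  show ?thesis
  proof (intro conjI)
    \<comment> \<open>\<open>resc\<close> evaluates at y + lam x, the claim at lam (x - a); hence a
      = - y / lam, which is still parallel to the boundary.\<close>
    let ?a = "\<lambda>k. - ((1 / lam k) *\<^sub>R y k)"
    have eq: "resc \<sigma> (lam k) (y k) (u (s k)) x = lam k powr ((?n - 2 * \<sigma>) / 2) * u (s k) (lam k *\<^sub>R (x - ?a k))" for k x
    proof -
      have "lam k *\<^sub>R (x - ?a k) = y k + lam k *\<^sub>R x" using lam[of k] by (simp add: algebra_simps)
      then show ?thesis by (simp only: resc_def)
    qed
    show "\<exists>r :: nat \<Rightarrow> nat. \<exists>lam :: nat \<Rightarrow> real. \<exists>a :: nat \<Rightarrow> 'a. \<exists>v.
            strict_mono r \<and> (\<forall>k. 0 < lam k \<and> a k \<bullet> en = 0) \<and> v \<in> Hhalf \<sigma> \<and>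
            (\<lambda>k. Ifrac \<sigma> halfspace
               (\<lambda>x. lam k powr ((real DIM('a) - 2 * \<sigma>) / 2) * u (r k) (lam k *\<^sub>R (x - a k)) - v x))
             \<longlonglongrightarrow> 0"
      by (rule exI[of _ s], rule exI[of _ lam], rule exI[of _ ?a], rule exI[of _ v])
         (use s lam y v lim[unfolded eq] in simp)
    \<comment> \<open>Form 1 and mass \<open>L\<close> give \<open>v\<close> the quotient
      \<open>?S\<close>: the strong limit is itself a minimiser.\<close>
    have "0 < Lpow ?p ?H v" using vL L by (simp add: enn2real_positive_iff)
    moreover have "Quot \<sigma> ?H v = ?S" unfolding Quot_def vI vL(2) Lal using S by simp
    ultimately show "\<exists>w :: 'a \<Rightarrow> real. w \<in> Hhalf \<sigma> \<and> 0 < Lpow (pcrit \<sigma> TYPE('a)) halfspace w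
            \<and> Lpow (pcrit \<sigma> TYPE('a)) halfspace w < \<infinity> \<and> Quot \<sigma> halfspace w = Shalf \<sigma> TYPE('a)"
      using v vL(1) by blast
  qed
qed

end
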